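(* Let $B$ be a Blaschke product in the unit disk $\mathbb{D}$ with zeros $\Lambda$ and let $N$ be a positive integer. The following conditions are equivalent: (a) $B$ is a product of $N$ Nevanlinna interpolating Blaschke products. (b) There exists $H_1\in\mathrm{Har}_+(\mathbb{D})$ such that $|B(z)|\geq e^{-H_1(z)}\rho^N(z,\Lambda)$ for all $z\in\mathbb{D}$. (c) There exists $H_2\in\mathrm{Har}_+(\mathbb{D})$ such that $|B(N)(z)|\geq e^{-H_2(z)}$ for all $z\in\mathbb{D}$. (d) There exists $H_3\in\mathrm{Har}_+(\mathbb{D})$ such that $$\sum_{j=0}^{N}(1-|z|)^j|B^{(j)}(z)|\geq e^{-H_3(z)},\qquad z\in\mathbb{D}.$$
   Context: $\mathrm{Har}_+(\mathbb{D})$ is the cone of positive harmonic functions in $\mathbb{D}$. The pseudohyperbolic distance is $\rho(z,w)=\left|\frac{z-w}{1-\bar z w}\right|$, $\rho(z,\Lambda)=\inf_{\lambda\in\Lambda}\rho(z,\lambda)$ (read as $1$ if $\Lambda=\emptyset$), and $\rho^N(z,\Lambda)=(\rho(z,\Lambda))^N$. Zeros are counted with multiplicity. For $z\in\mathbb{D}$, $|B(N)(z)|$ denotes the value at $z$ of the modulus of the Blaschke product obtained from $B$ by deleting the $N$ zeros of $B$ that are closest to $z$ in the pseudohyperbolic metric (all the zeros, if there are fewer than $N$). $B^{(j)}$ is the $j$-th derivative of $B$. The Nevanlinna class $\mathcal{N}$ is the set of analytic functions $f$ in $\mathbb{D}$ such that $\log^+|f|$ has a harmonic majorant in $\mathbb{D}$.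 For a sequence $\{\lambda_k\}_k$ in $\mathbb{D}$, let $W(\{\lambda_k\})$ be the set of complex sequences $\{w_k\}_k$ for which there is $H\in\mathrm{Har}_+(\mathbb{D})$ with $\log^+|w_k|\leq H(\lambda_k)$ for all $k$. A sequence $\{\lambda_k\}_k$ of distinct points of $\mathbb{D}$ is interpolating for $\mathcal{N}$ if for every $\{w_k\}_k\in W(\{\lambda_k\})$ there is $f\in\mathcal{N}$ with $f(\lambda_k)=w_k$ for all $k$. A Nevanlinna interpolating Blaschke product is a Blaschke product whose zeros (all simple) form a sequence interpolating for $\mathcal{N}$; finite and empty sequences (hence constant factors) are allowed. *)

theory Defs
  imports "HOL-Complex_Analysis.Complex_Analysis"
begin

abbreviation unit_disc :: "complex set" ("\<D>") where
  "\<D> \<equiv> ball 0 1"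

(* Twice continuously differentiable with vanishing Laplacian.  S is meant to be open;
   p and q are the first partials of u, and pp, pq, qp, qq the second ones. *)
definition harmonic_on :: "(complex \<Rightarrow> real) \<Rightarrow> complex set \<Rightarrow> bool" where
  "harmonic_on u S \<longleftrightarrow> (\<exists>p q pp pq qp qq :: complex \<Rightarrow> real.
     continuous_on S pp \<and> continuous_on S pq \<and> continuous_on S qp \<and> continuous_on S qq \<and>
     (\<forall>z\<in>S. (u has_derivative (\<lambda>h. p z * Re h + q z * Im h)) (at z) \<and>
             (p has_derivative (\<lambda>h. pp z * Re h + pq z * Im h)) (at z) \<and>
             (q has_derivative (\<lambda>h. qp z * Re h + qq z * Im h)) (at z) \<and>
             pp z + qq z = 0))"

definition Har_pos :: "(complex \<Rightarrow> real) set" where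
  "Har_pos = {H. harmonic_on H \<D> \<and> (\<forall>z\<in>\<D>. H z > 0)}"

(* Since ln 0 = 0, log_plus 0 = 0 as it should be. *)
definition log_plus :: "real \<Rightarrow> real" where
  "log_plus x = max 0 (ln x)"

definition nevanlinna_class :: "(complex \<Rightarrow> complex) set" where
  "nevanlinna_class = {f. f holomorphic_on \<D> \<and>
     (\<exists>h. harmonic_on h \<D> \<and> (\<forall>z\<in>\<D>. log_plus (norm (f z)) \<le> h z))}"

definition pseudohyp :: "complex \<Rightarrow> complex \<Rightarrow> real" where
  "pseudohyp z w = norm ((z - w) / (1 - cnj z * w))"

definition pseudohyp_set :: "complex \<Rightarrow> complex set \<Rightarrow> real" where
  "pseudohyp_set z L = (if L = {} then 1 else INF w\<in>L. pseudohyp z w)"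

(* A finite or infinite sequence in the disc is a function a :: nat => complex restricted to an
   index set K of naturals; repetitions in a encode multiplicities, and the order of the product
   is immaterial since it converges absolutely. *)

definition blaschke_factor :: "complex \<Rightarrow> complex \<Rightarrow> complex" where
  "blaschke_factor w z =
     (if w = 0 then z else (of_real (norm w) / w) * ((w - z) / (1 - cnj w * z)))"

definition blaschke_prod :: "nat set \<Rightarrow> (nat \<Rightarrow> complex) \<Rightarrow> complex \<Rightarrow> complex" where
  "blaschke_prod K a z = prodinf (\<lambda>k. if k \<in> K then blaschke_factor (a k) z else 1)"

definition blaschke_seq :: "nat set \<Rightarrow> (nat \<Rightarrow> complex) \<Rightarrow> bool" where
  "blaschke_seq K a \<longleftrightarrow> a ` K \<subseteq> \<D> \<and> (\<lambda>k. 1 - norm (a k)) summable_on K"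

definition blaschke_with_zeros ::
  "(complex \<Rightarrow> complex) \<Rightarrow> nat set \<Rightarrow> (nat \<Rightarrow> complex) \<Rightarrow> bool" where
  "blaschke_with_zeros B K a \<longleftrightarrow> blaschke_seq K a \<and>
     (\<exists>c. norm c = 1 \<and> (\<forall>z\<in>\<D>. B z = c * blaschke_prod K a z))"

definition nevanlinna_data :: "nat set \<Rightarrow> (nat \<Rightarrow> complex) \<Rightarrow> (nat \<Rightarrow> complex) set" where
  "nevanlinna_data K a = {w. \<exists>H\<in>Har_pos. \<forall>k\<in>K. log_plus (norm (w k)) \<le> H (a k)}"

definition nevanlinna_interpolating :: "nat set \<Rightarrow> (nat \<Rightarrow> complex) \<Rightarrow> bool" where
  "nevanlinna_interpolating K a \<longleftrightarrow> a ` K \<subseteq> \<D> \<and> inj_on a K \<and>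
     (\<forall>w\<in>nevanlinna_data K a. \<exists>f\<in>nevanlinna_class. \<forall>k\<in>K. f (a k) = w k)"

definition nevanlinna_interpolating_blaschke :: "(complex \<Rightarrow> complex) \<Rightarrow> bool" where
  "nevanlinna_interpolating_blaschke B \<longleftrightarrow>
     (\<exists>K a. blaschke_with_zeros B K a \<and> nevanlinna_interpolating K a)"

(* The indices of the N zeros closest to z (all of K if it has fewer than N elements): those
   preceded by fewer than N others when K is ordered by distance to z, ties being broken by the
   index.  For a Blaschke sequence only finitely many zeros are at most as far from z as a given
   one, so that card never meets an infinite set. *)
definition nearest_indices ::
  "nat set \<Rightarrow> (nat \<Rightarrow> complex) \<Rightarrow> nat \<Rightarrow> complex \<Rightarrow> nat set" where
  "nearest_indices K a N z = {i\<in>K. card {j\<in>K. pseudohyp z (a j) < pseudohyp z (a i) \<or>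
       pseudohyp z (a j) = pseudohyp z (a i) \<and> j < i} < N}"

(* |B(N)(z)|, where a restricted to K lists the zeros of B.  The tie-breaking does not matter,
   as a factor with zero w has modulus pseudohyp z w at z. *)
definition norm_blaschke_del :: "nat set \<Rightarrow> (nat \<Rightarrow> complex) \<Rightarrow> nat \<Rightarrow> complex \<Rightarrow> real" where
  "norm_blaschke_del K a N z = norm (blaschke_prod (K - nearest_indices K a N z) a z)"

end

theory Submission
  imports Defs
begin

text \<open>
  Write \<open>\<rho>\<close> for the pseudohyperbolic distance and \<open>B\<close> for a Blaschke product with zeros \<open>a k\<close>. All four
  conditions only concern the zeros close to a given point, because the far ones are controlled by a
  harmonic function for free: \<open>S z = 1 + (\<Sum>k. Re ((1 - |a k|^2) (1 + cnj (a k) z) / (1 - cnj (a k) z)))\<close>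
  is positive and harmonic, and it dominates \<open>\<Sum>k. 1 - \<rho>(z, a k)^2\<close>. Hence zeros with
  \<open>\<rho>(z, a k) \<ge> 1/3\<close> contribute at least \<open>exp (- 5 S z)\<close> to \<open>|B z|\<close> (\<open>blaschke_prod_far\<close>), and moving
  from \<open>z\<close> to a point \<open>w\<close> with \<open>\<rho>(w, a k) \<le> 3 \<rho>(z, a k)\<close> for all \<open>k\<close> enlarges the product by at most
  \<open>exp (5 S z)\<close> (\<open>blaschke_prod_compare\<close>). Harnack's inequality \<open>H w \<le> 3 H z\<close> for \<open>\<rho>(z, w) \<le> 1/2\<close>
  carries every harmonic majorant along.

  Interpolation enters through one characterization: a Blaschke sequence is interpolating for the
  Nevanlinna class iff some positive harmonic \<open>H\<close> satisfies \<open>|B_k (a k)| \<ge> exp (- H (a k))\<close>, where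
  \<open>B_k\<close> is the product over the other zeros. If this holds, an explicit series interpolates; its
  absolute convergence, with a harmonic bound for the logarithm of the sum, is again given by \<open>S\<close>
  (\<open>nevanlinna_interpolating_if_separated\<close>). Conversely, let \<open>f\<close> be interpolating with values \<open>1\<close> on
  a subset \<open>M\<close> and \<open>0\<close> on the other zeros. Dividing \<open>f\<close> by the exponential of an analytic completion
  of its majorant gives a function bounded by \<open>1\<close>, so the product over the zeros outside \<open>M\<close> is
  bounded below on \<open>M\<close>. Cutting the disc into dyadic cells with finitely many colours, such that
  cells of one colour are far apart, and letting \<open>M\<close> consist of the worst zero of each cell of one
  colour, reduces the claim to far zeros (\<open>separated_if_nevanlinna_interpolating\<close>).

  The equivalence then follows from five implications between the factorization \<open>A1\<close>, the lower
  bound \<open>A2\<close>, the bound \<open>A3\<close> for the product with deleted zeros and the bound \<open>A4\<close> for the derivatives.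

  \<^item> \<open>A1\<close> implies \<open>A2\<close>: an interpolating factor has at most one zero that matters near \<open>z\<close>, so it is
    bounded below by \<open>exp (- H z)\<close> times the distance of \<open>z\<close> to its zeros; multiply.
  \<^item> \<open>A2\<close> implies \<open>A3\<close>: let \<open>r\<close> be the distance from \<open>z\<close> to the zeros that are not deleted. There is a
    point \<open>w\<close> near \<open>z\<close> whose distance to all zeros is at least a constant times \<open>r\<close>. The bound at \<open>w\<close>
    has a factor \<open>r ^ N\<close>, which the \<open>N\<close> deleted zeros use up, and comparison moves the rest to \<open>z\<close>.
  \<^item> \<open>A3\<close> implies \<open>A1\<close>: at most \<open>N - 1\<close> other zeros are closer than \<open>exp (- H (a k))\<close> to \<open>a k\<close>, so a
    greedy colouring with \<open>N\<close> colours makes zeros of equal colour separated; each colour class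
    satisfies the criterion for interpolation.
  \<^item> \<open>A3\<close> implies \<open>A4\<close>: at a suitable point \<open>w\<close> at distance at most \<open>s\<close> from \<open>z\<close>, \<open>|B w|\<close> is at least a
    multiple of \<open>s ^ N\<close>, whereas the Taylor remainder of order \<open>N\<close> is of size \<open>s ^ (N + 1)\<close>.
  \<^item> \<open>A4\<close> implies \<open>A2\<close>: on the circle of radius comparable to \<open>r\<close> about \<open>z\<close>, \<open>|B|\<close> is at most a
    multiple of \<open>r ^ N\<close> times the deleted product at \<open>z\<close>, and Cauchy's inequalities lose only
    \<open>r ^ (- j)\<close> with \<open>j \<le> N\<close>.
\<close>

section \<open>The pseudohyperbolic metric\<close>

text \<open>
  The involutive automorphism of the disc that interchanges \<open>0\<close> and \<open>v\<close>.
\<close>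

definition disc_auto :: "complex \<Rightarrow> complex \<Rightarrow> complex" where
  "disc_auto v z = (v - z) / (1 - cnj v * z)"

lemma disc_denom_nz:
  assumes "v \<in> \<D>" "z \<in> \<D>"
  shows "1 - cnj v * z \<noteq> 0" "0 < norm (1 - cnj v * z)"
proof -
  have "norm v * norm z \<le> 1 * norm z" using assms by (intro mult_right_mono) auto
  then have "norm (cnj v * z) < 1" using assms by (simp add: norm_mult)
  then show "1 - cnj v * z \<noteq> 0" by auto
  then show "0 < norm (1 - cnj v * z)" by simp
qed

lemma norm_disc_denom:
  "(norm (1 - cnj v * z))\<^sup>2 = (norm (v - z))\<^sup>2 + (1 - (norm v)\<^sup>2) * (1 - (norm z)\<^sup>2)"
  unfolding cmod_power2 by (simp add: power2_eq_square algebra_simps)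

lemma norm_disc_denom_bounds:
  assumes "v \<in> \<D>" "z \<in> \<D>"
  shows "1 - norm z \<le> norm (1 - cnj v * z)" "1 - norm v \<le> norm (1 - cnj v * z)"
proof -
  have 1: "norm v * norm z \<le> norm z" "norm v * norm z \<le> norm v"
    using assms by (auto simp: mult_left_le mult_left_le_one_le)
  have "1 - norm (cnj v * z) \<le> norm (1 - cnj v * z)"
    by (metis norm_one norm_triangle_ineq2)
  then have 2: "1 - norm v * norm z \<le> norm (1 - cnj v * z)" by (simp add: norm_mult)
  show "1 - norm z \<le> norm (1 - cnj v * z)" "1 - norm v \<le> norm (1 - cnj v * z)"
    using 1 2 by linarith+
qed

lemma pseudohyp_norm_disc_auto: "pseudohyp z w = norm (disc_auto z w)"
  by (simp add: pseudohyp_def disc_auto_def)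

lemma pseudohyp_commute: "pseudohyp z w = pseudohyp w z"
proof -
  have "norm (1 - cnj z * w) = norm (1 - cnj w * z)"
    by (metis complex_cnj_cnj complex_cnj_diff complex_cnj_mult complex_cnj_one complex_mod_cnj mult.commute)
  then show ?thesis by (simp add: pseudohyp_def norm_divide norm_minus_commute)
qed

lemma pseudohyp_nonneg [simp]: "0 \<le> pseudohyp z w"
  by (simp add: pseudohyp_def)

lemma pseudohyp_self [simp]: "pseudohyp z z = 0"
  by (simp add: pseudohyp_def)

lemma one_minus_pseudohyp_sq:
  assumes "z \<in> \<D>" "w \<in> \<D>"
  shows "1 - (pseudohyp z w)\<^sup>2 = (1 - (norm z)\<^sup>2) * (1 - (norm w)\<^sup>2) / (norm (1 - cnj z * w))\<^sup>2"
proof -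
  define x y where "x = (norm (z - w))\<^sup>2" and "y = (norm (1 - cnj z * w))\<^sup>2"
  have y: "y \<noteq> 0" using disc_denom_nz(2)[OF assms] by (simp add: y_def)
  have "(pseudohyp z w)\<^sup>2 = x / y"
    by (simp add: pseudohyp_def norm_divide power_divide x_def y_def)
  moreover have "y - x = (1 - (norm z)\<^sup>2) * (1 - (norm w)\<^sup>2)"
    using norm_disc_denom[of z w] by (simp add: x_def y_def)
  moreover have "1 - x / y = (y - x) / y" using y by (simp add: diff_divide_distrib)
  ultimately show ?thesis by (simp add: y_def)
qed

lemma pseudohyp_less_1: "z \<in> \<D> \<Longrightarrow> w \<in> \<D> \<Longrightarrow> pseudohyp z w < 1"
proof -
  assume a: "z \<in> \<D>" "w \<in> \<D>"
  have "0 < (1 - (norm z)\<^sup>2) * (1 - (norm w)\<^sup>2) / (norm (1 - cnj z * w))\<^sup>2"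
  proof (intro divide_pos_pos mult_pos_pos)
    show "0 < 1 - (norm z)\<^sup>2" "0 < 1 - (norm w)\<^sup>2"
      using a by (simp_all add: power_less_one_iff)
    show "0 < (norm (1 - cnj z * w))\<^sup>2" using disc_denom_nz(2)[OF a] by simp
  qed
  then have "(pseudohyp z w)\<^sup>2 < 1" using one_minus_pseudohyp_sq[OF a] by linarith
  then show ?thesis by (simp add: abs_square_less_1)
qed

lemma pseudohyp_le_1: "z \<in> \<D> \<Longrightarrow> w \<in> \<D> \<Longrightarrow> pseudohyp z w \<le> 1"
  using pseudohyp_less_1 by (simp add: less_imp_le)

lemma pseudohyp_eq_0_iff: "z \<in> \<D> \<Longrightarrow> w \<in> \<D> \<Longrightarrow> pseudohyp z w = 0 \<longleftrightarrow> z = w"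
  using disc_denom_nz[of z w] by (auto simp: pseudohyp_def)

lemma disc_auto_in_disc: "v \<in> \<D> \<Longrightarrow> z \<in> \<D> \<Longrightarrow> disc_auto v z \<in> \<D>"
  using pseudohyp_less_1[of v z] by (simp add: pseudohyp_norm_disc_auto)

lemma disc_auto_invol:
  assumes "v \<in> \<D>" "z \<in> \<D>"
  shows "disc_auto v (disc_auto v z) = z"
proof -
  have d: "1 - cnj v * z \<noteq> 0" and e: "1 - cnj v * v \<noteq> 0"
    using disc_denom_nz assms by auto
  define D where "D = 1 - cnj v * z"
  have nz: "D \<noteq> 0" using d by (simp add: D_def)
  have a: "disc_auto v z = (v - z) / D" by (simp add: disc_auto_def D_def)
  have 1: "v - (v - z) / D = (v * D - (v - z)) / D" and 2: "1 - cnj v * ((v - z) / D) = (D - cnj v * (v - z)) / D"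
    using nz by (simp_all add: field_split_simps)
  have 3: "v * D - (v - z) = z * (1 - cnj v * v)" "D - cnj v * (v - z) = 1 - cnj v * v"
    unfolding D_def by (simp_all add: algebra_simps)
  show ?thesis unfolding disc_auto_def[of v "disc_auto v z"] unfolding a 1 2 3 using d e D_def by simp
qed

lemma disc_auto_0 [simp]: "disc_auto v 0 = v" and disc_auto_self [simp]: "disc_auto v v = 0"
  by (auto simp: disc_auto_def)

lemma disc_auto_holomorphic: "v \<in> \<D> \<Longrightarrow> disc_auto v holomorphic_on \<D>"
  unfolding disc_auto_def using disc_denom_nz by (auto intro!: holomorphic_intros)

lemma pseudohyp_disc_auto:
  assumes "v \<in> \<D>" "z \<in> \<D>" "w \<in> \<D>"
  shows "pseudohyp (disc_auto v z) (disc_auto v w) = pseudohyp z w"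
proof -
  have d: "1 - cnj v * z \<noteq> 0" "1 - cnj v * w \<noteq> 0" "1 - v * cnj z \<noteq> 0" and e: "1 - cnj v * v \<noteq> 0"
    using disc_denom_nz[of v z] disc_denom_nz[of v w] disc_denom_nz[of z v] disc_denom_nz[of v v] assms
    by (auto simp: mult.commute)
  define D E where "D = 1 - cnj v * z" and "E = 1 - cnj v * w"
  have a: "disc_auto v z = (v - z) / D" "disc_auto v w = (v - w) / E" by (simp_all add: disc_auto_def D_def E_def)
  have nz: "D \<noteq> 0" "E \<noteq> 0" "cnj D \<noteq> 0" using d by (simp_all add: D_def E_def)
  have "(v - z) * E - (v - w) * D = (w - z) * (1 - cnj v * v)"
    unfolding D_def E_def by (simp add: algebra_simps)
  then have 1: "disc_auto v z - disc_auto v w = (w - z) * (1 - cnj v * v) / (D * E)"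
    unfolding a using nz by (simp add: diff_frac_eq)
  have "cnj D * E - cnj (v - z) * (v - w) = (1 - cnj z * w) * (1 - cnj v * v)"
    unfolding D_def E_def by (simp add: algebra_simps)
  moreover have "1 - cnj ((v - z) / D) * ((v - w) / E) = (cnj D * E - cnj (v - z) * (v - w)) / (cnj D * E)"
  proof -
    have "1 - x / cnj D * (y / E) = (cnj D * E - x * y) / (cnj D * E)" for x y
      using nz by (simp add: field_split_simps)
    then show ?thesis by simp
  qed
  ultimately have 2: "1 - cnj (disc_auto v z) * disc_auto v w
      = (1 - cnj z * w) * (1 - cnj v * v) / (cnj D * E)"
    unfolding a by simp
  show ?thesis unfolding pseudohyp_def 1 2 using nz e
    by (simp add: norm_divide norm_mult norm_minus_commute)
qed

text \<open>
  For given moduli, \<open>1 - \<rho>^2\<close> is smallest when \<open>|1 - cnj z * w|\<close> takes its largest value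
  \<open>1 + |z| |w|\<close>, and then \<open>\<rho> = (|z| + |w|) / (1 + |z| |w|)\<close>.
\<close>

lemma pseudohyp_le_add_norm:
  assumes "z \<in> \<D>" "w \<in> \<D>"
  shows "pseudohyp z w \<le> norm z + norm w"
proof -
  define x y where "x = norm z" and "y = norm w"
  have xy: "0 \<le> x" "x < 1" "0 \<le> y" "y < 1" using assms by (auto simp: x_def y_def)
  have d: "norm (1 - cnj z * w) \<le> 1 + x * y"
    using norm_triangle_ineq4[of 1 "cnj z * w"] by (simp add: norm_mult x_def y_def)
  have "(1 - x\<^sup>2) * (1 - y\<^sup>2) / (1 + x * y)\<^sup>2 \<le> 1 - (pseudohyp z w)\<^sup>2"
    unfolding one_minus_pseudohyp_sq[OF assms] x_def[symmetric] y_def[symmetric]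
  proof (intro divide_left_mono power_mono d mult_pos_pos)
    show "0 < (norm (1 - cnj z * w))\<^sup>2" using disc_denom_nz(2)[OF assms] by simp
    have "0 < 1 + x * y" using xy by (smt (verit) mult_nonneg_nonneg)
    then show "0 < (1 + x * y)\<^sup>2" by simp
    show "0 \<le> (1 - x\<^sup>2) * (1 - y\<^sup>2)" using xy by (simp add: power_le_one)
  qed auto
  moreover have "(1 - x\<^sup>2) * (1 - y\<^sup>2) / (1 + x * y)\<^sup>2 = 1 - ((x + y) / (1 + x * y))\<^sup>2"
  proof -
    have "1 + x * y \<noteq> 0" using xy by (smt (verit) mult_nonneg_nonneg)
    then show ?thesis by (simp add: power_divide divide_simps) (simp add: algebra_simps power2_eq_square)
  qed
  ultimately have "(pseudohyp z w)\<^sup>2 \<le> ((x + y) / (1 + x * y))\<^sup>2" by simp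
  then have "pseudohyp z w \<le> (x + y) / (1 + x * y)"
    using xy by (meson abs_le_square_iff power2_le_imp_le add_nonneg_nonneg divide_nonneg_nonneg mult_nonneg_nonneg zero_le_one)
  also have "\<dots> \<le> x + y" using xy by (simp add: divide_le_eq mult_left_le add_nonneg_nonneg algebra_simps)
      (smt (verit) mult_nonneg_nonneg)
  finally show ?thesis by (simp add: x_def y_def)
qed

text \<open>
  An automorphism moves \<open>v\<close> to the origin, where the two distances on the right become moduli.
\<close>

lemma pseudohyp_triangle:
  assumes "z \<in> \<D>" "w \<in> \<D>" "v \<in> \<D>"
  shows "pseudohyp z w \<le> pseudohyp z v + pseudohyp v w"
proof -
  have "pseudohyp z w \<le> norm (disc_auto v z) + norm (disc_auto v w)"
    using pseudohyp_le_add_norm[OF disc_auto_in_disc disc_auto_in_disc, of v z v w] assms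
    by (simp only: pseudohyp_disc_auto)
  then show ?thesis using pseudohyp_commute[of z v] by (simp add: pseudohyp_norm_disc_auto)
qed

text \<open>
  This and the next lemma compare \<open>\<rho>\<close> with the Euclidean distance measured in units of the distance
  to the circle, so that auxiliary points can be chosen in Euclidean terms.
\<close>

lemma pseudohyp_le_euclid:
  assumes "z \<in> \<D>" "w \<in> \<D>" "norm (w - z) \<le> s * (1 - norm z)"
  shows "pseudohyp z w \<le> s"
proof -
  have "pseudohyp z w = norm (w - z) / norm (1 - cnj z * w)"
    by (simp add: pseudohyp_def norm_divide norm_minus_commute)
  also have "\<dots> \<le> norm (w - z) / (1 - norm z)"
    using assms norm_disc_denom_bounds[of z w] disc_denom_nz[of z w]
    by (intro divide_left_mono) auto
  also have "\<dots> \<le> s" using assms by (simp add: divide_le_eq)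
  finally show ?thesis .
qed

text \<open>
  The denominator is at most \<open>2 (1 - |w|) + |w - b|\<close>, and \<open>x / (2 + x)\<close> increases with \<open>x\<close>.
\<close>

lemma pseudohyp_ge_euclid:
  assumes "w \<in> \<D>" "b \<in> \<D>" "0 \<le> t" "t * (1 - norm w) \<le> norm (w - b)"
  shows "t / (t + 2) \<le> pseudohyp w b"
proof -
  define x where "x = norm (w - b)"
  have w: "0 < 1 - norm w" using assms by simp
  have "1 - cnj w * b = complex_of_real (1 - (norm w)\<^sup>2) + cnj w * (w - b)"
    using complex_norm_square[of w] by (simp add: algebra_simps)
  then have "norm (1 - cnj w * b) \<le> norm (complex_of_real (1 - (norm w)\<^sup>2)) + norm (cnj w * (w - b))"
    by (metis norm_triangle_ineq)
  also have "norm (complex_of_real (1 - (norm w)\<^sup>2)) \<le> 2 * (1 - norm w)"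
  proof -
    have "1 - (norm w)\<^sup>2 = (1 - norm w) * (1 + norm w)" by (simp add: power2_eq_square algebra_simps)
    also have "\<dots> \<le> (1 - norm w) * 2" using assms by (intro mult_left_mono) auto
    finally show ?thesis using assms by (subst norm_of_real) (simp add: abs_square_le_1)
  qed
  also have "norm (cnj w * (w - b)) \<le> x"
    using assms by (simp add: norm_mult x_def mult_left_le_one_le)
  finally have d: "norm (1 - cnj w * b) \<le> 2 * (1 - norm w) + x" by simp
  have "t * norm (1 - cnj w * b) \<le> t * (2 * (1 - norm w) + x)"
    using d assms by (intro mult_left_mono) auto
  also have "\<dots> \<le> (t + 2) * x" using assms by (simp add: x_def algebra_simps)
  finally have "t / (t + 2) \<le> x / norm (1 - cnj w * b)"
    using disc_denom_nz[OF assms(1,2)] assms(3) by (simp add: divide_simps algebra_simps)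
  then show ?thesis by (simp add: pseudohyp_def norm_divide x_def)
qed

section \<open>Positive harmonic functions as real parts\<close>

lemma harmonic_on_Re:
  assumes "G holomorphic_on \<D>" and u: "\<And>z. z \<in> \<D> \<Longrightarrow> u z = Re (G z)"
  shows "harmonic_on u \<D>"
proof -
  define g1 where "g1 = deriv G"
  define g2 where "g2 = deriv g1"
  have h1: "g1 holomorphic_on \<D>" unfolding g1_def by (rule holomorphic_deriv[OF assms(1)]) simp
  have h2: "g2 holomorphic_on \<D>" unfolding g2_def by (rule holomorphic_deriv[OF h1]) simp
  have c: "continuous_on \<D> g2" using h2 holomorphic_on_imp_continuous_on by blast
  have d0: "(G has_derivative (\<lambda>h. g1 z * h)) (at z)" if "z \<in> \<D>" for z
    using holomorphic_derivI[OF assms(1) _ that] unfolding g1_def has_field_derivative_def by auto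
  have d1: "(g1 has_derivative (\<lambda>h. g2 z * h)) (at z)" if "z \<in> \<D>" for z
    using holomorphic_derivI[OF h1 _ that] unfolding g2_def has_field_derivative_def by auto
  show ?thesis unfolding harmonic_on_def
  proof (rule exI[of _ "\<lambda>z. Re (g1 z)"], rule exI[of _ "\<lambda>z. - Im (g1 z)"], rule exI[of _ "\<lambda>z. Re (g2 z)"],
      rule exI[of _ "\<lambda>z. - Im (g2 z)"], rule exI[of _ "\<lambda>z. - Im (g2 z)"], rule exI[of _ "\<lambda>z. - Re (g2 z)"],
      intro conjI ballI)
    fix z assume z: "z \<in> \<D>"
    have "(u has_derivative (\<lambda>h. Re (g1 z * h))) (at z)"
      using has_derivative_transform_within_open[OF has_derivative_Re[OF d0[OF z]] open_ball z] u by simp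
    then show "(u has_derivative (\<lambda>h. Re (g1 z) * Re h + - Im (g1 z) * Im h)) (at z)" by simp
    have "((\<lambda>z. Re (g1 z)) has_derivative (\<lambda>h. Re (g2 z * h))) (at z)"
      using has_derivative_Re[OF d1[OF z]] .
    then show "((\<lambda>z. Re (g1 z)) has_derivative (\<lambda>h. Re (g2 z) * Re h + - Im (g2 z) * Im h)) (at z)" by simp
    have "((\<lambda>z. - Im (g1 z)) has_derivative (\<lambda>h. - Im (g2 z * h))) (at z)"
      using has_derivative_minus[OF has_derivative_Im[OF d1[OF z]]] .
    then show "((\<lambda>z. - Im (g1 z)) has_derivative (\<lambda>h. - Im (g2 z) * Re h + - Re (g2 z) * Im h)) (at z)"
      by (rule has_derivative_eq_rhs) (auto simp: algebra_simps)
  qed (auto intro!: continuous_intros c)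
qed

lemma DERIV_along_x:
  fixes u :: "complex \<Rightarrow> real"
  assumes "(u has_derivative (\<lambda>h. p * Re h + q * Im h)) (at (b + of_real s))"
  shows "((\<lambda>s. u (b + of_real s)) has_real_derivative p) (at s)"
proof -
  have "((\<lambda>s. b + of_real s) has_derivative (\<lambda>h. of_real h)) (at s)"
    by (auto intro!: derivative_eq_intros)
  from has_derivative_compose[OF this assms] show ?thesis
    by (auto simp: has_field_derivative_def elim!: has_derivative_eq_rhs)
qed

lemma DERIV_along_y:
  fixes u :: "complex \<Rightarrow> real"
  assumes "(u has_derivative (\<lambda>h. p * Re h + q * Im h)) (at (b + \<i> * of_real s))"
  shows "((\<lambda>s. u (b + \<i> * of_real s)) has_real_derivative q) (at s)"
proof -
  have "((\<lambda>s. b + \<i> * of_real s) has_derivative (\<lambda>h. \<i> * of_real h)) (at s)"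
    by (auto intro!: derivative_eq_intros)
  from has_derivative_compose[OF this assms] show ?thesis
    by (auto simp: has_field_derivative_def elim!: has_derivative_eq_rhs)
qed

text \<open>
  The Cauchy-Riemann equations for \<open>p - \<i> q\<close> need the symmetry of the second derivative, which
  \<^const>\<open>harmonic_on\<close> does not postulate. It is obtained from the continuity of the second partials: the
  second difference of \<open>u\<close> over a small square, evaluated by the mean value theorem in both orders,
  is \<open>t^2\<close> times a value of either mixed partial.
\<close>

lemma mixed_partials_equal:
  fixes u p q :: "complex \<Rightarrow> real"
  assumes S: "open S" "z \<in> S" and c: "continuous_on S pq" "continuous_on S qp"
    and u: "\<And>z. z \<in> S \<Longrightarrow> (u has_derivative (\<lambda>h. p z * Re h + q z * Im h)) (at z)"
    and p: "\<And>z. z \<in> S \<Longrightarrow> (p has_derivative (\<lambda>h. pp z * Re h + pq z * Im h)) (at z)"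
    and q: "\<And>z. z \<in> S \<Longrightarrow> (q has_derivative (\<lambda>h. qp z * Re h + qq z * Im h)) (at z)"
  shows "pq z = qp z"
proof (rule ccontr)
  assume ne: "pq z \<noteq> qp z"
  define e where "e = \<bar>pq z - qp z\<bar> / 2"
  have e: "e > 0" using ne by (simp add: e_def)
  obtain r0 where r0: "r0 > 0" "ball z r0 \<subseteq> S" using S openE by blast
  obtain r1 where r1: "r1 > 0" "\<And>w. w \<in> S \<Longrightarrow> dist w z < r1 \<Longrightarrow> dist (pq w) (pq z) < e"
    using c(1) S(2) e unfolding continuous_on_iff by blast
  obtain r2 where r2: "r2 > 0" "\<And>w. w \<in> S \<Longrightarrow> dist w z < r2 \<Longrightarrow> dist (qp w) (qp z) < e"
    using c(2) S(2) e unfolding continuous_on_iff by blast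
  define t where "t = min r0 (min r1 r2) / 3"
  have t: "t > 0" "3 * t \<le> r0" "3 * t \<le> r1" "3 * t \<le> r2" using r0 r1 r2 by (auto simp: t_def)
  have near: "dist (z + of_real x + \<i> * of_real y) z < 3 * t" if "0 \<le> x" "x \<le> t" "0 \<le> y" "y \<le> t" for x y
  proof -
    have "norm (of_real x + \<i> * of_real y) \<le> x + y"
      using norm_triangle_ineq[of "of_real x" "\<i> * of_real y"] that by (simp add: norm_mult)
    then show ?thesis using that t by (simp add: dist_norm add.assoc)
  qed
  have inS: "z + of_real x + \<i> * of_real y \<in> S" if "0 \<le> x" "x \<le> t" "0 \<le> y" "y \<le> t" for x y
    using near[OF that] t r0 by (auto simp: dist_commute subset_eq)
  \<comment> \<open>The second difference of \<open>u\<close> over a square of side \<open>t\<close>, evaluated in either order.\<close>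
  define D where "D = u (z + of_real t + \<i> * of_real t) - u (z + of_real t) - u (z + \<i> * of_real t) + u z"
  have "\<exists>x y. 0 \<le> x \<and> x \<le> t \<and> 0 \<le> y \<and> y \<le> t \<and> D = t * (t * pq (z + of_real x + \<i> * of_real y))"
  proof -
    have "((\<lambda>s. u (z + \<i> * of_real t + of_real s) - u (z + of_real s)) has_real_derivative
        p (z + of_real s + \<i> * of_real t) - p (z + of_real s)) (at s)" if "0 \<le> s" "s \<le> t" for s
    proof -
      have a: "z + \<i> * of_real t + of_real s = z + of_real s + \<i> * of_real t" by simp
      have "((\<lambda>s. u (z + \<i> * of_real t + of_real s)) has_real_derivative p (z + of_real s + \<i> * of_real t)) (at s)"
        using u[OF inS[of s t]] that t by (intro DERIV_along_x) (simp add: a)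
      moreover have "((\<lambda>s. u (z + of_real s)) has_real_derivative p (z + of_real s)) (at s)"
        using u[OF inS[of s 0]] that t by (intro DERIV_along_x) simp
      ultimately show ?thesis by (rule DERIV_diff)
    qed
    from MVT2[OF t(1) this] obtain x where x: "0 < x" "x < t"
      "D = t * (p (z + of_real x + \<i> * of_real t) - p (z + of_real x))"
      by (auto simp: D_def algebra_simps)
    have "((\<lambda>s. p (z + of_real x + \<i> * of_real s)) has_real_derivative pq (z + of_real x + \<i> * of_real s)) (at s)"
      if "0 \<le> s" "s \<le> t" for s
      using p[OF inS[of x s]] that x by (intro DERIV_along_y) simp
    from MVT2[OF t(1) this] obtain y where y: "0 < y" "y < t"
      "p (z + of_real x + \<i> * of_real t) - p (z + of_real x) = t * pq (z + of_real x + \<i> * of_real y)"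
      by auto
    then show ?thesis using x less_imp_le by metis
  qed
  then obtain w1 where w1: "w1 \<in> S" "dist w1 z < 3 * t" "D = t * (t * pq w1)"
    using near inS by blast
  have "\<exists>x y. 0 \<le> x \<and> x \<le> t \<and> 0 \<le> y \<and> y \<le> t \<and> D = t * (t * qp (z + of_real x + \<i> * of_real y))"
  proof -
    have "((\<lambda>s. u (z + of_real t + \<i> * of_real s) - u (z + \<i> * of_real s)) has_real_derivative
        q (z + of_real t + \<i> * of_real s) - q (z + \<i> * of_real s)) (at s)" if "0 \<le> s" "s \<le> t" for s
    proof -
      have "((\<lambda>s. u (z + of_real t + \<i> * of_real s)) has_real_derivative q (z + of_real t + \<i> * of_real s)) (at s)"
        using u[OF inS[of t s]] that t by (intro DERIV_along_y) simp
      moreover have "((\<lambda>s. u (z + \<i> * of_real s)) has_real_derivative q (z + \<i> * of_real s)) (at s)"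
        using u[OF inS[of 0 s]] that t by (intro DERIV_along_y) simp
      ultimately show ?thesis by (rule DERIV_diff)
    qed
    from MVT2[OF t(1) this] obtain y where y: "0 < y" "y < t"
      "D = t * (q (z + of_real t + \<i> * of_real y) - q (z + \<i> * of_real y))"
      by (auto simp: D_def algebra_simps)
    have a: "z + \<i> * of_real y + of_real s = z + of_real s + \<i> * of_real y" for s by simp
    have "((\<lambda>s. q (z + \<i> * of_real y + of_real s)) has_real_derivative qp (z + of_real s + \<i> * of_real y)) (at s)"
      if "0 \<le> s" "s \<le> t" for s
      using q[OF inS[of s y]] that y by (intro DERIV_along_x) (simp add: a)
    from MVT2[OF t(1) this] obtain x where x: "0 < x" "x < t"
      "q (z + of_real t + \<i> * of_real y) - q (z + \<i> * of_real y) = t * qp (z + of_real x + \<i> * of_real y)"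
      by (auto simp: a)
    then show ?thesis using y less_imp_le by metis
  qed
  then obtain w2 where w2: "w2 \<in> S" "dist w2 z < 3 * t" "D = t * (t * qp w2)"
    using near inS by blast
  have "pq w1 = qp w2" using w1 w2 t by simp
  moreover have "dist (pq w1) (pq z) < e" using r1(2)[OF w1(1)] w1 t by simp
  moreover have "dist (qp w2) (qp z) < e" using r2(2)[OF w2(1)] w2 t by simp
  moreover have "\<bar>pq z - qp z\<bar> = 2 * e" by (simp add: e_def)
  ultimately show False unfolding dist_real_def by linarith
qed

text \<open>
  The function \<open>p - \<i> q\<close> is holomorphic, and the real part of a primitive has the same first partials
  as \<open>u\<close>.
\<close>

lemma harmonic_on_obtain_Re:
  assumes "harmonic_on u \<D>"
  obtains G where "G holomorphic_on \<D>" "\<And>z. z \<in> \<D> \<Longrightarrow> Re (G z) = u z"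
proof -
  obtain p q pp pq qp qq :: "complex \<Rightarrow> real" where
    c: "continuous_on \<D> pp" "continuous_on \<D> pq" "continuous_on \<D> qp" "continuous_on \<D> qq" and
    d: "\<And>z. z \<in> \<D> \<Longrightarrow> (u has_derivative (\<lambda>h. p z * Re h + q z * Im h)) (at z)"
       "\<And>z. z \<in> \<D> \<Longrightarrow> (p has_derivative (\<lambda>h. pp z * Re h + pq z * Im h)) (at z)"
       "\<And>z. z \<in> \<D> \<Longrightarrow> (q has_derivative (\<lambda>h. qp z * Re h + qq z * Im h)) (at z)"
       "\<And>z. z \<in> \<D> \<Longrightarrow> pp z + qq z = 0"
    using assms unfolding harmonic_on_def by blast
  define f where "f z = of_real (p z) - \<i> * of_real (q z)" for z
  have "(f has_field_derivative (of_real (pp z) - \<i> * of_real (pq z))) (at z)" if z: "z \<in> \<D>" for z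
  proof -
    have e: "pq z = qp z"
      by (rule mixed_partials_equal[of \<D> z pq qp u p q pp qq]) (use z c d in auto)
    have "(f has_derivative (\<lambda>h. of_real (pp z * Re h + pq z * Im h) - \<i> * of_real (qp z * Re h + qq z * Im h))) (at z)"
      unfolding f_def by (intro derivative_intros d z)
    moreover have "of_real (pp z * Re h + pq z * Im h) - \<i> * of_real (qp z * Re h + qq z * Im h)
        = (of_real (pp z) - \<i> * of_real (pq z)) * h" for h
    proof -
      have r: "qq z = - pp z" "qp z = pq z" using e d(4)[OF z] by linarith+
      show ?thesis unfolding r by (simp add: complex_eq_iff algebra_simps)
    qed
    ultimately show ?thesis by (simp add: has_field_derivative_def)
  qed
  then have "f holomorphic_on \<D>" unfolding holomorphic_on_open[OF open_ball] by blast
  then obtain G0 where G0: "\<And>z. z \<in> \<D> \<Longrightarrow> (G0 has_field_derivative f z) (at z within \<D>)"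
    using holomorphic_convex_primitive'[OF convex_ball open_ball] by blast
  have "((\<lambda>z. Re (G0 z) - u z) has_derivative (\<lambda>h. 0)) (at z within \<D>)" if z: "z \<in> \<D>" for z
  proof -
    have "(G0 has_derivative (\<lambda>h. f z * h)) (at z within \<D>)"
      using G0[OF z] by (simp add: has_field_derivative_def)
    from has_derivative_diff[OF has_derivative_Re[OF this] has_derivative_at_withinI[OF d(1)[OF z]]]
    show ?thesis by (rule has_derivative_eq_rhs) (auto simp: f_def)
  qed
  then have "\<exists>c. \<forall>z\<in>\<D>. Re (G0 z) - u z = c"
    by (intro has_derivative_zero_constant convex_ball) auto
  then obtain k where k: "\<And>z. z \<in> \<D> \<Longrightarrow> Re (G0 z) - u z = k" by blast
  show ?thesis
  proof
    show "(\<lambda>z. G0 z - of_real k) holomorphic_on \<D>"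
    proof -
      have "G0 holomorphic_on \<D>" unfolding holomorphic_on_def field_differentiable_def using G0 by blast
      then show ?thesis by (intro holomorphic_intros)
    qed
    show "Re (G0 z - of_real k) = u z" if "z \<in> \<D>" for z using k[OF that] by simp
  qed
qed

lemma Har_pos_iff_Re:
  "H \<in> Har_pos \<longleftrightarrow> (\<exists>G. G holomorphic_on \<D> \<and> (\<forall>z\<in>\<D>. H z = Re (G z) \<and> Re (G z) > 0))"
proof
  assume "H \<in> Har_pos"
  then have h: "harmonic_on H \<D>" "\<forall>z\<in>\<D>. H z > 0" by (auto simp: Har_pos_def)
  obtain G where "G holomorphic_on \<D>" "\<And>z. z \<in> \<D> \<Longrightarrow> Re (G z) = H z"
    using harmonic_on_obtain_Re[OF h(1)] by blast
  then show "\<exists>G. G holomorphic_on \<D> \<and> (\<forall>z\<in>\<D>. H z = Re (G z) \<and> Re (G z) > 0)"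
    using h(2) by (metis)
next
  assume "\<exists>G. G holomorphic_on \<D> \<and> (\<forall>z\<in>\<D>. H z = Re (G z) \<and> Re (G z) > 0)"
  then obtain G where G: "G holomorphic_on \<D>" "\<And>z. z \<in> \<D> \<Longrightarrow> Re (G z) = H z" "\<And>z. z \<in> \<D> \<Longrightarrow> H z > 0"
    by metis
  have "harmonic_on H \<D>" by (rule harmonic_on_Re[OF G(1)]) (simp add: G(2))
  then show "H \<in> Har_pos" using G(3) by (simp add: Har_pos_def)
qed

lemma Har_pos_pos: "H \<in> Har_pos \<Longrightarrow> z \<in> \<D> \<Longrightarrow> 0 < H z"
  by (simp add: Har_pos_def)

lemma Har_pos_add: "H1 \<in> Har_pos \<Longrightarrow> H2 \<in> Har_pos \<Longrightarrow> (\<lambda>z. H1 z + H2 z) \<in> Har_pos"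
  unfolding Har_pos_iff_Re
  by (elim exE, rule_tac x = "\<lambda>z. G z + Ga z" in exI) (auto intro!: holomorphic_intros add_pos_pos)

lemma Har_pos_const: "0 < c \<Longrightarrow> (\<lambda>z. c) \<in> Har_pos"
  unfolding Har_pos_iff_Re by (rule exI[of _ "\<lambda>z. of_real c"]) auto

lemma Har_pos_cmult: "0 < c \<Longrightarrow> H \<in> Har_pos \<Longrightarrow> (\<lambda>z. c * H z) \<in> Har_pos"
  unfolding Har_pos_iff_Re
  by (elim exE, rule_tac x = "\<lambda>z. of_real c * G z" in exI) (auto intro!: holomorphic_intros)

lemma Har_pos_add_const: "H \<in> Har_pos \<Longrightarrow> 0 < c \<Longrightarrow> (\<lambda>z. H z + c) \<in> Har_pos"
  by (intro Har_pos_add Har_pos_const)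

lemma Har_pos_sum:
  assumes "finite I" "I \<noteq> {}" "\<And>i. i \<in> I \<Longrightarrow> H i \<in> Har_pos"
  shows "(\<lambda>z. \<Sum>i\<in>I. H i z) \<in> Har_pos"
  using assms by (induction rule: finite_ne_induct) (auto intro: Har_pos_add)

text \<open>
  The quotient \<open>(G v - G z) / (G v + cnj (G z))\<close> maps the disc into itself and vanishes at \<open>z\<close>, so it is
  bounded by \<open>\<rho>(z, v)\<close>. The constant is \<open>(1 + 1/2) / (1 - 1/2)\<close>.
\<close>

lemma Har_pos_Harnack:
  assumes "H \<in> Har_pos" "z \<in> \<D>" "w \<in> \<D>" "pseudohyp z w \<le> 1/2"
  shows "H w \<le> 3 * H z"
proof -
  obtain G where G: "G holomorphic_on \<D>" "\<And>z. z \<in> \<D> \<Longrightarrow> H z = Re (G z)" "\<And>z. z \<in> \<D> \<Longrightarrow> Re (G z) > 0"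
    using assms(1) unfolding Har_pos_iff_Re by metis
  have nz: "G v + cnj (G z) \<noteq> 0" if "v \<in> \<D>" for v
    using G(3)[OF that] G(3)[OF assms(2)] by (auto simp: complex_eq_iff)
  have id: "(norm (G v + cnj (G z)))\<^sup>2 - (norm (G v - G z))\<^sup>2 = 4 * Re (G v) * Re (G z)" for v
    unfolding cmod_power2 by (simp add: power2_eq_square algebra_simps)
  \<comment> \<open>The quotient composed with the automorphism taking \<open>0\<close> to \<open>z\<close>, as Schwarz's lemma asks for a zero at \<open>0\<close>.\<close>
  define F where "F v = (G (disc_auto z v) - G z) / (G (disc_auto z v) + cnj (G z))" for v
  have "norm (F (disc_auto z w)) \<le> norm (disc_auto z w)"
  proof (rule Schwarz_Lemma(1))
    have "(\<lambda>v. G (disc_auto z v)) holomorphic_on \<D>"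
      using holomorphic_on_compose_gen[OF disc_auto_holomorphic[OF assms(2)] G(1)]
        image_subsetI[of \<D> "disc_auto z" \<D>, OF disc_auto_in_disc[OF assms(2)]]
      by (simp add: o_def)
    then show "F holomorphic_on \<D>" unfolding F_def
      using nz disc_auto_in_disc[OF assms(2)] by (intro holomorphic_intros) auto
    show "F 0 = 0" by (simp add: F_def)
    show "norm (disc_auto z w) < 1" using disc_auto_in_disc[OF assms(2,3)] by simp
    show "norm (F v) < 1" if "norm v < 1" for v
    proof -
      have v: "disc_auto z v \<in> \<D>" using disc_auto_in_disc[OF assms(2)] that by simp
      have "0 < 4 * Re (G (disc_auto z v)) * Re (G z)" using G(3)[OF v] G(3)[OF assms(2)] by simp
      then have "(norm (G (disc_auto z v) - G z))\<^sup>2 < (norm (G (disc_auto z v) + cnj (G z)))\<^sup>2"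
        using id[of "disc_auto z v"] by linarith
      then have "norm (G (disc_auto z v) - G z) < norm (G (disc_auto z v) + cnj (G z))"
        using power2_less_imp_less norm_ge_zero by blast
      then show ?thesis using nz[OF v] by (simp add: F_def norm_divide)
    qed
  qed
  then have "norm (G w - G z) / norm (G w + cnj (G z)) \<le> 1/2"
    using order_trans[OF _ assms(4)[unfolded pseudohyp_norm_disc_auto]] disc_auto_invol[OF assms(2,3)]
    by (simp only: F_def norm_divide)
  then have "norm (G w - G z) \<le> norm (G w + cnj (G z)) / 2"
    using nz[OF assms(3)] by (simp add: divide_simps)
  then have "(norm (G w - G z))\<^sup>2 \<le> (norm (G w + cnj (G z)) / 2)\<^sup>2" by (intro power_mono) auto
  then have 1: "3 * (norm (G w + cnj (G z)))\<^sup>2 \<le> 16 * Re (G w) * Re (G z)"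
    using id[of w] by (simp add: power_divide)
  define x y where "x = Re (G w)" and "y = Re (G z)"
  have xy: "x > 0" "y > 0" using G(3) assms by (auto simp: x_def y_def)
  have "(x + y)\<^sup>2 \<le> (norm (G w + cnj (G z)))\<^sup>2"
    unfolding cmod_power2 by (simp add: x_def y_def)
  then have 2: "3 * (x + y)\<^sup>2 \<le> 16 * x * y" using 1 by (simp add: x_def y_def)
  have "x \<le> 3 * y"
  proof (rule ccontr)
    assume "\<not> x \<le> 3 * y"
    then have "0 < (x - 3 * y) * (3 * x - y)" using xy by (intro mult_pos_pos) auto
    then show False using 2 by (simp add: power2_eq_square algebra_simps)
  qed
  then show ?thesis using G(2) assms by (simp add: x_def y_def)
qed

section \<open>Blaschke products\<close>

lemma blaschke_seq_disc: "blaschke_seq K a \<Longrightarrow> k \<in> K \<Longrightarrow> a k \<in> \<D>"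
  by (auto simp: blaschke_seq_def)

lemma blaschke_seq_subset: "blaschke_seq K a \<Longrightarrow> J \<subseteq> K \<Longrightarrow> blaschke_seq J a"
  unfolding blaschke_seq_def by (meson image_mono subset_trans summable_on_subset_banach)

lemma blaschke_seq_summable:
  assumes "blaschke_seq K a"
  shows "summable (\<lambda>k. if k \<in> K then 1 - norm (a k) else 0)"
proof -
  have "(\<lambda>k. if k \<in> K then 1 - norm (a k) else 0) summable_on UNIV \<longleftrightarrow> (\<lambda>k. 1 - norm (a k)) summable_on K"
    by (rule summable_on_cong_neutral) auto
  moreover have "(if k \<in> K then 1 - norm (a k) else 0) \<ge> 0" for k
    using blaschke_seq_disc[OF assms, of k] by auto
  ultimately show ?thesis
    using assms by (simp add: blaschke_seq_def summable_on_UNIV_nonneg_real_iff)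
qed

lemma norm_blaschke_factor: "norm (blaschke_factor w z) = pseudohyp z w"
  unfolding pseudohyp_commute[of z w]
  by (simp add: blaschke_factor_def pseudohyp_def norm_mult norm_divide)

lemma blaschke_factor_holomorphic: "w \<in> \<D> \<Longrightarrow> blaschke_factor w holomorphic_on \<D>"
  unfolding blaschke_factor_def using disc_denom_nz(1)[of w]
  by (cases "w = 0") (auto intro!: holomorphic_intros)

text \<open>
  For \<open>w \<noteq> 0\<close> and \<open>r = |w|\<close> the difference is \<open>- (1 - r) (w + r z) / (w (1 - cnj w * z))\<close>; the factor
  \<open>|w|\<close> of the denominator cancels against \<open>|w + r z| \<le> 2 r\<close>, so the bound is uniform in \<open>w\<close>.
\<close>

lemma norm_blaschke_factor_minus_1:
  assumes "w \<in> \<D>" "z \<in> \<D>"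
  shows "norm (blaschke_factor w z - 1) \<le> (1 - norm w) * (2 / (1 - norm z))"
proof (cases "w = 0")
  case True
  have "norm (z - 1) \<le> 2" using norm_triangle_ineq4[of z 1] assms by simp
  also have "2 \<le> 2 / (1 - norm z)" using assms by (simp add: field_simps)
  finally show ?thesis using True by (simp add: blaschke_factor_def)
next
  case False
  define r where "r = norm w"
  have r: "0 < r" "r < 1" using False assms by (auto simp: r_def)
  have ww: "w * cnj w = of_real r * of_real r"
    using complex_norm_square[of w] by (simp add: r_def power2_eq_square)
  have d: "1 - cnj w * z \<noteq> 0" using disc_denom_nz assms by blast
  have "blaschke_factor w z - 1 = (of_real r * (w - z) - w * (1 - cnj w * z)) / (w * (1 - cnj w * z))"
  proof -
    define D where "D = 1 - cnj w * z"
    have D: "D \<noteq> 0" using d by (simp add: D_def)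
    show ?thesis unfolding blaschke_factor_def D_def[symmetric] r_def[symmetric]
      using False D by (simp add: field_simps)
  qed
  also have "of_real r * (w - z) - w * (1 - cnj w * z) = of_real r * (w - z) - w + (w * cnj w) * z"
    by (simp add: algebra_simps)
  also have "\<dots> = - (of_real (1 - r) * (w + of_real r * z))"
    unfolding ww by (simp add: algebra_simps)
  finally have "norm (blaschke_factor w z - 1) = (1 - r) * norm (w + of_real r * z) / (r * norm (1 - cnj w * z))"
    using r by (simp add: norm_divide norm_mult r_def[symmetric] del: of_real_diff)
  also have "\<dots> \<le> (1 - r) * (2 * r) / (r * (1 - norm z))"
  proof (intro frac_le mult_left_mono mult_nonneg_nonneg mult_pos_pos)
    have "norm (w + of_real r * z) \<le> norm w + norm (of_real r * z)" by (rule norm_triangle_ineq)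
    also have "norm (of_real r * z) \<le> r * 1"
      unfolding norm_mult using r assms by (intro mult_mono) auto
    finally show "norm (w + of_real r * z) \<le> 2 * r" by (simp add: r_def)
    show "1 - norm z \<le> norm (1 - cnj w * z)" using norm_disc_denom_bounds assms by blast
  qed (use r assms in auto)
  also have "\<dots> = (1 - r) * (2 / (1 - norm z))" using r by simp
  finally show ?thesis by (simp add: r_def)
qed

lemma blaschke_prod_convergent:
  assumes "blaschke_seq K a" "z \<in> \<D>"
  shows "convergent_prod (\<lambda>k. if k \<in> K then blaschke_factor (a k) z else 1)"
proof -
  have "summable (\<lambda>k. norm ((if k \<in> K then blaschke_factor (a k) z else 1) - 1))"
  proof (rule summable_comparison_test)
    show "summable (\<lambda>k. (if k \<in> K then 1 - norm (a k) else 0) * (2 / (1 - norm z)))"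
      by (intro summable_mult2 blaschke_seq_summable assms)
    have "norm (norm ((if k \<in> K then blaschke_factor (a k) z else 1) - 1))
        \<le> (if k \<in> K then 1 - norm (a k) else 0) * (2 / (1 - norm z))" for k
      using norm_blaschke_factor_minus_1[OF blaschke_seq_disc[OF assms(1), of k] assms(2)] by auto
    then show "\<exists>N. \<forall>n\<ge>N. norm (norm ((if n \<in> K then blaschke_factor (a n) z else 1) - 1))
        \<le> (if n \<in> K then 1 - norm (a n) else 0) * (2 / (1 - norm z))" by blast
  qed
  then show ?thesis
    using abs_convergent_prod_conv_summable abs_convergent_prod_imp_convergent_prod by blast
qed

lemma blaschke_prod_LIMSEQ:
  assumes "blaschke_seq K a" "z \<in> \<D>"
  shows "(\<lambda>n. \<Prod>k\<le>n. if k \<in> K then blaschke_factor (a k) z else 1) \<longlonglongrightarrow> blaschke_prod K a z"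
  unfolding blaschke_prod_def by (rule convergent_prod_LIMSEQ[OF blaschke_prod_convergent[OF assms]])

text \<open>
  Estimates for finite products of pseudohyperbolic distances pass to the limit through this lemma.
\<close>

lemma norm_blaschke_prod_LIMSEQ:
  assumes "blaschke_seq K a" "z \<in> \<D>"
  shows "(\<lambda>n. \<Prod>k\<in>K \<inter> {..n}. pseudohyp z (a k)) \<longlonglongrightarrow> norm (blaschke_prod K a z)"
proof -
  have "norm (\<Prod>k\<le>n. if k \<in> K then blaschke_factor (a k) z else 1) = (\<Prod>k\<in>K \<inter> {..n}. pseudohyp z (a k))" for n
  proof -
    have "norm (\<Prod>k\<le>n. if k \<in> K then blaschke_factor (a k) z else 1)
        = (\<Prod>k\<le>n. if k \<in> K then pseudohyp z (a k) else 1)"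
      unfolding prod_norm[symmetric] by (intro prod.cong) (auto simp: norm_blaschke_factor)
    also have "\<dots> = (\<Prod>k\<in>{..n} \<inter> K. pseudohyp z (a k))" by (subst prod.inter_restrict) auto
    finally show ?thesis by (simp add: Int_commute)
  qed
  with tendsto_norm[OF blaschke_prod_LIMSEQ[OF assms]] show ?thesis by simp
qed

lemma blaschke_prod_holomorphic:
  assumes "blaschke_seq K a"
  shows "blaschke_prod K a holomorphic_on \<D>"
proof (rule holomorphic_uniform_sequence[OF open_ball])
  define f where "f k z = (if k \<in> K then blaschke_factor (a k) z else 1)" for k z
  have hf: "f k holomorphic_on \<D>" for k
    using blaschke_factor_holomorphic[OF blaschke_seq_disc[OF assms, of k]]
    by (cases "k \<in> K") (auto simp: f_def[abs_def])
  show "(\<lambda>z. \<Prod>k<n. f k z) holomorphic_on \<D>" for n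
    by (intro holomorphic_intros hf)
  fix x assume x: "x \<in> \<D>"
  define d where "d = (1 - norm x) / 2"
  have d: "d > 0" using x by (simp add: d_def)
  have sub: "norm z \<le> (1 + norm x) / 2" if "z \<in> cball x d" for z
  proof -
    have "norm z \<le> norm x + norm (z - x)" by (metis add.commute diff_add_cancel norm_triangle_ineq)
    then show ?thesis using that by (simp add: d_def dist_norm norm_minus_commute field_simps)
  qed
  have sub1: "z \<in> \<D>" if "z \<in> cball x d" for z using sub[OF that] x by simp
  have "uniformly_convergent_on (cball x d) (\<lambda>N z. \<Sum>n<N. norm (f n z - 1))"
  proof (rule Weierstrass_m_test'[where M = "\<lambda>k. (if k \<in> K then 1 - norm (a k) else 0) * (4 / (1 - norm x))"])
    show "norm (norm (f n z - 1)) \<le> (if n \<in> K then 1 - norm (a n) else 0) * (4 / (1 - norm x))"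
      if "z \<in> cball x d" for n z
    proof (cases "n \<in> K")
      case True
      have "norm (f n z - 1) \<le> (1 - norm (a n)) * (2 / (1 - norm z))"
        using norm_blaschke_factor_minus_1[OF blaschke_seq_disc[OF assms True] sub1[OF that]] True by (simp add: f_def)
      also have "\<dots> \<le> (1 - norm (a n)) * (2 / ((1 - norm x) / 2))"
        using sub[OF that] x blaschke_seq_disc[OF assms True] by (intro mult_left_mono divide_left_mono) auto
      finally show ?thesis using True by simp
    qed (simp add: f_def)
    show "summable (\<lambda>k. (if k \<in> K then 1 - norm (a k) else 0) * (4 / (1 - norm x)))"
      by (intro summable_mult2 blaschke_seq_summable assms)
  qed
  then have "uniformly_convergent_on (cball x d) (\<lambda>N z. \<Prod>n<N. f n z)"
    by (intro uniformly_convergent_on_prod' compact_cball)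
       (use hf sub1 in \<open>meson continuous_on_subset holomorphic_on_imp_continuous_on subsetI\<close>)
  then obtain g where g: "uniform_limit (cball x d) (\<lambda>N z. \<Prod>n<N. f n z) g sequentially"
    by (auto simp: uniformly_convergent_on_def)
  have "g z = blaschke_prod K a z" if "z \<in> cball x d" for z
  proof -
    have "(\<lambda>N. \<Prod>n<N. f n z) \<longlonglongrightarrow> g z" using tendsto_uniform_limitI[OF g that] .
    then have "(\<lambda>N. \<Prod>n\<le>N. f n z) \<longlonglongrightarrow> g z"
      using LIMSEQ_Suc[of "\<lambda>N. \<Prod>n<N. f n z"] by (simp add: lessThan_Suc_atMost)
    then show ?thesis
      using blaschke_prod_LIMSEQ[OF assms sub1[OF that]] LIMSEQ_unique unfolding f_def by blast
  qed
  then have "uniform_limit (cball x d) (\<lambda>N z. \<Prod>n<N. f n z) (blaschke_prod K a) sequentially"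
    using g uniform_limit_cong'[of "cball x d" "\<lambda>N z. \<Prod>n<N. f n z" "\<lambda>N z. \<Prod>n<N. f n z" g "blaschke_prod K a"] by simp
  then show "\<exists>d>0. cball x d \<subseteq> \<D> \<and> uniform_limit (cball x d) (\<lambda>N z. \<Prod>n<N. f n z) (blaschke_prod K a) sequentially"
    using d sub1 by blast
qed

lemma blaschke_prod_finite: "finite A \<Longrightarrow> blaschke_prod A a z = (\<Prod>k\<in>A. blaschke_factor (a k) z)"
  unfolding blaschke_prod_def by (subst prodinf_finite[of A]) auto

lemma norm_blaschke_prod_finite: "finite A \<Longrightarrow> norm (blaschke_prod A a z) = (\<Prod>k\<in>A. pseudohyp z (a k))"
  by (simp add: blaschke_prod_finite prod_norm[symmetric] norm_blaschke_factor)

lemma blaschke_prod_empty [simp]: "blaschke_prod {} a z = 1"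
  by (simp add: blaschke_prod_finite)

lemma blaschke_prod_Un:
  assumes "blaschke_seq (A \<union> C) a" "A \<inter> C = {}" "z \<in> \<D>"
  shows "blaschke_prod (A \<union> C) a z = blaschke_prod A a z * blaschke_prod C a z"
proof -
  have s: "blaschke_seq A a" "blaschke_seq C a" using assms(1) blaschke_seq_subset by blast+
  show ?thesis unfolding blaschke_prod_def
    prodinf_mult[OF blaschke_prod_convergent[OF s(1) assms(3)] blaschke_prod_convergent[OF s(2) assms(3)]]
    by (rule prodinf_cong) (use assms(2) in auto)
qed

lemma blaschke_prod_split:
  assumes "blaschke_seq K a" "J \<subseteq> K" "z \<in> \<D>"
  shows "blaschke_prod K a z = blaschke_prod J a z * blaschke_prod (K - J) a z"
  using blaschke_prod_Un[of J "K - J" a z] assms by (simp add: Un_absorb1)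

lemma blaschke_prod_UN:
  assumes "finite I" "blaschke_seq (\<Union>i\<in>I. C i) a" "disjoint_family_on C I" "z \<in> \<D>"
  shows "blaschke_prod (\<Union>i\<in>I. C i) a z = (\<Prod>i\<in>I. blaschke_prod (C i) a z)"
  using assms
proof (induction rule: finite_induct)
  case (insert i I)
  have "C i \<inter> (\<Union>i\<in>I. C i) = {}" using insert.prems(2) insert.hyps by (auto simp: disjoint_family_on_def)
  moreover have "blaschke_prod (\<Union>i\<in>I. C i) a z = (\<Prod>i\<in>I. blaschke_prod (C i) a z)"
  proof (rule insert.IH)
    show "blaschke_seq (\<Union>i\<in>I. C i) a" using insert.prems(1) by (rule blaschke_seq_subset) auto
    show "disjoint_family_on C I" using insert.prems(2) by (rule disjoint_family_on_mono[rotated]) auto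
  qed fact
  ultimately show ?case using insert.hyps insert.prems by (simp add: blaschke_prod_Un)
qed simp

lemma norm_blaschke_prod_le_1:
  assumes "blaschke_seq K a" "z \<in> \<D>"
  shows "norm (blaschke_prod K a z) \<le> 1"
  using norm_blaschke_prod_LIMSEQ[OF assms]
proof (rule LIMSEQ_le_const2)
  show "\<exists>N. \<forall>n\<ge>N. (\<Prod>k\<in>K \<inter> {..n}. pseudohyp z (a k)) \<le> 1"
    using pseudohyp_le_1[OF assms(2)] blaschke_seq_disc[OF assms(1)] by (auto intro!: prod_le_1)
qed

lemma norm_blaschke_prod_antimono:
  assumes "blaschke_seq K a" "J \<subseteq> K" "z \<in> \<D>"
  shows "norm (blaschke_prod K a z) \<le> norm (blaschke_prod J a z)"
  using norm_blaschke_prod_le_1[OF blaschke_seq_subset[OF assms(1)] assms(3), of "K - J"]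
  unfolding blaschke_prod_split[OF assms] norm_mult by (simp add: mult_left_le)

lemma norm_blaschke_prod_le_pseudohyp:
  assumes "blaschke_seq K a" "k \<in> K" "z \<in> \<D>"
  shows "norm (blaschke_prod K a z) \<le> pseudohyp z (a k)"
  using norm_blaschke_prod_antimono[OF assms(1) _ assms(3), of "{k}"] assms(2)
  by (simp add: norm_blaschke_prod_finite)

lemma blaschke_prod_at_zero:
  assumes "blaschke_seq K a" "k \<in> K"
  shows "blaschke_prod K a (a k) = 0"
  using norm_blaschke_prod_le_pseudohyp[OF assms blaschke_seq_disc[OF assms]] by simp

text \<open>
  Schwarz's lemma, transported from \<open>0\<close> to \<open>b\<close>. That lemma concerns functions with
  \<open>|F| < 1\<close>; the factor \<open>r < 1\<close> makes it applicable to \<open>|F| \<le> 1\<close> and is removed at the end.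
\<close>

lemma Schwarz_pseudohyp:
  assumes F: "F holomorphic_on \<D>" "\<And>z. z \<in> \<D> \<Longrightarrow> norm (F z) \<le> 1" and b: "b \<in> \<D>" "F b = 0" and z: "z \<in> \<D>"
  shows "norm (F z) \<le> pseudohyp z b"
proof (rule field_le_mult_one_interval)
  fix r :: real assume r: "0 < r" "r < 1"
  have im: "disc_auto b ` \<D> \<subseteq> \<D>" using disc_auto_in_disc[OF b(1)] by blast
  have "norm (of_real r * F (disc_auto b (disc_auto b z))) \<le> norm (disc_auto b z)"
  proof (rule Schwarz_Lemma(1)[where f = "\<lambda>v. of_real r * F (disc_auto b v)"])
    have "(\<lambda>v. F (disc_auto b v)) holomorphic_on \<D>"
      using holomorphic_on_compose_gen[OF disc_auto_holomorphic[OF b(1)] F(1) im] by (simp add: o_def)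
    then show "(\<lambda>v. of_real r * F (disc_auto b v)) holomorphic_on \<D>" by (intro holomorphic_intros)
    show "norm (of_real r * F (disc_auto b v)) < 1" if "norm v < 1" for v
    proof -
      have "r * norm (F (disc_auto b v)) \<le> r * 1"
        using F(2)[OF disc_auto_in_disc[OF b(1)]] that r by (intro mult_left_mono) auto
      then have "r * norm (F (disc_auto b v)) < 1" using r by linarith
      then show ?thesis using r by (simp add: norm_mult)
    qed
    show "norm (disc_auto b z) < 1" using disc_auto_in_disc[OF b(1) z] by simp
  qed (use b in simp)
  then show "r * norm (F z) \<le> pseudohyp z b"
    unfolding pseudohyp_commute[of z b] unfolding pseudohyp_norm_disc_auto
    using r disc_auto_invol[OF b(1) z] by (simp add: norm_mult)
qed

text \<open>
  The zeros are divided out one at a time: by Schwarz's lemma at \<open>b\<close>, the quotient of \<open>F\<close> by the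
  Blaschke factor of \<open>b\<close> is again bounded by \<open>1\<close>.
\<close>

lemma norm_le_prod_pseudohyp:
  assumes "finite Z" "Z \<subseteq> \<D>" "F holomorphic_on \<D>" "\<And>z. z \<in> \<D> \<Longrightarrow> norm (F z) \<le> 1"
    "\<And>b. b \<in> Z \<Longrightarrow> F b = 0" "z \<in> \<D>"
  shows "norm (F z) \<le> (\<Prod>b\<in>Z. pseudohyp z b)"
  using assms
proof (induction Z arbitrary: F rule: finite_induct)
  case (insert b Z)
  have b: "b \<in> \<D>" "F b = 0" using insert.prems by auto
  define g where "g v = (if v = b then deriv F b else (F v - F b) / (v - b))" for v
  have g: "g holomorphic_on \<D>" unfolding g_def by (rule pole_lemma_open[OF insert.prems(2) open_ball])
  have Fg: "F v = (v - b) * g v" for v using b by (simp add: g_def)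
  define G where "G v = (1 - cnj b * v) * g v" for v
  have G: "G holomorphic_on \<D>" unfolding G_def by (intro holomorphic_intros g)
  have FG: "norm (F v) = pseudohyp v b * norm (G v)" if "v \<in> \<D>" for v
    using disc_denom_nz[OF b(1) that] unfolding pseudohyp_commute[of v b]
    by (simp add: Fg G_def pseudohyp_def norm_mult norm_divide norm_minus_commute)
  have G1: "norm (G v) \<le> 1" if v: "v \<in> \<D>" "v \<noteq> b" for v
  proof -
    have "pseudohyp v b * norm (G v) \<le> pseudohyp v b * 1"
      using Schwarz_pseudohyp[OF insert.prems(2,3) b v(1)] FG[OF v(1)] by simp
    moreover have "pseudohyp v b > 0" using pseudohyp_eq_0_iff[OF v(1) b(1)] v(2) pseudohyp_nonneg[of v b] by linarith
    ultimately show ?thesis by (simp only: mult_le_cancel_left_pos)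
  qed
  have "norm (G b) \<le> 1"
  proof (rule tendsto_upperbound)
    have "continuous_on \<D> G" using G holomorphic_on_imp_continuous_on by blast
    then have "(G \<longlongrightarrow> G b) (at b)"
      using b(1) by (simp add: continuous_on_eq_continuous_at[OF open_ball] isCont_def)
    then show "((\<lambda>v. norm (G v)) \<longlongrightarrow> norm (G b)) (at b)" by (rule tendsto_norm)
    have "eventually (\<lambda>v. v \<in> \<D> \<and> v \<noteq> b) (at b)"
      using eventually_at_in_open[OF open_ball b(1)] by (simp add: conj_commute)
    then show "eventually (\<lambda>v. norm (G v) \<le> 1) (at b)" by eventually_elim (use G1 in blast)
  qed simp
  then have G2: "norm (G v) \<le> 1" if "v \<in> \<D>" for v using G1 that by (cases "v = b") auto
  have "norm (G z) \<le> (\<Prod>b\<in>Z. pseudohyp z b)"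
  proof (rule insert.IH)
    show "G v = 0" if "v \<in> Z" for v
    proof -
      have v: "v \<noteq> b" "F v = 0" using that insert.hyps insert.prems by auto
      then have "g v = 0" using Fg[of v] by simp
      then show ?thesis by (simp add: G_def)
    qed
  qed (use insert.prems G G2 in auto)
  then show ?case using insert.hyps FG[OF insert.prems(5)] by (simp add: mult_left_mono)
qed simp

lemma norm_le_blaschke_prod:
  assumes "F holomorphic_on \<D>" "\<And>z. z \<in> \<D> \<Longrightarrow> norm (F z) \<le> 1"
    and J: "blaschke_seq J a" "inj_on a J" "\<And>k. k \<in> J \<Longrightarrow> F (a k) = 0" and z: "z \<in> \<D>"
  shows "norm (F z) \<le> norm (blaschke_prod J a z)"
  using norm_blaschke_prod_LIMSEQ[OF J(1) z]
proof (rule LIMSEQ_le_const, intro exI allI impI)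
  fix n :: nat
  have inj: "inj_on a (J \<inter> {..n})" using J(2) by (rule inj_on_subset) auto
  have "norm (F z) \<le> (\<Prod>b\<in>a ` (J \<inter> {..n}). pseudohyp z b)"
    by (rule norm_le_prod_pseudohyp) (use assms blaschke_seq_disc[OF J(1)] in auto)
  then show "norm (F z) \<le> (\<Prod>k\<in>J \<inter> {..n}. pseudohyp z (a k))"
    by (simp add: prod.reindex[OF inj])
qed

section \<open>The harmonic majorant of a Blaschke sequence\<close>

text \<open>
  The Herglotz kernel with the boundary point replaced by \<open>w\<close>, weighted so that the sum over a Blaschke
  sequence converges.
\<close>

definition herglotz_term :: "complex \<Rightarrow> complex \<Rightarrow> complex" where
  "herglotz_term w z = of_real (1 - (norm w)\<^sup>2) * ((1 + cnj w * z) / (1 - cnj w * z))"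

lemma Re_herglotz_term:
  "Re (herglotz_term w z) = (1 - (norm w)\<^sup>2) * (1 - (norm w)\<^sup>2 * (norm z)\<^sup>2) / (norm (1 - cnj w * z))\<^sup>2"
proof -
  have "Re ((1 + u) / (1 - u)) = (1 - (norm u)\<^sup>2) / (norm (1 - u))\<^sup>2" for u :: complex
    unfolding Re_divide cmod_power2 by (simp add: power2_eq_square algebra_simps)
  from this[of "cnj w * z"] show ?thesis
    unfolding herglotz_term_def
    by (simp add: norm_mult power_mult_distrib del: of_real_diff of_real_power times_divide_eq_right) simp
qed

text \<open>
  In the formula for the real part, \<open>1 - |w|^2 |z|^2\<close> is at least \<open>1 - |z|^2\<close>, which gives the first
  bound, and at least \<open>1 - |w|^2\<close>, which gives the second.
\<close>

lemma Re_herglotz_term_ge: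
  assumes "w \<in> \<D>" "z \<in> \<D>"
  shows "1 - (pseudohyp z w)\<^sup>2 \<le> Re (herglotz_term w z)"
    and "((1 - (norm w)\<^sup>2) / norm (1 - cnj w * z))\<^sup>2 \<le> Re (herglotz_term w z)"
    and "0 \<le> Re (herglotz_term w z)"
proof -
  define x y where "x = (norm w)\<^sup>2" and "y = (norm z)\<^sup>2"
  have xy: "0 \<le> x" "x \<le> 1" "0 \<le> y" "y \<le> 1" using assms by (auto simp: x_def y_def power_le_one)
  have xy1: "x * y \<le> x" "x * y \<le> y" using xy by (auto simp: mult_left_le mult_left_le_one_le)
  define D where "D = (norm (1 - cnj w * z))\<^sup>2"
  have D: "D > 0" using disc_denom_nz(2)[OF assms] by (simp add: D_def)
  have R: "Re (herglotz_term w z) = (1 - x) * (1 - x * y) / D"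
    by (simp add: Re_herglotz_term x_def y_def D_def)
  have "1 - (pseudohyp z w)\<^sup>2 = (1 - x) * (1 - y) / D"
    unfolding pseudohyp_commute[of z w] one_minus_pseudohyp_sq[OF assms] by (simp add: x_def y_def D_def)
  also have "\<dots> \<le> (1 - x) * (1 - x * y) / D"
    using D xy xy1 by (intro divide_right_mono mult_left_mono) auto
  finally show "1 - (pseudohyp z w)\<^sup>2 \<le> Re (herglotz_term w z)" by (simp add: R)
  have "((1 - (norm w)\<^sup>2) / norm (1 - cnj w * z))\<^sup>2 = (1 - x) * (1 - x) / D"
    by (simp add: power_divide D_def x_def power2_eq_square)
  also have "\<dots> \<le> (1 - x) * (1 - x * y) / D"
    using D xy xy1 by (intro divide_right_mono mult_left_mono) auto
  finally show "((1 - (norm w)\<^sup>2) / norm (1 - cnj w * z))\<^sup>2 \<le> Re (herglotz_term w z)" by (simp add: R)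
  show "0 \<le> Re (herglotz_term w z)" using R D xy xy1 by simp
qed

lemma one_minus_sq_le: "w \<in> \<D> \<Longrightarrow> 1 - (norm w)\<^sup>2 \<le> 2 * (1 - norm w)"
proof -
  assume "w \<in> \<D>"
  have "0 \<le> (1 - norm w)\<^sup>2" by simp
  then show ?thesis by (simp add: power2_eq_square algebra_simps)
qed

lemma norm_herglotz_term:
  assumes "w \<in> \<D>" "z \<in> \<D>"
  shows "norm (herglotz_term w z) \<le> (1 - norm w) * 4 / (1 - norm z)"
proof -
  have "norm (1 + cnj w * z) \<le> 2"
  proof -
    have "norm w * norm z \<le> 1 * 1" using assms by (intro mult_mono) auto
    then show ?thesis using norm_triangle_ineq[of 1 "cnj w * z"] by (simp add: norm_mult)
  qed
  moreover have "0 \<le> 1 - (norm w)\<^sup>2" using assms by (simp add: power_le_one)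
  ultimately have "(1 - (norm w)\<^sup>2) * (norm (1 + cnj w * z) / norm (1 - cnj w * z))
      \<le> (2 * (1 - norm w)) * (2 / (1 - norm z))"
    using assms norm_disc_denom_bounds[OF assms] disc_denom_nz[OF assms] one_minus_sq_le[OF assms(1)]
    by (intro mult_mono frac_le) auto
  moreover have "norm (herglotz_term w z) = (1 - (norm w)\<^sup>2) * (norm (1 + cnj w * z) / norm (1 - cnj w * z))"
    using assms by (simp add: herglotz_term_def norm_mult norm_divide power_le_one del: of_real_diff of_real_power)
  moreover have "(2 * (1 - norm w)) * (2 / (1 - norm z)) = (1 - norm w) * 4 / (1 - norm z)" by simp
  ultimately show ?thesis by linarith
qed

lemma disc_series:
  fixes f :: "nat \<Rightarrow> complex \<Rightarrow> complex"
  assumes f: "\<And>k. f k holomorphic_on \<D>" and c: "summable c" "\<And>k. 0 \<le> c k"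
    and b: "\<And>k z. z \<in> \<D> \<Longrightarrow> norm (f k z) \<le> c k / (1 - norm z) ^ p"
  shows "(\<lambda>z. \<Sum>k. f k z) holomorphic_on \<D>"
    and "z \<in> \<D> \<Longrightarrow> summable (\<lambda>k. norm (f k z))"
proof -
  show "(\<lambda>z. \<Sum>k. f k z) holomorphic_on \<D>"
  proof (rule holomorphic_uniform_sequence[OF open_ball])
    show "(\<lambda>z. \<Sum>k<n. f k z) holomorphic_on \<D>" for n by (intro holomorphic_intros f)
    fix x assume x: "x \<in> \<D>"
    define d where "d = (1 - norm x) / 2"
    have d: "d > 0" using x by (simp add: d_def)
    have sub: "d \<le> 1 - norm z" if "z \<in> cball x d" for z
    proof -
      have "norm z \<le> norm x + norm (z - x)" by (metis add.commute diff_add_cancel norm_triangle_ineq)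
      then show ?thesis using that by (simp add: d_def dist_norm norm_minus_commute field_simps)
    qed
    have sub1: "cball x d \<subseteq> \<D>" using sub d by fastforce
    have "uniform_limit (cball x d) (\<lambda>n z. \<Sum>k<n. f k z) (\<lambda>z. \<Sum>k. f k z) sequentially"
    proof (rule Weierstrass_m_test)
      show "summable (\<lambda>k. c k / d ^ p)" by (intro summable_divide c)
      show "norm (f k z) \<le> c k / d ^ p" if "z \<in> cball x d" for k z
      proof -
        have "norm (f k z) \<le> c k / (1 - norm z) ^ p" using b sub1 that by blast
        also have "\<dots> \<le> c k / d ^ p" using sub[OF that] d c
          by (intro divide_left_mono power_mono) auto
        finally show ?thesis .
      qed
    qed
    then show "\<exists>d>0. cball x d \<subseteq> \<D> \<and> uniform_limit (cball x d) (\<lambda>n z. \<Sum>k<n. f k z) (\<lambda>z. \<Sum>k. f k z) sequentially"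
      using d sub1 by blast
  qed
  assume z: "z \<in> \<D>"
  show "summable (\<lambda>k. norm (f k z))"
    by (rule summable_comparison_test[OF _ summable_divide[OF c(1), of "(1 - norm z) ^ p"]])
       (use b[OF z] in auto)
qed

text \<open>
  The first sum controls Blaschke products, the second one the series that solves the interpolation
  problem. Bounding finite partial sums includes the convergence of both.
\<close>

definition blaschke_majorant :: "nat set \<Rightarrow> (nat \<Rightarrow> complex) \<Rightarrow> (complex \<Rightarrow> real) \<Rightarrow> bool" where
  "blaschke_majorant K a S \<longleftrightarrow> S \<in> Har_pos \<and> (\<forall>z\<in>\<D>. \<forall>F. finite F \<longrightarrow> F \<subseteq> K \<longrightarrow>
     (\<Sum>k\<in>F. 1 - (pseudohyp z (a k))\<^sup>2) \<le> S z \<and>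
     (\<Sum>k\<in>F. ((1 - (norm (a k))\<^sup>2) / norm (1 - cnj (a k) * z))\<^sup>2) \<le> S z)"

lemma blaschke_majorant_exists:
  assumes "blaschke_seq K a"
  obtains S where "blaschke_majorant K a S"
proof -
  define f where "f k z = (if k \<in> K then herglotz_term (a k) z else 0)" for k z
  define c where "c k = (if k \<in> K then 1 - norm (a k) else 0) * 4" for k
  have c: "summable c" "\<And>k. 0 \<le> c k"
    using summable_mult2[OF blaschke_seq_summable[OF assms]] less_imp_le[OF blaschke_seq_disc[OF assms, simplified]]
    by (auto simp: c_def[abs_def])
  have f: "f k holomorphic_on \<D>" for k
  proof (cases "k \<in> K")
    case True
    then have "herglotz_term (a k) holomorphic_on \<D>"
      unfolding herglotz_term_def using disc_denom_nz(1)[OF blaschke_seq_disc[OF assms]]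
      by (auto intro!: holomorphic_intros)
    then show ?thesis using True by (simp add: f_def[abs_def])
  qed (simp add: f_def[abs_def])
  have b: "norm (f k z) \<le> c k / (1 - norm z) ^ 1" if "z \<in> \<D>" for k z
    using norm_herglotz_term[OF blaschke_seq_disc[OF assms] that] by (auto simp: f_def c_def)
  \<comment> \<open>The summand \<open>1\<close> makes \<open>S\<close> positive even if there are no zeros.\<close>
  define S where "S z = 1 + Re (\<Sum>k. f k z)" for z
  have pos: "0 \<le> Re (f k z)" if "z \<in> \<D>" for k z
    using Re_herglotz_term_ge(3)[OF blaschke_seq_disc[OF assms] that] by (auto simp: f_def)
  have le: "(\<Sum>k\<in>F. Re (f k z)) \<le> S z - 1" if "z \<in> \<D>" "finite F" for F z
  proof -
    have "summable (\<lambda>k. f k z)" using disc_series(2)[OF f c b that(1)] by (rule summable_norm_cancel)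
    then have "(\<lambda>k. Re (f k z)) sums (S z - 1)"
      using summable_sums sums_Re by (fastforce simp: S_def)
    then show ?thesis
      using sum_le_suminf[OF sums_summable that(2)] pos[OF that(1)] sums_unique by metis
  qed
  have "S \<in> Har_pos" unfolding Har_pos_iff_Re
  proof (intro exI conjI ballI)
    show "(\<lambda>z. 1 + (\<Sum>k. f k z)) holomorphic_on \<D>"
      by (intro holomorphic_intros disc_series(1)[OF f c b])
    show "S z = Re (1 + (\<Sum>k. f k z))" for z by (simp add: S_def)
    then show "0 < Re (1 + (\<Sum>k. f k z))" if "z \<in> \<D>" for z using le[OF that, of "{}"] by (metis add_le_cancel_left diff_add_cancel finite.emptyI le_diff_eq less_add_one order_less_le_trans sum.empty add.left_neutral zero_less_one)
  qed
  moreover have "(\<Sum>k\<in>F. 1 - (pseudohyp z (a k))\<^sup>2) \<le> S z \<and>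
     (\<Sum>k\<in>F. ((1 - (norm (a k))\<^sup>2) / norm (1 - cnj (a k) * z))\<^sup>2) \<le> S z"
    if z: "z \<in> \<D>" and F: "finite F" "F \<subseteq> K" for z F
  proof -
    have "(\<Sum>k\<in>F. 1 - (pseudohyp z (a k))\<^sup>2) \<le> (\<Sum>k\<in>F. Re (f k z))"
         "(\<Sum>k\<in>F. ((1 - (norm (a k))\<^sup>2) / norm (1 - cnj (a k) * z))\<^sup>2) \<le> (\<Sum>k\<in>F. Re (f k z))"
      using Re_herglotz_term_ge[OF blaschke_seq_disc[OF assms] z] F(2)
      by (auto intro!: sum_mono simp: f_def subset_eq)
    then show ?thesis using le[OF z F(1)] by linarith
  qed
  ultimately show ?thesis using that unfolding blaschke_majorant_def by blast
qed

lemma blaschke_majorant_Har_pos: "blaschke_majorant K a S \<Longrightarrow> S \<in> Har_pos"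
  by (simp add: blaschke_majorant_def)

text \<open>
  Each such zero adds at least \<open>1 - t^2\<close> to a sum that is bounded by \<open>S z\<close>.
\<close>

lemma finite_near_zeros:
  assumes "blaschke_seq K a" "z \<in> \<D>" "t < 1"
  shows "finite {k \<in> K. pseudohyp z (a k) \<le> t}"
proof (rule ccontr)
  assume inf: "infinite {k \<in> K. pseudohyp z (a k) \<le> t}"
  then have t: "0 \<le> t" using pseudohyp_nonneg order_trans not_finite_existsD by (metis (mono_tags, lifting))
  obtain S where S: "blaschke_majorant K a S" using blaschke_majorant_exists[OF assms(1)] .
  have e: "0 < 1 - t\<^sup>2" using t assms(3) by (simp add: power_less_one_iff)
  obtain n :: nat where n: "S z / (1 - t\<^sup>2) < n" using reals_Archimedean2 by blast
  obtain F where F: "F \<subseteq> {k \<in> K. pseudohyp z (a k) \<le> t}" "finite F" "card F = n"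
    using infinite_arbitrarily_large[OF inf] by blast
  have "real n * (1 - t\<^sup>2) \<le> (\<Sum>k\<in>F. 1 - (pseudohyp z (a k))\<^sup>2)"
  proof -
    have "(\<Sum>k\<in>F. 1 - t\<^sup>2) \<le> (\<Sum>k\<in>F. 1 - (pseudohyp z (a k))\<^sup>2)"
      using F(1) by (intro sum_mono diff_left_mono power_mono) auto
    then show ?thesis using F(3) by simp
  qed
  also have "\<dots> \<le> S z" using S F assms(2) unfolding blaschke_majorant_def by blast
  finally show False using n e by (simp add: pos_divide_less_eq)
qed

text \<open>
  If \<open>\<rho> \<ge> 1/3\<close> then \<open>1 \<le> \<rho> (1 + 5 (1 - \<rho>^2))\<close>, and otherwise \<open>3 \<le> 1 + 5 (1 - \<rho>^2)\<close>. Thus a single bound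
  covers far zeros, where \<open>x \<le> 1\<close> is used, and near zeros, where \<open>x \<le> 3 \<rho>\<close> is used.
\<close>

lemma compare_factor:
  fixes x \<rho> :: real
  assumes "x \<le> 1" "x \<le> 3 * \<rho>" "0 \<le> \<rho>" "\<rho> \<le> 1"
  shows "x \<le> \<rho> * exp (5 * (1 - \<rho>\<^sup>2))"
proof -
  have "x \<le> \<rho> * (1 + 5 * (1 - \<rho>\<^sup>2))"
  proof (cases "1/3 \<le> \<rho>")
    case True
    have "0 \<le> (1 - \<rho>) * (5 * \<rho>\<^sup>2 + 5 * \<rho> - 1)"
      using True assms by (intro mult_nonneg_nonneg) (auto simp: add_increasing)
    also have "\<dots> = \<rho> * (1 + 5 * (1 - \<rho>\<^sup>2)) - 1"
      by (simp add: algebra_simps power2_eq_square)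
    finally show ?thesis using assms by linarith
  next
    case False
    then have "\<rho>\<^sup>2 \<le> (1/3)\<^sup>2" using assms by (intro power_mono) auto
    then have "3 \<le> 1 + 5 * (1 - \<rho>\<^sup>2)" by (simp add: power2_eq_square)
    then have "\<rho> * 3 \<le> \<rho> * (1 + 5 * (1 - \<rho>\<^sup>2))" using assms by (intro mult_left_mono)
    then show ?thesis using assms by linarith
  qed
  also have "\<dots> \<le> \<rho> * exp (5 * (1 - \<rho>\<^sup>2))"
    using assms by (intro mult_left_mono exp_ge_add_one_self)
  finally show ?thesis .
qed

lemma compare_prod:
  assumes S: "blaschke_majorant K a S" and K: "a ` K \<subseteq> \<D>" and z: "z \<in> \<D>" and F: "finite F" "F \<subseteq> K"
    and x: "\<And>j. j \<in> F \<Longrightarrow> 0 \<le> x j" "\<And>j. j \<in> F \<Longrightarrow> x j \<le> 1" "\<And>j. j \<in> F \<Longrightarrow> x j \<le> 3 * pseudohyp z (a j)"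
  shows "prod x F \<le> exp (5 * S z) * (\<Prod>j\<in>F. pseudohyp z (a j))"
proof -
  have "prod x F \<le> (\<Prod>j\<in>F. pseudohyp z (a j) * exp (5 * (1 - (pseudohyp z (a j))\<^sup>2)))"
  proof (intro prod_mono conjI compare_factor)
    show "pseudohyp z (a j) \<le> 1" if "j \<in> F" for j
      using pseudohyp_le_1[OF z] K F(2) that by blast
  qed (use x in auto)
  also have "\<dots> = (\<Prod>j\<in>F. pseudohyp z (a j)) * exp (5 * (\<Sum>j\<in>F. 1 - (pseudohyp z (a j))\<^sup>2))"
    by (simp add: prod.distrib exp_sum[OF F(1)] sum_distrib_left)
  also have "\<dots> \<le> (\<Prod>j\<in>F. pseudohyp z (a j)) * exp (5 * S z)"
    using S F z unfolding blaschke_majorant_def by (intro mult_left_mono prod_nonneg) auto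
  finally show ?thesis by (simp add: mult.commute)
qed

text \<open>
  The number of zeros near \<open>z\<close> may be unbounded as \<open>z\<close> varies, but each costs a constant factor only
  and their number is at most a multiple of \<open>S z\<close>; the zeros far from \<open>z\<close> cost \<open>exp (5 * S z)\<close>
  altogether even if their factors at \<open>w\<close> are replaced by \<open>1\<close>.
\<close>

lemma blaschke_prod_compare:
  assumes K: "blaschke_seq K a" and S: "blaschke_majorant K a S" and z: "z \<in> \<D>" "w \<in> \<D>" and J: "J \<subseteq> K"
    and c: "\<And>j. j \<in> J \<Longrightarrow> pseudohyp w (a j) \<le> 3 * pseudohyp z (a j)"
  shows "norm (blaschke_prod J a w) \<le> exp (5 * S z) * norm (blaschke_prod J a z)"
proof (rule LIMSEQ_le[OF norm_blaschke_prod_LIMSEQ tendsto_mult_left[OF norm_blaschke_prod_LIMSEQ]])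
  show "blaschke_seq J a" using blaschke_seq_subset[OF K J] .
  then show "blaschke_seq J a" .
  have "(\<Prod>k\<in>J \<inter> {..n}. pseudohyp w (a k)) \<le> exp (5 * S z) * (\<Prod>k\<in>J \<inter> {..n}. pseudohyp z (a k))" for n
    by (rule compare_prod[OF S _ z(1)])
       (use K J c pseudohyp_le_1[OF z(2)] blaschke_seq_disc[OF K] in auto)
  then show "\<exists>N. \<forall>n\<ge>N. (\<Prod>k\<in>J \<inter> {..n}. pseudohyp w (a k)) \<le> exp (5 * S z) * (\<Prod>k\<in>J \<inter> {..n}. pseudohyp z (a k))"
    by blast
qed (use z in auto)

lemma blaschke_prod_far:
  assumes K: "blaschke_seq K a" and S: "blaschke_majorant K a S" and z: "z \<in> \<D>" and J: "J \<subseteq> K"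
    and c: "\<And>j. j \<in> J \<Longrightarrow> 1/3 \<le> pseudohyp z (a j)"
  shows "exp (- (5 * S z)) \<le> norm (blaschke_prod J a z)"
proof (rule LIMSEQ_le_const[OF norm_blaschke_prod_LIMSEQ])
  show "blaschke_seq J a" using blaschke_seq_subset[OF K J] .
  have "exp (- (5 * S z)) \<le> (\<Prod>k\<in>J \<inter> {..n}. pseudohyp z (a k))" for n
  proof -
    have "(\<Prod>k\<in>J \<inter> {..n}. 1) \<le> exp (5 * S z) * (\<Prod>k\<in>J \<inter> {..n}. pseudohyp z (a k))"
      by (rule compare_prod[OF S _ z]) (use K J c blaschke_seq_disc[OF K] in \<open>force+\<close>)
    then show ?thesis by (simp add: exp_minus divide_simps mult.commute)
  qed
  then show "\<exists>N. \<forall>n\<ge>N. exp (- (5 * S z)) \<le> (\<Prod>k\<in>J \<inter> {..n}. pseudohyp z (a k))" by blast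
qed (use z in auto)

lemma blaschke_prod_nonzero:
  assumes "blaschke_seq K a" "z \<in> \<D>" "z \<notin> a ` K"
  shows "blaschke_prod K a z \<noteq> 0"
proof -
  obtain S where S: "blaschke_majorant K a S" using blaschke_majorant_exists[OF assms(1)] .
  define J where "J = {k \<in> K. pseudohyp z (a k) \<le> 1/3}"
  have J: "finite J" "J \<subseteq> K" unfolding J_def by (rule finite_near_zeros[OF assms(1,2)]) auto
  have "exp (- (5 * S z)) \<le> norm (blaschke_prod (K - J) a z)"
    by (rule blaschke_prod_far[OF assms(1) S assms(2)]) (auto simp: J_def)
  then have "blaschke_prod (K - J) a z \<noteq> 0" by (metis exp_gt_zero linorder_not_le norm_zero)
  moreover have "pseudohyp z (a k) \<noteq> 0" if "k \<in> J" for k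
    using that J assms pseudohyp_eq_0_iff[OF assms(2) blaschke_seq_disc[OF assms(1)]] by blast
  then have "norm (blaschke_prod J a z) \<noteq> 0" by (simp add: norm_blaschke_prod_finite J)
  ultimately show ?thesis unfolding blaschke_prod_split[OF assms(1) J(2) assms(2)] by auto
qed

section \<open>Interpolation for separated sequences\<close>

lemma log_plus_le:
  assumes "0 \<le> x" "0 \<le> y" "x \<le> exp y"
  shows "log_plus x \<le> y"
proof (cases "x = 0")
  case False
  then have "ln x \<le> ln (exp y)" using assms by (subst ln_le_cancel_iff) auto
  then show ?thesis using assms by (simp add: log_plus_def)
qed (use assms in \<open>simp add: log_plus_def\<close>)

lemma le_exp_log_plus: "0 \<le> x \<Longrightarrow> x \<le> exp (log_plus x)"
proof (cases "x = 0")
  case False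
  assume "0 \<le> x"
  then have "x = exp (ln x)" using False by simp
  also have "\<dots> \<le> exp (log_plus x)" by (simp add: log_plus_def)
  finally show ?thesis .
qed simp

lemma log_plus_nonneg [simp]: "0 \<le> log_plus x" by (simp add: log_plus_def)

text \<open>
  Let \<open>H\<close> bound \<open>- ln |B_k (a k)|\<close>, let \<open>Hw\<close> bound the data and let \<open>Re G = H + Hw\<close>. The series
  \<open>\<Sum>k. w k * (B_k z / B_k (a k)) * exp (G z - G (a k)) * ((1 - |a k|^2) / (1 - cnj (a k) * z))^2\<close>
  takes the value \<open>w k\<close> at \<open>a k\<close>. By the choice of \<open>G\<close> the constant coefficients are bounded by \<open>1\<close>, so
  the sum is at most \<open>exp (H z + Hw z) * S z\<close>, whose logarithm is at most \<open>H z + Hw z + S z\<close>.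
\<close>

theorem nevanlinna_interpolating_if_separated:
  assumes C: "blaschke_seq C a" "inj_on a C" and H: "H \<in> Har_pos"
    and sep: "\<And>k. k \<in> C \<Longrightarrow> exp (- H (a k)) \<le> norm (blaschke_prod (C - {k}) a (a k))"
  shows "nevanlinna_interpolating C a"
  unfolding nevanlinna_interpolating_def
proof (intro conjI ballI)
  show "a ` C \<subseteq> \<D>" using blaschke_seq_disc[OF C(1)] by blast
  show "inj_on a C" by fact
  fix w assume "w \<in> nevanlinna_data C a"
  then obtain Hw where Hw: "Hw \<in> Har_pos" "\<And>k. k \<in> C \<Longrightarrow> log_plus (norm (w k)) \<le> Hw (a k)"
    by (auto simp: nevanlinna_data_def)
  obtain S where S: "blaschke_majorant C a S" using blaschke_majorant_exists[OF C(1)] .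
  note S_pos = blaschke_majorant_Har_pos[OF S]
  have "(\<lambda>z. H z + Hw z) \<in> Har_pos" using H Hw(1) by (rule Har_pos_add)
  then obtain G where G: "G holomorphic_on \<D>" "\<And>z. z \<in> \<D> \<Longrightarrow> Re (G z) = H z + Hw z"
    unfolding Har_pos_iff_Re by metis
  have disc: "a k \<in> \<D>" if "k \<in> C" for k using blaschke_seq_disc[OF C(1) that] .
  have Cs: "blaschke_seq (C - {k}) a" for k using blaschke_seq_subset[OF C(1)] by blast
  \<comment> \<open>The factor \<open>exp (G z)\<close> stays outside the series, whose terms then have bounds of the form needed for uniform convergence.\<close>
  define \<beta> where "\<beta> k = w k / blaschke_prod (C - {k}) a (a k) * exp (- G (a k))" for k
  define u where "u k z = of_real (1 - (norm (a k))\<^sup>2) / (1 - cnj (a k) * z)" for k z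
  define t where "t k z = (if k \<in> C then \<beta> k * blaschke_prod (C - {k}) a z * (u k z)\<^sup>2 else 0)" for k z
  have \<beta>: "norm (\<beta> k) \<le> 1" if k: "k \<in> C" for k
  proof -
    have "norm (w k) \<le> exp (Hw (a k))"
      using le_exp_log_plus[of "norm (w k)"] Hw(2)[OF k] by (meson exp_le_cancel_iff norm_ge_zero order_trans)
    then have "norm (w k) / norm (blaschke_prod (C - {k}) a (a k)) \<le> exp (Hw (a k)) / exp (- H (a k))"
      by (intro frac_le sep k) auto
    then have "norm (w k) / norm (blaschke_prod (C - {k}) a (a k)) * exp (- Re (G (a k)))
        \<le> exp (Hw (a k)) / exp (- H (a k)) * exp (- Re (G (a k)))" by (intro mult_right_mono) auto
    then have "norm (\<beta> k) \<le> exp (Hw (a k)) / exp (- H (a k)) * exp (- Re (G (a k)))"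
      unfolding \<beta>_def norm_mult norm_divide by simp
    also have "\<dots> = exp (Hw (a k)) * exp (H (a k)) * exp (- (H (a k) + Hw (a k)))"
      using G(2)[OF disc[OF k]] by (simp add: exp_minus[of "H (a k)"] divide_inverse)
    also have "\<dots> = 1" by (simp flip: exp_add)
    finally show ?thesis .
  qed
  have nu: "norm (u k z) = (1 - (norm (a k))\<^sup>2) / norm (1 - cnj (a k) * z)" if "k \<in> C" for k z
    using disc[OF that] by (simp add: u_def norm_divide power_le_one del: of_real_diff of_real_power)
  have t_le: "norm (t k z) \<le> ((1 - (norm (a k))\<^sup>2) / norm (1 - cnj (a k) * z))\<^sup>2" if "k \<in> C" "z \<in> \<D>" for k z
  proof -
    have "norm (t k z) = (norm (\<beta> k) * norm (blaschke_prod (C - {k}) a z)) * (norm (u k z))\<^sup>2"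
      using that by (simp add: t_def norm_mult norm_power)
    also have "\<dots> \<le> 1 * (norm (u k z))\<^sup>2"
      using \<beta>[OF that(1)] norm_blaschke_prod_le_1[OF Cs that(2)] by (intro mult_right_mono mult_le_one) auto
    finally show ?thesis using nu[OF that(1)] by simp
  qed
  define c where "c k = (if k \<in> C then 1 - norm (a k) else 0) * 2" for k
  have c: "summable c" "\<And>k. 0 \<le> c k"
    using summable_mult2[OF blaschke_seq_summable[OF C(1)]] less_imp_le[OF disc[simplified]]
    by (auto simp: c_def[abs_def])
  have t_hol: "t k holomorphic_on \<D>" for k
  proof (cases "k \<in> C")
    case True
    have "u k holomorphic_on \<D>"
      unfolding u_def using disc_denom_nz(1)[OF disc[OF True]] by (auto intro!: holomorphic_intros)
    then have "(\<lambda>z. \<beta> k * blaschke_prod (C - {k}) a z * (u k z)\<^sup>2) holomorphic_on \<D>"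
      using blaschke_prod_holomorphic[OF Cs] by (intro holomorphic_intros)
    then show ?thesis using True by (simp add: t_def[abs_def])
  qed (simp add: t_def[abs_def])
  have t_b: "norm (t k z) \<le> c k / (1 - norm z) ^ 2" if z: "z \<in> \<D>" for k z
  proof (cases "k \<in> C")
    case True
    define q where "q = 1 - (norm (a k))\<^sup>2"
    have q: "0 \<le> q" "q \<le> 1" "q \<le> c k"
      using disc[OF True] one_minus_sq_le[OF disc[OF True]] True by (auto simp: q_def power_le_one c_def)
    have "norm (t k z) \<le> q\<^sup>2 / (norm (1 - cnj (a k) * z))\<^sup>2"
      using t_le[OF True z] by (simp add: q_def power_divide)
    also have "\<dots> \<le> c k / (1 - norm z)\<^sup>2"
    proof (intro frac_le power_mono norm_disc_denom_bounds disc True z)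
      have "q\<^sup>2 \<le> q" using q by (simp add: power2_eq_square mult_left_le)
      then show "q\<^sup>2 \<le> c k" using q by linarith
    qed (use z c in auto)
    finally show ?thesis .
  qed (simp add: t_def c_def)
  define f where "f z = exp (G z) * (\<Sum>k. t k z)" for z
  have "f holomorphic_on \<D>"
    unfolding f_def by (intro holomorphic_intros G disc_series(1)[OF t_hol c t_b])
  moreover have "log_plus (norm (f z)) \<le> (H z + Hw z) + S z" if z: "z \<in> \<D>" for z
  proof (rule log_plus_le)
    have sm: "summable (\<lambda>k. norm (t k z))" by (rule disc_series(2)[OF t_hol c t_b z])
    have "(\<Sum>k. norm (t k z)) \<le> S z"
    proof (rule suminf_le_const[OF sm])
      fix n
      have "(\<Sum>k<n. norm (t k z)) = (\<Sum>k\<in>{..<n} \<inter> C. norm (t k z))"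
        by (rule sum.mono_neutral_right) (auto simp: t_def)
      also have "\<dots> \<le> (\<Sum>k\<in>{..<n} \<inter> C. ((1 - (norm (a k))\<^sup>2) / norm (1 - cnj (a k) * z))\<^sup>2)"
        by (intro sum_mono t_le z) auto
      also have "\<dots> \<le> S z" using S z unfolding blaschke_majorant_def by (meson finite_Int finite_lessThan inf_le2)
      finally show "(\<Sum>k<n. norm (t k z)) \<le> S z" .
    qed
    then have "norm (\<Sum>k. t k z) \<le> S z" using summable_norm[OF sm] by linarith
    also have "\<dots> \<le> exp (S z)" using exp_ge_add_one_self[of "S z"] by linarith
    finally show "norm (f z) \<le> exp (H z + Hw z + S z)"
      using G(2)[OF z] by (simp add: f_def norm_mult exp_add mult_left_mono)
    show "0 \<le> H z + Hw z + S z" using Har_pos_pos[OF H z] Har_pos_pos[OF Hw(1) z] Har_pos_pos[OF S_pos z] by linarith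
  qed simp
  moreover have "harmonic_on (\<lambda>z. (H z + Hw z) + S z) \<D>"
    using Har_pos_add[OF Har_pos_add[OF H Hw(1)] S_pos] by (simp add: Har_pos_def)
  ultimately have "f \<in> nevanlinna_class" unfolding nevanlinna_class_def by blast
  moreover have "f (a j) = w j" if j: "j \<in> C" for j
  proof -
    have "t k (a j) = 0" if "k \<noteq> j" for k
    proof (cases "k \<in> C")
      case True
      then have "blaschke_prod (C - {k}) a (a j) = 0" using j that by (intro blaschke_prod_at_zero Cs) auto
      then show ?thesis by (simp add: t_def)
    qed (simp add: t_def)
    then have "(\<Sum>k. t k (a j)) = (\<Sum>k\<in>{j}. t k (a j))" by (intro suminf_finite) auto
    moreover have "u j (a j) = 1"
    proof -
      have "cnj (a j) * a j = of_real ((norm (a j))\<^sup>2)" using complex_norm_square[of "a j"] by (simp add: mult.commute)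
      then have "1 - cnj (a j) * a j = of_real (1 - (norm (a j))\<^sup>2)" by simp
      then show ?thesis using disc_denom_nz(1)[OF disc[OF j] disc[OF j]] unfolding u_def by simp
    qed
    moreover have "blaschke_prod (C - {j}) a (a j) \<noteq> 0" using sep[OF j] by (metis exp_gt_zero linorder_not_le norm_zero)
    ultimately show ?thesis using j by (simp add: f_def t_def \<beta>_def exp_minus)
  qed
  ultimately show "\<exists>f\<in>nevanlinna_class. \<forall>k\<in>C. f (a k) = w k" by blast
qed

text \<open>
  Interpolate the value \<open>1\<close> on \<open>M\<close> and \<open>0\<close> on the rest by \<open>f\<close>, and let \<open>Re G\<close> be the majorant of
  \<open>log_plus |f|\<close>. Then \<open>f * exp (- G)\<close> is bounded by \<open>1\<close> and vanishes off \<open>M\<close>, hence is dominated by the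
  Blaschke product of those zeros. Adding \<open>1\<close> to the majorant makes it strictly positive.
\<close>

lemma interpolating_zero_one:
  assumes K: "blaschke_seq K a" "nevanlinna_interpolating K a" and M: "M \<subseteq> K"
  shows "\<exists>H\<in>Har_pos. \<forall>k\<in>M. exp (- H (a k)) \<le> norm (blaschke_prod (K - M) a (a k))"
proof -
  define w where "w k = (if k \<in> M then 1 else 0 :: complex)" for k
  have "w \<in> nevanlinna_data K a"
    unfolding nevanlinna_data_def using Har_pos_const[of 1] by (auto simp: w_def log_plus_def intro!: bexI[of _ "\<lambda>_. 1"])
  then obtain f where f: "f \<in> nevanlinna_class" "\<And>k. k \<in> K \<Longrightarrow> f (a k) = w k"
    using K(2) unfolding nevanlinna_interpolating_def by blast
  have inj: "inj_on a K" using K(2) by (simp add: nevanlinna_interpolating_def)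
  obtain h where fh: "f holomorphic_on \<D>" "harmonic_on h \<D>" "\<And>z. z \<in> \<D> \<Longrightarrow> log_plus (norm (f z)) \<le> h z"
    using f(1) by (auto simp: nevanlinna_class_def)
  obtain G where G: "G holomorphic_on \<D>" "\<And>z. z \<in> \<D> \<Longrightarrow> Re (G z) = h z"
    using harmonic_on_obtain_Re[OF fh(2)] by blast
  have h0: "0 \<le> h z" if "z \<in> \<D>" for z using fh(3)[OF that] log_plus_nonneg order_trans by blast
  define F where "F z = f z * exp (- G z)" for z
  have F_hol: "F holomorphic_on \<D>" unfolding F_def by (intro holomorphic_intros fh G)
  have F_1: "norm (F z) \<le> 1" if z: "z \<in> \<D>" for z
  proof -
    have "norm (f z) \<le> exp (h z)"
      using le_exp_log_plus[of "norm (f z)"] fh(3)[OF z] by (meson exp_le_cancel_iff norm_ge_zero order_trans)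
    then have "norm (f z) * exp (- h z) \<le> exp (h z) * exp (- h z)" by (intro mult_right_mono) auto
    then show ?thesis using G(2)[OF z] by (simp add: F_def norm_mult flip: exp_add)
  qed
  have F_0: "F (a k) = 0" if "k \<in> K - M" for k using f(2) that by (simp add: F_def w_def)
  have le: "exp (- (h (a k) + 1)) \<le> norm (blaschke_prod (K - M) a (a k))" if k: "k \<in> M" for k
  proof -
    have ak: "a k \<in> \<D>" using blaschke_seq_disc[OF K(1)] M k by blast
    have "exp (- (h (a k) + 1)) \<le> exp (- h (a k))" by simp
    also have "\<dots> = norm (F (a k))" using f(2)[of k] k M G(2)[OF ak] by (auto simp: F_def w_def norm_mult)
    also have "\<dots> \<le> norm (blaschke_prod (K - M) a (a k))"
    proof (rule norm_le_blaschke_prod[OF F_hol F_1])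
      show "blaschke_seq (K - M) a" using K(1) by (rule blaschke_seq_subset) auto
      show "inj_on a (K - M)" using inj by (rule inj_on_subset) auto
    qed (use F_0 ak in auto)
    finally show ?thesis .
  qed
  have "(\<lambda>z. h z + 1) \<in> Har_pos" unfolding Har_pos_iff_Re
  proof (intro exI conjI ballI)
    show "(\<lambda>z. G z + 1) holomorphic_on \<D>" by (intro holomorphic_intros G)
    show "h z + 1 = Re (G z + 1)" if "z \<in> \<D>" for z using G(2)[OF that] by simp
    show "0 < Re (G z + 1)" if "z \<in> \<D>" for z using G(2)[OF that] h0[OF that] by simp
  qed
  with le show ?thesis by (intro bexI[of _ "\<lambda>z. h z + 1"]) auto
qed

section \<open>Separation of interpolating sequences\<close>

text \<open>
  The \<open>n\<close> with \<open>2 ^ (- n - 1) < 1 - |z| \<le> 2 ^ (- n)\<close>.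
\<close>

definition disc_level :: "complex \<Rightarrow> nat" where
  "disc_level z = (LEAST n. 1 < 2 ^ (n + 1) * (1 - norm z))"

lemma disc_level:
  assumes "z \<in> \<D>"
  shows "1 < 2 ^ (disc_level z + 1) * (1 - norm z)" "2 ^ disc_level z * (1 - norm z) \<le> 1"
proof -
  have d: "0 < 1 - norm z" using assms by simp
  obtain n where "1 / (1 - norm z) < 2 ^ n" using real_arch_pow[of 2 "1 / (1 - norm z)"] by auto
  then have "1 < 2 ^ n * (1 - norm z)" using d by (simp add: divide_less_eq)
  also have "\<dots> \<le> 2 ^ (n + 1) * (1 - norm z)" using d by (intro mult_right_mono power_increasing) auto
  finally show "1 < 2 ^ (disc_level z + 1) * (1 - norm z)" unfolding disc_level_def by (rule LeastI)
  show "2 ^ disc_level z * (1 - norm z) \<le> 1"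
  proof (cases "disc_level z")
    case (Suc m)
    then have "\<not> 1 < 2 ^ (m + 1) * (1 - norm z)" unfolding disc_level_def by (intro not_less_Least) simp
    then show ?thesis using Suc by simp
  qed simp
qed

text \<open>
  Each dyadic ring of the disc is cut along a square grid of side \<open>2 ^ (- n) / 8\<close>. This side is small
  enough for points of one cell to be at pseudohyperbolic distance at most \<open>1/2\<close>.
\<close>

definition disc_cell :: "complex \<Rightarrow> nat \<times> int \<times> int" where
  "disc_cell z = (disc_level z, \<lfloor>2 ^ disc_level z * 8 * Re z\<rfloor>, \<lfloor>2 ^ disc_level z * 8 * Im z\<rfloor>)"

text \<open>
  Distinct cells of equal colour lie in rings of levels that differ by at least \<open>2\<close>, or in one ring with
  some grid coordinate differing by at least \<open>10\<close>. Both keep them at distance at least \<open>1/3\<close>.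
\<close>

definition cell_colour :: "nat \<times> int \<times> int \<Rightarrow> nat \<times> int \<times> int" where
  "cell_colour = (\<lambda>(n, i, j). (n mod 2, i mod 10, j mod 10))"

lemma finite_cell_colours: "finite (range cell_colour)"
proof (rule finite_subset)
  show "range cell_colour \<subseteq> {..<2} \<times> {0..<10} \<times> {0..<10}" by (auto simp: cell_colour_def)
qed auto

lemma same_cell_near:
  assumes z: "z \<in> \<D>" and w: "w \<in> \<D>" and eq: "disc_cell z = disc_cell w"
  shows "pseudohyp z w \<le> 1/2"
proof (rule pseudohyp_le_euclid[OF z w])
  define m :: real where "m = 2 ^ disc_level z"
  have m: "m > 0" by (simp add: m_def)
  have lw: "disc_level w = disc_level z" and
    fl: "\<lfloor>m * 8 * Re z\<rfloor> = \<lfloor>m * 8 * Re w\<rfloor>" "\<lfloor>m * 8 * Im z\<rfloor> = \<lfloor>m * 8 * Im w\<rfloor>"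
    using eq by (auto simp: disc_cell_def m_def)
  have "\<bar>m * 8 * Re w - m * 8 * Re z\<bar> \<le> 1" "\<bar>m * 8 * Im w - m * 8 * Im z\<bar> \<le> 1" using fl by linarith+
  moreover have "\<bar>m * 8 * x - m * 8 * y\<bar> = m * 8 * \<bar>x - y\<bar>" for x y
    using m by (simp add: abs_mult flip: right_diff_distrib)
  ultimately have "m * 8 * (\<bar>Re (w - z)\<bar> + \<bar>Im (w - z)\<bar>) \<le> 2" by (simp add: distrib_left)
  moreover have "m * 8 * norm (w - z) \<le> m * 8 * (\<bar>Re (w - z)\<bar> + \<bar>Im (w - z)\<bar>)"
    using m by (intro mult_left_mono cmod_le) auto
  moreover have "1 < m * 2 * (1 - norm z)" using disc_level(1)[OF z] by (simp add: m_def mult.commute mult.left_commute)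
  ultimately have "m * 8 * norm (w - z) \<le> m * 8 * (1/2 * (1 - norm z))" by (simp add: algebra_simps)
  then show "norm (w - z) \<le> 1/2 * (1 - norm z)" using m by simp
qed

lemma level_gap_far:
  assumes z: "z \<in> \<D>" and w: "w \<in> \<D>" and gap: "disc_level z + 2 \<le> disc_level w"
  shows "1/3 \<le> pseudohyp w z"
proof -
  have "2 ^ (disc_level z + 2) * (1 - norm w) \<le> 2 ^ disc_level w * (1 - norm w)"
    using gap w by (intro mult_right_mono power_increasing) auto
  also have "\<dots> \<le> 1" using disc_level(2)[OF w] .
  also have "\<dots> \<le> 2 ^ (disc_level z + 1) * (1 - norm z)" using disc_level(1)[OF z] by simp
  finally have "2 ^ (disc_level z + 1) * (2 * (1 - norm w)) \<le> 2 ^ (disc_level z + 1) * (1 - norm z)"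
    by simp
  then have "2 * (1 - norm w) \<le> 1 - norm z" by (simp only: mult_le_cancel_left_pos zero_less_power zero_less_numeral)
  moreover have "norm w - norm z \<le> norm (w - z)" by (rule norm_triangle_ineq2)
  ultimately have "1 * (1 - norm w) \<le> norm (w - z)" by simp
  from pseudohyp_ge_euclid[OF w z _ this] show ?thesis by simp
qed

lemma same_colour_far:
  assumes z: "z \<in> \<D>" and w: "w \<in> \<D>"
    and col: "cell_colour (disc_cell z) = cell_colour (disc_cell w)" and ne: "disc_cell z \<noteq> disc_cell w"
  shows "1/3 \<le> pseudohyp z w"
proof (cases "disc_level z = disc_level w")
  case False
  have "disc_level z mod 2 = disc_level w mod 2" using col by (simp add: disc_cell_def cell_colour_def)
  then have "disc_level z + 2 \<le> disc_level w \<or> disc_level w + 2 \<le> disc_level z" using False by presburger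
  then show ?thesis using level_gap_far[OF z w] level_gap_far[OF w z] by (auto simp: pseudohyp_commute[of z w])
next
  case True
  define m :: real where "m = 2 ^ disc_level z"
  have m: "m > 0" by (simp add: m_def)
  have gap: "9 < \<bar>x - y\<bar>" if "\<lfloor>x\<rfloor> mod 10 = \<lfloor>y\<rfloor> mod 10" "\<lfloor>x\<rfloor> \<noteq> \<lfloor>y\<rfloor>" for x y :: real
  proof -
    have "10 \<le> \<bar>\<lfloor>x\<rfloor> - \<lfloor>y\<rfloor>\<bar>" using that by presburger
    then show ?thesis by linarith
  qed
  have "\<lfloor>m * 8 * Re z\<rfloor> mod 10 = \<lfloor>m * 8 * Re w\<rfloor> mod 10" "\<lfloor>m * 8 * Im z\<rfloor> mod 10 = \<lfloor>m * 8 * Im w\<rfloor> mod 10"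
    "\<lfloor>m * 8 * Re z\<rfloor> \<noteq> \<lfloor>m * 8 * Re w\<rfloor> \<or> \<lfloor>m * 8 * Im z\<rfloor> \<noteq> \<lfloor>m * 8 * Im w\<rfloor>"
    using col ne True by (auto simp: disc_cell_def cell_colour_def m_def)
  then have "9 < \<bar>m * 8 * Re z - m * 8 * Re w\<bar> \<or> 9 < \<bar>m * 8 * Im z - m * 8 * Im w\<bar>" using gap by blast
  moreover have "\<bar>m * 8 * x - m * 8 * y\<bar> = m * 8 * \<bar>x - y\<bar>" for x y
    using m by (simp add: abs_mult flip: right_diff_distrib)
  ultimately have "9 < m * 8 * \<bar>Re (z - w)\<bar> \<or> 9 < m * 8 * \<bar>Im (z - w)\<bar>" by simp
  moreover have "m * 8 * \<bar>Re (z - w)\<bar> \<le> m * 8 * norm (z - w)" "m * 8 * \<bar>Im (z - w)\<bar> \<le> m * 8 * norm (z - w)"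
    using m abs_Re_le_cmod[of "z - w"] abs_Im_le_cmod[of "z - w"] by (intro mult_left_mono; simp)+
  ultimately have "9 < m * 8 * norm (z - w)" by linarith
  moreover have "m * (1 - norm z) \<le> 1" using disc_level(2)[OF z] by (simp add: m_def)
  ultimately have "m * (1 - norm z) \<le> m * norm (z - w)" by linarith
  then have "1 * (1 - norm z) \<le> norm (z - w)" using m by simp
  from pseudohyp_ge_euclid[OF z w _ this] show ?thesis by simp
qed

text \<open>
  In each cell let \<open>m k\<close> be the zero at which the product over the other zeros is smallest; by Harnack's
  inequality it is enough to bound the product at these zeros. For one colour, let \<open>M\<close> be the set of
  the chosen zeros. The zeros outside \<open>M\<close> are handled by interpolating \<open>0\<close> and \<open>1\<close>, and those in \<open>M\<close> are
  far from each other. The finitely many colours lead to finitely many harmonic functions, which are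
  added up.
\<close>

theorem separated_if_nevanlinna_interpolating:
  assumes K: "blaschke_seq K a" and int: "nevanlinna_interpolating K a"
  shows "\<exists>H\<in>Har_pos. \<forall>k\<in>K. exp (- H (a k)) \<le> norm (blaschke_prod (K - {k}) a (a k))"
proof -
  obtain S where S: "blaschke_majorant K a S" using blaschke_majorant_exists[OF K] .
  note S_pos = blaschke_majorant_Har_pos[OF S]
  have disc: "a k \<in> \<D>" if "k \<in> K" for k using blaschke_seq_disc[OF K that] .
  define b where "b k = norm (blaschke_prod (K - {k}) a (a k))" for k
  define Q where "Q k = {j \<in> K. disc_cell (a j) = disc_cell (a k)}" for k
  have Q: "finite (Q k)" "k \<in> Q k" if "k \<in> K" for k
  proof -
    have "Q k \<subseteq> {j \<in> K. pseudohyp (a k) (a j) \<le> 1/2}"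
      using same_cell_near[OF disc[OF that] disc] by (auto simp: Q_def)
    then show "finite (Q k)" using finite_near_zeros[OF K disc[OF that], of "1/2"] finite_subset by auto
    show "k \<in> Q k" using that by (simp add: Q_def)
  qed
  define m where "m k = arg_min_on b (Q k)" for k
  have m: "m k \<in> K" "disc_cell (a (m k)) = disc_cell (a k)" "b (m k) \<le> b k" if "k \<in> K" for k
  proof -
    have "m k \<in> Q k" unfolding m_def using Q[OF that] by (intro arg_min_if_finite(1)) auto
    then show "m k \<in> K" "disc_cell (a (m k)) = disc_cell (a k)" by (auto simp: Q_def)
    show "b (m k) \<le> b k" unfolding m_def using Q[OF that] by (intro arg_min_least) auto
  qed
  have m_cong: "m k = m j" if "disc_cell (a k) = disc_cell (a j)" for k j
    using that by (simp add: m_def Q_def)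
  define M where "M c = m ` {k \<in> K. cell_colour (disc_cell (a k)) = c}" for c
  have MK: "M c \<subseteq> K" for c using m(1) by (auto simp: M_def)
  have M_far: "1/3 \<le> pseudohyp (a i) (a j)" if "i \<in> M c" "j \<in> M c" "i \<noteq> j" for i j c
  proof (rule same_colour_far)
    show "a i \<in> \<D>" "a j \<in> \<D>" using that MK disc by blast+
    obtain k l where kl: "i = m k" "k \<in> K" "cell_colour (disc_cell (a k)) = c"
       "j = m l" "l \<in> K" "cell_colour (disc_cell (a l)) = c"
      using \<open>i \<in> M c\<close> \<open>j \<in> M c\<close> by (auto simp: M_def)
    show "cell_colour (disc_cell (a i)) = cell_colour (disc_cell (a j))" using kl m(2) by simp
    show "disc_cell (a i) \<noteq> disc_cell (a j)" using that(3) kl m(2) m_cong by metis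
  qed
  have "\<forall>c. \<exists>H\<in>Har_pos. \<forall>k\<in>M c. exp (- H (a k)) \<le> norm (blaschke_prod (K - M c) a (a k))"
    using interpolating_zero_one[OF K int MK] by blast
  then obtain H where H: "\<And>c. H c \<in> Har_pos"
    "\<And>c k. k \<in> M c \<Longrightarrow> exp (- H c (a k)) \<le> norm (blaschke_prod (K - M c) a (a k))" by metis
  define H' where "H' z = 3 * ((\<Sum>c\<in>range cell_colour. H c z) + 5 * S z)" for z
  have sum_pos: "(\<lambda>z. \<Sum>c\<in>range cell_colour. H c z) \<in> Har_pos"
    by (rule Har_pos_sum[OF finite_cell_colours]) (use H in auto)
  have "(\<lambda>z. (\<Sum>c\<in>range cell_colour. H c z) + 5 * S z) \<in> Har_pos"
    by (intro Har_pos_add Har_pos_cmult sum_pos S_pos) simp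
  note base = this
  have "H' \<in> Har_pos" unfolding H'_def by (intro Har_pos_cmult base) simp
  moreover have "exp (- H' (a k)) \<le> b k" if k: "k \<in> K" for k
  proof -
    define c where "c = cell_colour (disc_cell (a k))"
    define i where "i = m k"
    have i: "i \<in> M c" "i \<in> K" using k m(1) by (auto simp: i_def M_def c_def)
    have near: "pseudohyp (a k) (a i) \<le> 1/2"
      using same_cell_near[OF disc[OF k] disc[OF i(2)]] m(2)[OF k] by (simp add: i_def)
    have "H c (a i) \<le> (\<Sum>c\<in>range cell_colour. H c (a i))"
      by (rule member_le_sum) (use H(1) Har_pos_pos[OF _ disc[OF i(2)]] finite_cell_colours in \<open>auto simp: c_def less_imp_le\<close>)
    then have "H c (a i) + 5 * S (a i) \<le> (\<Sum>c\<in>range cell_colour. H c (a i)) + 5 * S (a i)" by simp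
    also have "\<dots> \<le> H' (a k)"
      using Har_pos_Harnack[OF base disc[OF k] disc[OF i(2)] near] by (simp add: H'_def)
    finally have "exp (- H' (a k)) \<le> exp (- H c (a i)) * exp (- (5 * S (a i)))"
      by (simp flip: exp_add)
    also have "\<dots> \<le> norm (blaschke_prod (K - M c) a (a i)) * norm (blaschke_prod (M c - {i}) a (a i))"
    proof (intro mult_mono H(2) i)
      show "exp (- (5 * S (a i))) \<le> norm (blaschke_prod (M c - {i}) a (a i))"
      proof (rule blaschke_prod_far[OF K S disc[OF i(2)]])
        show "M c - {i} \<subseteq> K" using MK by blast
      qed (use M_far[OF i(1)] in auto)
    qed auto
    also have "\<dots> = b i"
    proof -
      have e: "K - {i} = (K - M c) \<union> (M c - {i})" using i MK by blast
      have "blaschke_prod (K - {i}) a (a i) = blaschke_prod (K - M c) a (a i) * blaschke_prod (M c - {i}) a (a i)"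
        unfolding e
      proof (rule blaschke_prod_Un)
        show "blaschke_seq (K - M c \<union> (M c - {i})) a"
          by (rule blaschke_seq_subset[OF K]) (use MK in blast)
      qed (use disc[OF i(2)] in auto)
      then show ?thesis by (simp add: b_def norm_mult)
    qed
    also have "\<dots> \<le> b k" using m(3)[OF k] by (simp add: i_def)
    finally show ?thesis .
  qed
  ultimately show ?thesis unfolding b_def by blast
qed

section \<open>Nearest zeros, auxiliary points and colourings\<close>

lemma pseudohyp_set_le: "w \<in> L \<Longrightarrow> pseudohyp_set z L \<le> pseudohyp z w"
  unfolding pseudohyp_set_def by (auto intro!: cINF_lower bdd_belowI2[of _ 0])

lemma pseudohyp_set_greatest: "r \<le> 1 \<Longrightarrow> (\<And>w. w \<in> L \<Longrightarrow> r \<le> pseudohyp z w) \<Longrightarrow> r \<le> pseudohyp_set z L"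
  unfolding pseudohyp_set_def by (auto intro!: cINF_greatest)

lemma pseudohyp_set_nonneg [simp]: "0 \<le> pseudohyp_set z L"
  by (rule pseudohyp_set_greatest) auto

lemma pseudohyp_set_le_1: "z \<in> \<D> \<Longrightarrow> L \<subseteq> \<D> \<Longrightarrow> pseudohyp_set z L \<le> 1"
proof (cases "L = {}")
  case False
  assume "z \<in> \<D>" "L \<subseteq> \<D>"
  moreover obtain w where "w \<in> L" using False by blast
  ultimately show ?thesis using pseudohyp_set_le[of w L z] pseudohyp_le_1[of z w] by fastforce
qed (simp add: pseudohyp_set_def)

lemma pseudohyp_set_antimono:
  "z \<in> \<D> \<Longrightarrow> L' \<subseteq> \<D> \<Longrightarrow> L \<subseteq> L' \<Longrightarrow> pseudohyp_set z L' \<le> pseudohyp_set z L"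
  by (rule pseudohyp_set_greatest) (auto intro: pseudohyp_set_le pseudohyp_set_le_1)

lemma pseudohyp_set_pos:
  assumes K: "blaschke_seq K a" and z: "z \<in> \<D>" "z \<notin> a ` K"
  shows "0 < pseudohyp_set z (a ` K)"
proof -
  define X where "X = {k \<in> K. pseudohyp z (a k) \<le> 1/2}"
  have X: "finite X" unfolding X_def by (rule finite_near_zeros[OF K z(1)]) simp
  define m where "m = Min (insert (1/2) ((\<lambda>k. pseudohyp z (a k)) ` X))"
  have "0 < pseudohyp z (a k)" if "k \<in> X" for k
  proof -
    have "pseudohyp z (a k) \<noteq> 0"
      using that z pseudohyp_eq_0_iff[OF z(1) blaschke_seq_disc[OF K]] by (auto simp: X_def)
    then show ?thesis using pseudohyp_nonneg[of z "a k"] by linarith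
  qed
  then have "0 < m" unfolding m_def using X by (subst Min_gr_iff) auto
  moreover have "m \<le> pseudohyp_set z (a ` K)"
  proof (rule pseudohyp_set_greatest)
    have m: "m \<le> 1/2" unfolding m_def using X by (intro Min_le) auto
    then show "m \<le> 1" by simp
    show "m \<le> pseudohyp z w" if wK: "w \<in> a ` K" for w
    proof -
      obtain k where k: "k \<in> K" "w = a k" using wK by auto
      show ?thesis
      proof (cases "k \<in> X")
        case True
        then show ?thesis unfolding m_def k using X by (intro Min_le) auto
      next
        case False
        then show ?thesis using k m by (auto simp: X_def)
      qed
    qed
  qed
  ultimately show ?thesis by linarith
qed

text \<open>
  Counting predecessors in the order by distance, then index, is strictly monotone along that order. Hence
  the indices with fewer than \<open>N\<close> predecessors form an initial segment with at most \<open>N\<close> elements, and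
  with exactly \<open>N\<close> if anything is left: a minimal remaining index has its predecessors in the segment.
\<close>

lemma nearest_indices:
  fixes N :: nat
  assumes K: "blaschke_seq K a" and z: "z \<in> \<D>"
  defines "M \<equiv> nearest_indices K a N z"
  shows "M \<subseteq> K" "finite M" "card M \<le> N" "K - M \<noteq> {} \<Longrightarrow> card M = N"
    "\<And>i j. i \<in> M \<Longrightarrow> j \<in> K - M \<Longrightarrow> pseudohyp z (a i) \<le> pseudohyp z (a j)"
proof -
  define P where "P i = {j \<in> K. pseudohyp z (a j) < pseudohyp z (a i) \<or>
       pseudohyp z (a j) = pseudohyp z (a i) \<and> j < i}" for i
  have M: "M = {i \<in> K. card (P i) < N}" by (simp add: M_def nearest_indices_def P_def)
  have fin: "finite (P i)" if "i \<in> K" for i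
    by (rule finite_subset[OF _ finite_near_zeros[OF K z pseudohyp_less_1[OF z blaschke_seq_disc[OF K that]]]])
       (auto simp: P_def)
  have mono: "card (P j) < card (P i)" if "j \<in> P i" "i \<in> K" for i j
    by (rule psubset_card_mono[OF fin]) (use that in \<open>auto simp: P_def\<close>)
  have total: "j \<in> P i \<or> i \<in> P j" if "i \<in> K" "j \<in> K" "i \<noteq> j" for i j
    using that by (auto simp: P_def)
  show MK: "M \<subseteq> K" by (auto simp: M)
  have "\<not> (\<exists>X\<subseteq>M. finite X \<and> card X = N + 1)"
  proof
    assume "\<exists>X\<subseteq>M. finite X \<and> card X = N + 1"
    then obtain X where X: "X \<subseteq> M" "finite X" "card X = N + 1" by blast
    then have "Max ((\<lambda>i. card (P i)) ` X) \<in> (\<lambda>i. card (P i)) ` X" by (intro Max_in) auto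
    then obtain i where i: "i \<in> X" "Max ((\<lambda>i. card (P i)) ` X) = card (P i)" by auto
    have "X - {i} \<subseteq> P i"
    proof
      fix j assume j: "j \<in> X - {i}"
      then have "card (P j) \<le> card (P i)" unfolding i(2)[symmetric] using X by (intro Max_ge) auto
      then show "j \<in> P i" using total[of i j] mono[of i j] j i X MK by force
    qed
    then have "card (X - {i}) \<le> card (P i)" using i X MK fin by (intro card_mono) auto
    then show False using i X by (auto simp: M)
  qed
  then show f: "finite M" and c: "card M \<le> N"
    using infinite_arbitrarily_large[of M "N + 1"] obtain_subset_with_card_n[of "N + 1" M]
    by (metis, metis Suc_eq_plus1 not_less_eq_eq)
  show "card M = N" if ne: "K - M \<noteq> {}"
  proof -
    obtain j where j: "j \<in> K - M" "\<And>i. i \<in> K - M \<Longrightarrow> card (P j) \<le> card (P i)"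
    proof -
      obtain i where "i \<in> K - M" using ne by blast
      from ex_has_least_nat[of "\<lambda>i. i \<in> K - M", OF this, of "\<lambda>i. card (P i)"] show thesis using that by blast
    qed
    have "P j \<subseteq> M"
    proof
      fix i assume i: "i \<in> P j"
      then have "card (P i) < card (P j)" using mono j by blast
      then show "i \<in> M" using j(2)[of i] i by (auto simp: P_def)
    qed
    then have "card (P j) \<le> card M" using f by (intro card_mono)
    moreover have "N \<le> card (P j)" using j(1) by (auto simp: M)
    ultimately show ?thesis using c by simp
  qed
  show "pseudohyp z (a i) \<le> pseudohyp z (a j)" if "i \<in> M" "j \<in> K - M" for i j
  proof (rule ccontr)
    assume "\<not> pseudohyp z (a i) \<le> pseudohyp z (a j)"
    then have "j \<in> P i" using that by (auto simp: P_def)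
    then have "card (P j) < card (P i)" using mono that MK by blast
    then show False using that by (auto simp: M)
  qed
qed

text \<open>
  Among \<open>N + 1\<close> equally spaced points on a segment starting at \<open>z\<close>, each of the at most \<open>N\<close> zeros is within
  half the spacing of at most one, so some point is far from all of them.
\<close>

lemma point_avoiding_zeros:
  assumes z: "z \<in> \<D>" and s: "0 < s" "s \<le> 1" and M: "finite M" "card M \<le> N" "a ` M \<subseteq> \<D>"
  obtains w where "w \<in> \<D>" "norm (w - z) \<le> s * (1 - norm z)"
    "\<And>i. i \<in> M \<Longrightarrow> s / (12 * (real N + 1)) \<le> pseudohyp w (a i)"
proof -
  define d where "d = 1 - norm z"
  have d: "d > 0" using z by (simp add: d_def)
  define h where "h = s * d / (real N + 1)"
  have h: "h > 0" using s d by (simp add: h_def)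
  define p where "p k = z + of_real (real k * h)" for k :: nat
  have "\<exists>k\<le>N. \<forall>i\<in>M. h / 2 \<le> norm (p k - a i)"
  proof (rule ccontr)
    assume "\<not> (\<exists>k\<le>N. \<forall>i\<in>M. h / 2 \<le> norm (p k - a i))"
    then have "\<forall>k\<in>{..N}. \<exists>i\<in>M. norm (p k - a i) < h / 2" by (meson atMost_iff not_le)
    then obtain f where f: "\<And>k. k \<le> N \<Longrightarrow> f k \<in> M" "\<And>k. k \<le> N \<Longrightarrow> norm (p k - a (f k)) < h / 2"
      by (metis atMost_iff)
    have "inj_on f {..N}"
    proof (rule inj_onI)
      fix k l assume kl: "k \<in> {..N}" "l \<in> {..N}" "f k = f l"
      have "norm (p k - p l) \<le> norm (p k - a (f k)) + norm (p l - a (f k))"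
        using norm_triangle_ineq4[of "p k - a (f k)" "p l - a (f k)"] by simp
      also have "\<dots> < h" using f(2)[of k] f(2)[of l] kl by simp
      finally have "norm (p k - p l) < h" .
      moreover have "p k - p l = of_real ((real k - real l) * h)" by (simp add: p_def algebra_simps)
      ultimately have "\<bar>real k - real l\<bar> * h < 1 * h" using h by (simp add: norm_mult abs_mult del: of_real_mult of_real_diff)
      then have "\<bar>real k - real l\<bar> < 1" using h mult_less_cancel_right_pos by blast
      then show "k = l" by linarith
    qed
    then have "card {..N} \<le> card M" using f(1) M(1) by (intro card_inj_on_le[of f]) auto
    then show False using M(2) by simp
  qed
  then obtain k where k: "k \<le> N" "\<And>i. i \<in> M \<Longrightarrow> h / 2 \<le> norm (p k - a i)" by blast
  have "real k * h \<le> real N * h" using k h by simp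
  also have "\<dots> < (real N + 1) * h" using h by (simp add: distrib_right)
  also have "\<dots> = s * d" by (simp add: h_def)
  finally have lt: "norm (p k - z) < s * d" using h by (simp add: p_def norm_mult)
  also have "s * d \<le> 1 * d" using s d by (intro mult_right_mono) auto
  finally have "norm (p k - z) < d" by simp
  then have pD: "p k \<in> \<D>" and n1: "1 - norm (p k) \<le> 2 * d"
    using norm_triangle_ineq2[of "p k" z] norm_triangle_ineq3[of "p k" z] by (auto simp: d_def)
  show ?thesis
  proof
    show "p k \<in> \<D>" "norm (p k - z) \<le> s * (1 - norm z)" using pD lt by (auto simp: d_def)
    fix i assume i: "i \<in> M"
    \<comment> \<open>Half the spacing, measured in units of \<open>2 (1 - |z|) \<ge> 1 - |p k|\<close>; then \<open>t / (t + 2) \<ge> t / 3\<close>.\<close>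
    define t where "t = s / (4 * (real N + 1))"
    have t: "0 < t" "t \<le> 1" using s by (auto simp: t_def divide_le_eq)
    have "t * (1 - norm (p k)) \<le> t * (2 * d)" using n1 t by (intro mult_left_mono) auto
    also have "\<dots> = h / 2" by (simp add: t_def h_def field_simps)
    also have "\<dots> \<le> norm (p k - a i)" using k(2)[OF i] .
    finally have "t / (t + 2) \<le> pseudohyp (p k) (a i)"
      using t i M(3) by (intro pseudohyp_ge_euclid[OF pD]) auto
    moreover have "t / 3 \<le> t / (t + 2)" using t by (intro divide_left_mono) auto
    ultimately show "s / (12 * (real N + 1)) \<le> pseudohyp (p k) (a i)" by (simp add: t_def)
  qed
qed

text \<open>
  Cauchy's inequalities on the circle of radius \<open>(1 - |z|) / 2\<close> bound the \<open>n\<close>-th Taylor term at \<open>w\<close> by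
  \<open>(2 s) ^ n\<close>; the terms beyond \<open>N\<close> form a geometric tail with ratio at most \<open>1/2\<close>.
\<close>

lemma taylor_bound:
  fixes f :: "complex \<Rightarrow> complex"
  assumes f: "f holomorphic_on \<D>" "\<And>z. z \<in> \<D> \<Longrightarrow> norm (f z) \<le> 1" and z: "z \<in> \<D>"
    and s: "0 \<le> s" "s \<le> 1/4" and w: "norm (w - z) \<le> s * (1 - norm z)"
  shows "norm (f w) \<le> (\<Sum>j=0..N. (1 - norm z) ^ j * norm ((deriv ^^ j) f z)) + 2 * (2 * s) ^ (N + 1)"
proof -
  define d where "d = 1 - norm z"
  have d: "d > 0" using z by (simp add: d_def)
  have sub: "ball z d \<subseteq> \<D>"
  proof
    fix x assume "x \<in> ball z d"
    then show "x \<in> \<D>" using norm_triangle_ineq2[of x z] by (simp add: d_def dist_norm norm_minus_commute)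
  qed
  have sub2: "cball z (d/2) \<subseteq> ball z d" using d by auto
  have wd: "norm (w - z) \<le> s * d" using w by (simp add: d_def)
  also have "s * d < 1 * d" using s d by (intro mult_strict_right_mono) auto
  finally have "w \<in> ball z d" by (simp add: dist_norm norm_minus_commute)
  define t where "t n = (deriv ^^ n) f z / fact n * (w - z) ^ n" for n
  have sums: "t sums f w" unfolding t_def
    by (rule holomorphic_power_series[OF holomorphic_on_subset[OF f(1) sub]]) fact
  have tn: "norm (t n) = norm ((deriv ^^ n) f z) / fact n * norm (w - z) ^ n" for n
    by (simp add: t_def norm_mult norm_divide norm_power)
  have cauchy: "norm ((deriv ^^ n) f z) \<le> fact n * 1 / (d/2) ^ n" for n
  proof (rule Cauchy_inequality)
    show "f holomorphic_on ball z (d/2)"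
      using f(1) by (rule holomorphic_on_subset) (use sub sub2 ball_subset_cball in blast)
    show "continuous_on (cball z (d/2)) f"
      using holomorphic_on_imp_continuous_on[OF f(1)] by (rule continuous_on_subset) (use sub sub2 in blast)
    show "norm (f x) \<le> 1" if "norm (z - x) = d/2" for x
    proof -
      have "x \<in> cball z (d/2)" using that by (simp add: dist_norm)
      then show ?thesis using f(2) sub sub2 by blast
    qed
  qed (use d in auto)
  have t1: "norm (t n) \<le> (2 * s) ^ n" for n
  proof -
    have "norm (t n) \<le> (fact n * 1 / (d/2) ^ n) / fact n * (s * d) ^ n" unfolding tn
      using cauchy[of n] wd by (intro mult_mono divide_right_mono power_mono) (use d in auto)
    also have "\<dots> = (2 * s) ^ n" using d by (simp add: power_mult_distrib power_divide)
    finally show ?thesis .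
  qed
  have t2: "norm (t n) \<le> d ^ n * norm ((deriv ^^ n) f z)" for n
  proof -
    have "norm (t n) \<le> norm ((deriv ^^ n) f z) / 1 * d ^ n" unfolding tn
    proof (intro mult_mono divide_left_mono power_mono)
      show "norm (w - z) \<le> d" using \<open>w \<in> ball z d\<close> by (simp add: dist_norm norm_minus_commute)
    qed (auto simp: fact_ge_1)
    then show ?thesis by (simp add: mult.commute)
  qed
  have g: "summable (\<lambda>n. (2 * s) ^ n)" using s by (intro summable_geometric) auto
  have sn: "summable (\<lambda>n. norm (t n))"
    by (rule summable_comparison_test[OF _ g]) (use t1 in auto)
  have "norm (f w) \<le> (\<Sum>n. norm (t n))" using summable_norm[OF sn] sums sums_unique by metis
  also have "\<dots> = (\<Sum>n. norm (t (n + (N + 1)))) + (\<Sum>n<N + 1. norm (t n))"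
    by (rule suminf_split_initial_segment[OF sn])
  also have "(\<Sum>n. norm (t (n + (N + 1)))) \<le> (\<Sum>n. (2 * s) ^ (N + 1) * (2 * s) ^ n)"
  proof (rule suminf_le)
    show "norm (t (n + (N + 1))) \<le> (2 * s) ^ (N + 1) * (2 * s) ^ n" for n
      using t1[of "n + (N + 1)"] by (simp add: power_add mult_ac)
    show "summable (\<lambda>n. norm (t (n + (N + 1))))" using sn by (rule summable_ignore_initial_segment)
    show "summable (\<lambda>n. (2 * s) ^ (N + 1) * (2 * s) ^ n)" using g by (rule summable_mult)
  qed
  also have "\<dots> = (2 * s) ^ (N + 1) * (1 / (1 - 2 * s))"
    using s by (subst suminf_mult[OF g]) (simp add: suminf_geometric)
  also have "\<dots> \<le> (2 * s) ^ (N + 1) * 2" using s by (intro mult_left_mono) (auto simp: divide_le_eq)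
  also have "(\<Sum>n<N + 1. norm (t n)) \<le> (\<Sum>n<N + 1. d ^ n * norm ((deriv ^^ n) f z))"
    by (intro sum_mono t2)
  also have "{..<N + 1} = {0..N}" by auto
  finally show ?thesis by (simp add: d_def)
qed

text \<open>
  Every vertex takes a colour not used by its fewer than \<open>N\<close> earlier neighbours.
\<close>

lemma greedy_colouring:
  fixes R :: "nat \<Rightarrow> nat set"
  assumes "\<And>i. finite (R i)" "\<And>i. card (R i) < N"
  shows "\<exists>col. \<forall>i. col i < N \<and> (\<forall>j\<in>R i. j < i \<longrightarrow> col j \<noteq> col i)"
proof (rule dependent_wf_choice[OF wf_less_than, where P = "\<lambda>col i c. c < N \<and> (\<forall>j\<in>R i. j < i \<longrightarrow> col j \<noteq> c)"])
  show "\<exists>c. c < N \<and> (\<forall>j\<in>R i. j < i \<longrightarrow> col j \<noteq> c)" for i and col :: "nat \<Rightarrow> nat"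
  proof -
    have "card (col ` R i) < card {..<N}"
      using card_image_le[OF assms(1), of col i] assms(2)[of i] by simp
    then have "\<not> {..<N} \<subseteq> col ` R i" using assms(1) by (meson card_mono finite_imageI not_le)
    then show ?thesis by auto
  qed
qed auto

section \<open>The lower bound and the deleted product\<close>

text \<open>
  If \<open>a k\<close> is the zero nearest to \<open>z\<close>, then \<open>\<rho>(a k, a j) \<le> \<rho>(z, a k) + \<rho>(z, a j) \<le> 2 \<rho>(z, a j)\<close> for the other
  zeros, so the product over them can be compared with its value at \<open>a k\<close>, which is bounded below by
  assumption. Without a zero at distance at most \<open>1/3\<close> all zeros are far.
\<close>

lemma one_zero_lower_bound:
  assumes K: "blaschke_seq K a" and H: "H \<in> Har_pos"
    and sep: "\<And>k. k \<in> K \<Longrightarrow> exp (- H (a k)) \<le> norm (blaschke_prod (K - {k}) a (a k))"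
  shows "\<exists>H1\<in>Har_pos. \<forall>z\<in>\<D>. exp (- H1 z) * pseudohyp_set z (a ` K) \<le> norm (blaschke_prod K a z)"
proof -
  obtain S where S: "blaschke_majorant K a S" using blaschke_majorant_exists[OF K] .
  note S_pos = blaschke_majorant_Har_pos[OF S]
  have disc: "a k \<in> \<D>" if "k \<in> K" for k using blaschke_seq_disc[OF K that] .
  then have LD: "a ` K \<subseteq> \<D>" by blast
  define H1 where "H1 z = 3 * H z + 5 * S z" for z
  have "H1 \<in> Har_pos" unfolding H1_def by (intro Har_pos_add Har_pos_cmult H S_pos) auto
  moreover have "exp (- H1 z) * pseudohyp_set z (a ` K) \<le> norm (blaschke_prod K a z)" if z: "z \<in> \<D>" for z
  proof -
    define X where "X = {k \<in> K. pseudohyp z (a k) \<le> 1/3}"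
    have X: "finite X" unfolding X_def by (rule finite_near_zeros[OF K z]) simp
    show ?thesis
    proof (cases "X = {}")
      case True
      have "exp (- H1 z) * pseudohyp_set z (a ` K) \<le> exp (- (5 * S z)) * 1"
        using Har_pos_pos[OF H z] by (intro mult_mono pseudohyp_set_le_1 z LD) (auto simp: H1_def)
      also have "\<dots> \<le> norm (blaschke_prod K a z)"
        using blaschke_prod_far[OF K S z, of K] True by (force simp: X_def)
      finally show ?thesis .
    next
      case False
      define k where "k = arg_min_on (\<lambda>k. pseudohyp z (a k)) X"
      have "k \<in> X" unfolding k_def using X False by (rule arg_min_if_finite(1))
      then have k: "k \<in> K" "pseudohyp z (a k) \<le> 1/3" by (auto simp: X_def)
      have le: "pseudohyp z (a k) \<le> pseudohyp z (a j)" if "j \<in> K" for j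
      proof (cases "j \<in> X")
        case True
        then show ?thesis unfolding k_def using X by (intro arg_min_least) auto
      next
        case False
        then show ?thesis using that k(2) by (auto simp: X_def)
      qed
      have "exp (- (3 * H z)) \<le> exp (- H (a k))"
        using Har_pos_Harnack[OF H z disc[OF k(1)]] k(2) by simp
      also have "\<dots> \<le> norm (blaschke_prod (K - {k}) a (a k))" by (rule sep[OF k(1)])
      also have "\<dots> \<le> exp (5 * S z) * norm (blaschke_prod (K - {k}) a z)"
      proof (rule blaschke_prod_compare[OF K S z disc[OF k(1)]])
        fix j assume j: "j \<in> K - {k}"
        have "pseudohyp (a k) (a j) \<le> pseudohyp z (a k) + pseudohyp z (a j)"
          using pseudohyp_triangle[of "a k" "a j" z] disc j k z by (simp add: pseudohyp_commute[of z "a k"])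
        moreover have "pseudohyp z (a k) \<le> pseudohyp z (a j)" using le j by blast
        ultimately show "pseudohyp (a k) (a j) \<le> 3 * pseudohyp z (a j)"
          using pseudohyp_nonneg[of z "a j"] by linarith
      qed auto
      finally have 1: "exp (- H1 z) \<le> norm (blaschke_prod (K - {k}) a z)"
        by (simp add: H1_def exp_diff exp_minus divide_simps mult_ac)
      have "exp (- H1 z) * pseudohyp_set z (a ` K) \<le> norm (blaschke_prod (K - {k}) a z) * pseudohyp z (a k)"
        using k by (intro mult_mono 1 pseudohyp_set_le) auto
      also have "\<dots> = norm (blaschke_prod K a z)"
        using blaschke_prod_split[OF K, of "{k}" z] k z by (simp add: norm_mult norm_blaschke_prod_finite mult.commute)
      finally show ?thesis .
    qed
  qed
  ultimately show ?thesis by blast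
qed

text \<open>
  The deleted factors are at most \<open>N\<close> distances, each at least the distance to the whole zero set; if
  fewer than \<open>N\<close> are deleted, the missing powers of that distance are at most \<open>1\<close>.
\<close>

lemma deleted_imp_lower_bound:
  assumes K: "blaschke_seq K a" and z: "z \<in> \<D>" and q: "q \<le> norm_blaschke_del K a N z" "0 \<le> q"
  shows "q * pseudohyp_set z (a ` K) ^ N \<le> norm (blaschke_prod K a z)"
proof -
  define M where "M = nearest_indices K a N z"
  note M = nearest_indices[OF K z, where N = N, folded M_def]
  define p where "p = pseudohyp_set z (a ` K)"
  have "a ` K \<subseteq> \<D>" using blaschke_seq_disc[OF K] by blast
  then have p: "0 \<le> p" "p \<le> 1" using pseudohyp_set_le_1[OF z] by (auto simp: p_def)
  have "p ^ N \<le> p ^ card M" using M(3) p by (rule power_decreasing)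
  also have "\<dots> = (\<Prod>i\<in>M. p)" by simp
  also have "\<dots> \<le> (\<Prod>i\<in>M. pseudohyp z (a i))"
    using p M(1) by (intro prod_mono) (auto simp: p_def intro!: pseudohyp_set_le)
  also have "\<dots> = norm (blaschke_prod M a z)" using M(2) by (simp add: norm_blaschke_prod_finite)
  finally have "p ^ N * q \<le> norm (blaschke_prod M a z) * norm (blaschke_prod (K - M) a z)"
    using q p by (intro mult_mono) (auto simp: norm_blaschke_del_def M_def)
  also have "\<dots> = norm (blaschke_prod K a z)"
    unfolding blaschke_prod_split[OF K M(1) z] by (simp add: norm_mult)
  finally show ?thesis by (simp add: p_def mult.commute)
qed

lemma norm_blaschke_prod_power_le:
  assumes K: "blaschke_seq K a" and w: "w \<in> \<D>" and M: "M \<subseteq> K" "finite M"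
    and b: "\<And>i. i \<in> M \<Longrightarrow> pseudohyp w (a i) \<le> b"
  shows "norm (blaschke_prod K a w) \<le> b ^ card M * norm (blaschke_prod (K - M) a w)"
proof -
  have "norm (blaschke_prod M a w) \<le> (\<Prod>i\<in>M. b)"
    unfolding norm_blaschke_prod_finite[OF M(2)] by (intro prod_mono) (use b in auto)
  then show ?thesis unfolding blaschke_prod_split[OF K M(1) w] by (simp add: norm_mult mult_right_mono)
qed

text \<open>
  Near a zero \<open>z\<close> of multiplicity at least \<open>N + 1\<close>, the product is at most \<open>t ^ (N + 1)\<close> with
  \<open>t = \<rho>(z, w)\<close>, while the lower bound is a constant times \<open>t ^ N\<close>.
\<close>

lemma multiplicity_le:
  assumes K: "blaschke_seq K a" and H: "H \<in> Har_pos"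
    and lb: "\<And>z. z \<in> \<D> \<Longrightarrow> exp (- H z) * pseudohyp_set z (a ` K) ^ N \<le> norm (blaschke_prod K a z)"
    and z: "z \<in> \<D>" and E: "E \<subseteq> K" "finite E" "\<And>i. i \<in> E \<Longrightarrow> a i = z"
  shows "card E \<le> N"
proof (rule ccontr)
  assume "\<not> card E \<le> N"
  then have cE: "Suc N \<le> card E" by simp
  define J where "J = {k \<in> K. a k \<noteq> z}"
  have "blaschke_seq J a" using K by (rule blaschke_seq_subset) (auto simp: J_def)
  then have r: "0 < pseudohyp_set z (a ` J)" using z by (rule pseudohyp_set_pos) (auto simp: J_def)
  \<comment> \<open>Near enough to \<open>z\<close> that \<open>z\<close> is the nearest zero, that Harnack's inequality applies, and that the two bounds conflict.\<close>
  define e where "e = min (pseudohyp_set z (a ` J) / 2) (min (1/2) (exp (- (3 * H z)) / 2))"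
  have e: "0 < e" "e \<le> 1/2" "2 * e \<le> pseudohyp_set z (a ` J)" "e < exp (- (3 * H z))"
    using r by (auto simp: e_def min_less_iff_disj)
  define w where "w = z + of_real (e * (1 - norm z))"
  have nw: "norm (w - z) = e * (1 - norm z)" using e z by (simp add: w_def norm_mult del: of_real_mult of_real_diff)
  have "norm w \<le> norm z + norm (w - z)" by (metis add.commute diff_add_cancel norm_triangle_ineq)
  also have "\<dots> \<le> norm z + 1/2 * (1 - norm z)" unfolding nw using e z by (intro add_left_mono mult_right_mono) auto
  also have "\<dots> < 1" using z by (simp add: field_simps)
  finally have w: "w \<in> \<D>" by simp
  define t where "t = pseudohyp z w"
  have t: "t \<le> e" unfolding t_def by (rule pseudohyp_le_euclid[OF z w]) (simp add: nw)
  have "w \<noteq> z" using nw e z by auto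
  then have t0: "0 < t" using pseudohyp_eq_0_iff[OF z w] pseudohyp_nonneg[of z w] by (auto simp: t_def less_le)
  have tset: "t \<le> pseudohyp_set w (a ` K)"
  proof (rule pseudohyp_set_greatest)
    show "t \<le> 1" using t e by simp
    fix v assume "v \<in> a ` K"
    then obtain k where k: "k \<in> K" "v = a k" by auto
    show "t \<le> pseudohyp w v"
    proof (cases "a k = z")
      case True
      then show ?thesis using k by (simp add: t_def pseudohyp_commute)
    next
      case False
      then have "2 * e \<le> pseudohyp z v" using e(3) pseudohyp_set_le[of v "a ` J" z] k by (auto simp: J_def)
      also have "\<dots> \<le> t + pseudohyp w v"
        using pseudohyp_triangle[OF z _ w, of v] blaschke_seq_disc[OF K k(1)] k(2) by (simp add: t_def)
      finally show ?thesis using t by simp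
    qed
  qed
  have "exp (- (3 * H z)) * t ^ N \<le> exp (- H w) * pseudohyp_set w (a ` K) ^ N"
    using Har_pos_Harnack[OF H z w] t e t0 tset by (intro mult_mono power_mono) (auto simp: t_def)
  also have "\<dots> \<le> norm (blaschke_prod K a w)" by (rule lb[OF w])
  also have "\<dots> \<le> t ^ card E * norm (blaschke_prod (K - E) a w)"
    by (rule norm_blaschke_prod_power_le[OF K w E(1,2)]) (simp add: E(3) t_def pseudohyp_commute)
  also have "\<dots> \<le> t ^ card E * 1"
    using norm_blaschke_prod_le_1[OF blaschke_seq_subset[OF K] w, of "K - E"] t0 by (intro mult_left_mono) auto
  also have "\<dots> \<le> t ^ Suc N * 1" using cE t e t0 by (intro mult_right_mono power_decreasing) auto
  finally have "exp (- (3 * H z)) \<le> t" using t0 by simp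
  then show False using t e by simp
qed

text \<open>
  Let \<open>r\<close> be the distance from \<open>z\<close> to the remaining zeros; it is positive, as \<open>z\<close> has multiplicity at most
  \<open>N\<close>. At a point \<open>w\<close> with \<open>\<rho>(z, w) \<le> r / 2\<close> that avoids all zeros at the scale of \<open>r\<close>, the lower bound is a
  constant times \<open>r ^ N\<close>, and the deleted factors are at most \<open>(2 r) ^ N\<close>. So the remaining product is
  bounded below at \<open>w\<close>, and by comparison at \<open>z\<close>.
\<close>

lemma lower_bound_imp_deleted:
  assumes K: "blaschke_seq K a" and H: "H \<in> Har_pos"
    and lb: "\<And>z. z \<in> \<D> \<Longrightarrow> exp (- H z) * pseudohyp_set z (a ` K) ^ N \<le> norm (blaschke_prod K a z)"
  shows "\<exists>H2\<in>Har_pos. \<forall>z\<in>\<D>. exp (- H2 z) \<le> norm_blaschke_del K a N z"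
proof -
  obtain S where S: "blaschke_majorant K a S" using blaschke_majorant_exists[OF K] .
  note S_pos = blaschke_majorant_Har_pos[OF S]
  have disc: "a k \<in> \<D>" if "k \<in> K" for k using blaschke_seq_disc[OF K that] .
  \<comment> \<open>Later \<open>p\<close> is the lower bound \<open>(r / 2) / (12 (N + 1))\<close> for distances from \<open>w\<close>, and \<open>C = 2 r / p\<close>.\<close>
  define C where "C = 48 * (real N + 1)"
  have C: "C > 1" by (simp add: C_def)
  define H2 where "H2 z = (3 * H z + 5 * S z) + (real N + 1) * ln C" for z
  have "H2 \<in> Har_pos" unfolding H2_def
    using C by (intro Har_pos_add_const Har_pos_add Har_pos_cmult H S_pos) (auto intro!: mult_pos_pos)
  moreover have "exp (- H2 z) \<le> norm_blaschke_del K a N z" if z: "z \<in> \<D>" for z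
  proof -
    define M where "M = nearest_indices K a N z"
    note M = nearest_indices[OF K z, where N = N, folded M_def]
    define J where "J = K - M"
    have JK: "J \<subseteq> K" by (auto simp: J_def)
    have bJ: "blaschke_seq J a" using K JK by (rule blaschke_seq_subset)
    have del: "norm_blaschke_del K a N z = norm (blaschke_prod J a z)"
      by (simp add: norm_blaschke_del_def M_def J_def)
    show ?thesis
    proof (cases "J = {}")
      case True
      have "0 < H2 z" using \<open>H2 \<in> Har_pos\<close> z by (rule Har_pos_pos)
      then show ?thesis using True by (simp add: del)
    next
      case False
      then have cM: "card M = N" using M(4) by (simp add: J_def)
      define r where "r = pseudohyp_set z (a ` J)"
      have zJ: "z \<notin> a ` J"
      proof
        assume "z \<in> a ` J"
        then obtain j where j: "j \<in> J" "a j = z" by auto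
        have "a i = z" if "i \<in> M" for i
        proof -
          have "pseudohyp z (a i) \<le> pseudohyp z (a j)" using M(5)[OF that, of j] j by (simp add: J_def)
          then have "pseudohyp z (a i) = 0" using j pseudohyp_nonneg[of z "a i"] by simp
          then show ?thesis using pseudohyp_eq_0_iff[OF z disc] that M(1) by blast
        qed
        then have "card (insert j M) \<le> N"
          using j M JK by (intro multiplicity_le[OF K H lb z]) auto
        then show False using cM M(2) j by (simp add: J_def)
      qed
      have aJ: "a ` J \<subseteq> \<D>" using disc JK by blast
      have r: "0 < r" "r \<le> 1" unfolding r_def
        using pseudohyp_set_pos[OF bJ z zJ] pseudohyp_set_le_1[OF z aJ] by auto
      have rJ: "r \<le> pseudohyp z (a j)" if "j \<in> J" for j
        unfolding r_def using that by (intro pseudohyp_set_le) auto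
      have rM: "pseudohyp z (a i) \<le> r" if "i \<in> M" for i unfolding r_def
        by (rule pseudohyp_set_greatest) (use M(1,5) that z disc[THEN pseudohyp_le_1[OF z]] in \<open>auto simp: J_def\<close>)
      obtain w where w: "w \<in> \<D>" "norm (w - z) \<le> r / 2 * (1 - norm z)"
        "\<And>i. i \<in> M \<Longrightarrow> (r / 2) / (12 * (real N + 1)) \<le> pseudohyp w (a i)"
      proof -
        have "0 < r / 2" "r / 2 \<le> 1" "a ` M \<subseteq> \<D>" using r M(1) disc by auto
        from point_avoiding_zeros[OF z this(1,2) M(2,3) this(3)] that show thesis by blast
      qed
      have zw: "pseudohyp z w \<le> r / 2" by (rule pseudohyp_le_euclid[OF z w(1,2)])
      define p where "p = (r / 2) / (12 * (real N + 1))"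
      have p0: "0 < p" using r by (simp add: p_def)
      have p1: "p \<le> r / 2" using r by (simp add: p_def divide_le_eq mult_ge1_I)
      have "p \<le> pseudohyp_set w (a ` K)"
      proof (rule pseudohyp_set_greatest)
        show "p \<le> 1" using p1 r by simp
        fix v assume "v \<in> a ` K"
        then obtain k where k: "k \<in> K" "v = a k" by auto
        show "p \<le> pseudohyp w v"
        proof (cases "k \<in> M")
          case True
          then show ?thesis using w(3) k by (simp add: p_def)
        next
          case False
          then have "r \<le> pseudohyp z v" using rJ k by (simp add: J_def)
          also have "\<dots> \<le> pseudohyp z w + pseudohyp w v" using pseudohyp_triangle[OF z _ w(1)] disc k by simp
          finally show ?thesis using zw p1 by simp
        qed
      qed
      then have "exp (- (3 * H z)) * p ^ N \<le> exp (- H w) * pseudohyp_set w (a ` K) ^ N"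
        using Har_pos_Harnack[OF H z w(1)] zw r p0 by (intro mult_mono power_mono) auto
      also have "\<dots> \<le> norm (blaschke_prod K a w)" by (rule lb[OF w(1)])
      also have "\<dots> \<le> (2 * r) ^ card M * norm (blaschke_prod J a w)"
        unfolding J_def
      proof (rule norm_blaschke_prod_power_le[OF K w(1) M(1,2)])
        fix i assume i: "i \<in> M"
        have "pseudohyp w (a i) \<le> pseudohyp z w + pseudohyp z (a i)"
          using pseudohyp_triangle[OF w(1) _ z, of "a i"] disc i M(1) by (auto simp: pseudohyp_commute[of w z])
        then show "pseudohyp w (a i) \<le> 2 * r" using rM[OF i] zw r by simp
      qed
      also have "norm (blaschke_prod J a w) \<le> exp (5 * S z) * norm (blaschke_prod J a z)"
      proof (rule blaschke_prod_compare[OF K S z w(1) JK])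
        fix j assume j: "j \<in> J"
        have "pseudohyp w (a j) \<le> pseudohyp z w + pseudohyp z (a j)"
          using pseudohyp_triangle[OF w(1) _ z, of "a j"] disc j JK by (auto simp: pseudohyp_commute[of w z])
        then show "pseudohyp w (a j) \<le> 3 * pseudohyp z (a j)" using rJ[OF j] zw r by simp
      qed
      finally have "exp (- (3 * H z)) * p ^ N \<le> (2 * r) ^ N * (exp (5 * S z) * norm (blaschke_prod J a z))"
        using r by (simp add: cM mult_left_mono)
      moreover have "2 * r = C * p" by (simp add: C_def p_def field_simps)
      then have "(2 * r) ^ N = C ^ N * p ^ N" by (simp only: power_mult_distrib)
      ultimately have "exp (- (3 * H z)) * p ^ N \<le> C ^ N * (exp (5 * S z) * norm (blaschke_prod J a z)) * p ^ N"
        by (simp only: mult_ac)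
      then have "exp (- (3 * H z)) \<le> C ^ N * (exp (5 * S z) * norm (blaschke_prod J a z))"
        using p0 by (simp only: mult_le_cancel_right_pos zero_less_power)
      also have "\<dots> \<le> C ^ (N + 1) * (exp (5 * S z) * norm (blaschke_prod J a z))"
        using C by (intro mult_right_mono power_increasing) auto
      also have "C ^ (N + 1) = exp ((real N + 1) * ln C)"
        using C by (simp add: exp_of_nat_mult[of "N + 1" "ln C", simplified] add.commute)
      finally show ?thesis by (simp add: del H2_def exp_add exp_diff exp_minus divide_simps mult_ac)
    qed
  qed
  ultimately show ?thesis by blast
qed

section \<open>Derivatives\<close>

lemma blaschke_with_zerosD:
  assumes "blaschke_with_zeros B K a"
  shows "blaschke_seq K a" "B holomorphic_on \<D>" "\<And>z. z \<in> \<D> \<Longrightarrow> norm (B z) = norm (blaschke_prod K a z)"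
proof -
  show K: "blaschke_seq K a" using assms by (simp add: blaschke_with_zeros_def)
  obtain c where c: "norm c = 1" "\<And>z. z \<in> \<D> \<Longrightarrow> B z = c * blaschke_prod K a z"
    using assms by (auto simp: blaschke_with_zeros_def)
  have "(\<lambda>z. c * blaschke_prod K a z) holomorphic_on \<D>"
    by (intro holomorphic_intros blaschke_prod_holomorphic K)
  then show "B holomorphic_on \<D>" by (rule holomorphic_transform) (simp add: c)
  show "norm (B z) = norm (blaschke_prod K a z)" if "z \<in> \<D>" for z
    using c that by (simp add: norm_mult)
qed

text \<open>
  The remaining zeros have distance at least \<open>exp (- H z)\<close> from \<open>z\<close>, since each of them bounds the deleted
  product from above. For \<open>s\<close> well below that distance there is a point \<open>w\<close> at distance at most \<open>s\<close> where \<open>|B w|\<close>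
  is at least \<open>(c s) ^ N * exp (- X z)\<close>, with a constant \<open>c\<close> that depends on \<open>N\<close> and \<open>X = H + 15 S\<close>. For \<open>s\<close> a
  suitable multiple of \<open>exp (- X z)\<close> this is twice the Taylor remainder \<open>2 (2 s) ^ (N + 1)\<close>, and the
  derivatives must supply the difference.
\<close>

lemma deleted_imp_derivatives:
  assumes B: "blaschke_with_zeros B K a" and H: "H \<in> Har_pos"
    and lb: "\<And>z. z \<in> \<D> \<Longrightarrow> exp (- H z) \<le> norm_blaschke_del K a N z"
  shows "\<exists>H3\<in>Har_pos. \<forall>z\<in>\<D>. exp (- H3 z) \<le> (\<Sum>j=0..N. (1 - norm z) ^ j * norm ((deriv ^^ j) B z))"
proof -
  note K = blaschke_with_zerosD(1)[OF B] and hol = blaschke_with_zerosD(2)[OF B] and nB = blaschke_with_zerosD(3)[OF B]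
  obtain S where S: "blaschke_majorant K a S" using blaschke_majorant_exists[OF K] .
  note S_pos = blaschke_majorant_Har_pos[OF S]
  have disc: "a k \<in> \<D>" if "k \<in> K" for k using blaschke_seq_disc[OF K that] .
  define c where "c = 1 / (12 * (real N + 1))"
  have c: "0 < c" "c \<le> 1" by (auto simp: c_def divide_le_eq)
  \<comment> \<open>This makes \<open>(c s) ^ N * exp (- X z)\<close> equal to \<open>2 ^ (N + 3) * s ^ (N + 1)\<close> for \<open>s = exp (- X z) / C\<close>, twice the Taylor remainder.\<close>
  define C where "C = 2 ^ (N + 3) / c ^ N"
  have C: "1 < C"
  proof -
    have "c ^ N \<le> 1" using c by (simp add: power_le_one)
    moreover have "(2::real) ^ 1 \<le> 2 ^ (N + 3)" by (rule power_increasing) auto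
    ultimately show ?thesis using c by (simp add: C_def divide_simps)
  qed
  define X where "X z = H z + 15 * S z" for z
  define H3 where "H3 z = (real N + 1) * (X z + ln C)" for z
  have X: "X \<in> Har_pos" unfolding X_def by (intro Har_pos_add Har_pos_cmult H S_pos) auto
  then have "H3 \<in> Har_pos" unfolding H3_def using C by (intro Har_pos_cmult Har_pos_add_const) auto
  moreover have "exp (- H3 z) \<le> (\<Sum>j=0..N. (1 - norm z) ^ j * norm ((deriv ^^ j) B z))" if z: "z \<in> \<D>" for z
  proof -
    define M where "M = nearest_indices K a N z"
    note M = nearest_indices[OF K z, where N = N, folded M_def]
    define J where "J = K - M"
    have JK: "J \<subseteq> K" by (auto simp: J_def)
    have bJ: "blaschke_seq J a" using K JK by (rule blaschke_seq_subset)
    define q where "q = exp (- H z)"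
    have q: "q \<le> norm (blaschke_prod J a z)"
      using lb[OF z] by (simp add: norm_blaschke_del_def M_def J_def q_def)
    define s where "s = exp (- X z) / C"
    have sC: "s * 2 ^ (N + 3) = c ^ N * exp (- X z)" using c by (simp add: s_def C_def)
    have s0: "0 < s" using C by (simp add: s_def)
    have s_le: "s \<le> q / 2 ^ (N + 3)"
    proof -
      have "c ^ N * exp (- X z) \<le> 1 * q"
        using c Har_pos_pos[OF S_pos z] by (intro mult_mono) (auto simp: power_le_one X_def q_def)
      then show ?thesis using sC by (simp add: pos_le_divide_eq)
    qed
    have "q / 2 ^ (N + 3) \<le> q / 2 ^ 3"
      by (intro divide_left_mono power_increasing) (auto simp: q_def)
    moreover have "q / 2 ^ 3 = q / 8" by simp
    ultimately have s8: "s \<le> q / 8" using s_le by linarith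
    have "q \<le> 1" using Har_pos_pos[OF H z] by (simp add: q_def)
    then have s1: "s \<le> 1/8" using s8 by simp
    have rJ: "8 * s \<le> pseudohyp z (a j)" if "j \<in> J" for j
      using norm_blaschke_prod_le_pseudohyp[OF bJ that z] q s8 by linarith
    obtain w where w: "w \<in> \<D>" "norm (w - z) \<le> s * (1 - norm z)"
        "\<And>i. i \<in> M \<Longrightarrow> s / (12 * (real N + 1)) \<le> pseudohyp w (a i)"
    proof -
      have "s \<le> 1" "a ` M \<subseteq> \<D>" using s1 M(1) disc by auto
      from point_avoiding_zeros[OF z s0 this(1) M(2,3) this(2)] that show thesis by blast
    qed
    have zw: "pseudohyp z w \<le> s" by (rule pseudohyp_le_euclid[OF z w(1,2)])
    have "q \<le> norm (blaschke_prod J a z)" by (rule q)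
    also have "\<dots> \<le> exp (5 * S w) * norm (blaschke_prod J a w)"
    proof (rule blaschke_prod_compare[OF K S w(1) z JK])
      fix j assume j: "j \<in> J"
      have "pseudohyp z (a j) \<le> pseudohyp z w + pseudohyp w (a j)"
        using pseudohyp_triangle[OF z _ w(1), of "a j"] disc j JK by auto
      then show "pseudohyp z (a j) \<le> 3 * pseudohyp w (a j)" using rJ[OF j] zw s0 by linarith
    qed
    also have "\<dots> \<le> exp (15 * S z) * norm (blaschke_prod J a w)"
      using Har_pos_Harnack[OF S_pos z w(1)] zw s1 by (intro mult_right_mono) auto
    finally have "exp (- X z) \<le> norm (blaschke_prod J a w)"
      by (simp add: q_def X_def exp_diff exp_minus divide_simps mult_ac)
    moreover have "(c * s) ^ N \<le> norm (blaschke_prod M a w)"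
    proof -
      have "c * s \<le> 1 * 1" using c s0 s1 by (intro mult_mono) auto
      then have "(c * s) ^ N \<le> (c * s) ^ card M" using c s0 M(3) by (intro power_decreasing) auto
      also have "\<dots> = (\<Prod>i\<in>M. c * s)" by simp
      also have "\<dots> \<le> (\<Prod>i\<in>M. pseudohyp w (a i))"
        using c s0 w(3) by (intro prod_mono) (auto simp: c_def)
      finally show ?thesis by (simp add: norm_blaschke_prod_finite M(2))
    qed
    ultimately have "(c * s) ^ N * exp (- X z) \<le> norm (blaschke_prod M a w) * norm (blaschke_prod J a w)"
      using c s0 by (intro mult_mono) auto
    also have "\<dots> = norm (B w)"
      unfolding nB[OF w(1)] blaschke_prod_split[OF K M(1) w(1)] J_def by (simp add: norm_mult)
    also have "\<dots> \<le> (\<Sum>j=0..N. (1 - norm z) ^ j * norm ((deriv ^^ j) B z)) + 2 * (2 * s) ^ (N + 1)"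
      using s0 s1 norm_blaschke_prod_le_1[OF K] nB by (intro taylor_bound hol z w(2)) auto
    finally have "(c * s) ^ N * exp (- X z) - 2 * (2 * s) ^ (N + 1)
        \<le> (\<Sum>j=0..N. (1 - norm z) ^ j * norm ((deriv ^^ j) B z))" by simp
    moreover have "(c * s) ^ N * exp (- X z) = s ^ N * (s * 2 ^ (N + 3))"
      unfolding sC by (simp add: power_mult_distrib mult_ac)
    moreover have "s ^ N * (s * 2 ^ (N + 3)) - 2 * (2 * s) ^ (N + 1) = 2 ^ (N + 2) * s ^ (N + 1)"
      by (simp add: power_add power_mult_distrib algebra_simps)
    moreover have "1 * s ^ (N + 1) \<le> 2 ^ (N + 2) * s ^ (N + 1)"
      using s0 by (intro mult_right_mono one_le_power) auto
    moreover have "exp (- H3 z) = s ^ (N + 1)"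
    proof -
      have "s = exp (- (X z + ln C))" using C by (simp add: s_def exp_minus exp_add exp_diff divide_simps)
      then have "s ^ (N + 1) = exp (real (N + 1) * (- (X z + ln C)))" by (simp only: exp_of_nat_mult)
      also have "real (N + 1) * (- (X z + ln C)) = - H3 z" by (simp add: H3_def algebra_simps)
      finally show ?thesis by simp
    qed
    ultimately show ?thesis by linarith
  qed
  ultimately show ?thesis by blast
qed

text \<open>
  At a zero there is nothing to show. Elsewhere the distance \<open>r\<close> from \<open>z\<close> to the remaining zeros is
  positive. On the circle of radius \<open>(r / 2) (1 - |z|)\<close> about \<open>z\<close> the \<open>N\<close> deleted factors are at most
  \<open>2 r\<close> and the remaining product is comparable to its value at \<open>z\<close>, so Cauchy's inequalities bound the sum of
  derivatives by a multiple of the deleted product at \<open>z\<close>, the powers of \<open>r\<close> cancelling.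
\<close>

lemma derivatives_imp_lower_bound:
  assumes B: "blaschke_with_zeros B K a" and N: "N \<ge> 1" and H: "H \<in> Har_pos"
    and lb: "\<And>z. z \<in> \<D> \<Longrightarrow> exp (- H z) \<le> (\<Sum>j=0..N. (1 - norm z) ^ j * norm ((deriv ^^ j) B z))"
  shows "\<exists>H1\<in>Har_pos. \<forall>z\<in>\<D>. exp (- H1 z) * pseudohyp_set z (a ` K) ^ N \<le> norm (B z)"
proof -
  note K = blaschke_with_zerosD(1)[OF B] and hol = blaschke_with_zerosD(2)[OF B] and nB = blaschke_with_zerosD(3)[OF B]
  obtain S where S: "blaschke_majorant K a S" using blaschke_majorant_exists[OF K] .
  note S_pos = blaschke_majorant_Har_pos[OF S]
  have disc: "a k \<in> \<D>" if "k \<in> K" for k using blaschke_seq_disc[OF K that] .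
  \<comment> \<open>The number of terms, the factorials in Cauchy's inequalities, and \<open>(2 / r) ^ N * (2 * r) ^ N\<close>.\<close>
  define C :: real where "C = (real N + 1) * fact N * 4 ^ N"
  have C: "1 < C"
  proof -
    have "1 * 1 * 4 ^ 1 \<le> C" unfolding C_def using N
      by (intro mult_mono power_increasing fact_ge_1) auto
    then show ?thesis by simp
  qed
  define H1 where "H1 z = (H z + 5 * S z) + ln C" for z
  have H1: "H1 \<in> Har_pos" unfolding H1_def using C by (intro Har_pos_add_const Har_pos_add Har_pos_cmult H S_pos) auto
  moreover have "exp (- H1 z) * pseudohyp_set z (a ` K) ^ N \<le> norm (B z)" if z: "z \<in> \<D>" for z
  proof (cases "z \<in> a ` K")
    case True
    then have "pseudohyp_set z (a ` K) = 0" using pseudohyp_set_le[of z "a ` K" z] pseudohyp_set_nonneg[of z "a ` K"] by simp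
    then show ?thesis using N by (cases N) auto
  next
    case False
    define M where "M = nearest_indices K a N z"
    note M = nearest_indices[OF K z, where N = N, folded M_def]
    define J where "J = K - M"
    have JK: "J \<subseteq> K" by (auto simp: J_def)
    have bJ: "blaschke_seq J a" using K JK by (rule blaschke_seq_subset)
    have "exp (- H1 z) \<le> norm (blaschke_prod J a z)"
    proof (cases "J = {}")
      case True
      then show ?thesis using Har_pos_pos[OF H1 z] by simp
    next
      case ne: False
      then have cM: "card M = N" using M(4) by (simp add: J_def)
      define r where "r = pseudohyp_set z (a ` J)"
      have aJ: "a ` J \<subseteq> \<D>" "z \<notin> a ` J" using disc JK False by blast+
      have r: "0 < r" "r \<le> 1" unfolding r_def
        using pseudohyp_set_pos[OF bJ z aJ(2)] pseudohyp_set_le_1[OF z aJ(1)] by auto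
      have rJ: "r \<le> pseudohyp z (a j)" if "j \<in> J" for j
        unfolding r_def using that by (intro pseudohyp_set_le) auto
      have rM: "pseudohyp z (a i) \<le> r" if "i \<in> M" for i unfolding r_def
        by (rule pseudohyp_set_greatest) (use M(1,5) that z disc[THEN pseudohyp_le_1[OF z]] in \<open>auto simp: J_def\<close>)
      define R where "R = r / 2 * (1 - norm z)"
      have R: "0 < R" using r z by (simp add: R_def)
      define T where "T = (2 * r) ^ N * (exp (5 * S z) * norm (blaschke_prod J a z))"
      have sub: "cball z R \<subseteq> \<D>"
      proof
        fix x assume x: "x \<in> cball z R"
        have "R \<le> 1/2 * (1 - norm z)" unfolding R_def using r z by (intro mult_right_mono) auto
        then show "x \<in> \<D>" using x z norm_triangle_ineq2[of x z] by (simp add: dist_norm norm_minus_commute)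
      qed
      have T: "norm (B w) \<le> T" if wR: "norm (z - w) = R" for w
      proof -
        have w: "w \<in> \<D>" using sub wR by (auto simp: dist_norm)
        have zw: "pseudohyp z w \<le> r / 2"
          by (rule pseudohyp_le_euclid[OF z w]) (use wR in \<open>simp add: R_def norm_minus_commute\<close>)
        have "norm (B w) \<le> (2 * r) ^ card M * norm (blaschke_prod J a w)"
          unfolding nB[OF w] J_def
        proof (rule norm_blaschke_prod_power_le[OF K w M(1,2)])
          fix i assume i: "i \<in> M"
          have "pseudohyp w (a i) \<le> pseudohyp z w + pseudohyp z (a i)"
            using pseudohyp_triangle[OF w _ z, of "a i"] disc i M(1) by (auto simp: pseudohyp_commute[of w z])
          then show "pseudohyp w (a i) \<le> 2 * r" using rM[OF i] zw r by simp
        qed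
        also have "norm (blaschke_prod J a w) \<le> exp (5 * S z) * norm (blaschke_prod J a z)"
        proof (rule blaschke_prod_compare[OF K S z w JK])
          fix j assume j: "j \<in> J"
          have "pseudohyp w (a j) \<le> pseudohyp z w + pseudohyp z (a j)"
            using pseudohyp_triangle[OF w _ z, of "a j"] disc j JK by (auto simp: pseudohyp_commute[of w z])
          then show "pseudohyp w (a j) \<le> 3 * pseudohyp z (a j)" using rJ[OF j] zw r by simp
        qed
        finally show ?thesis using r by (simp add: T_def cM mult_left_mono)
      qed
      have T0: "0 \<le> T" using r by (simp add: T_def)
      have le_T: "(1 - norm z) ^ j * norm ((deriv ^^ j) B z) \<le> fact N * (2 / r) ^ N * T" if "j \<le> N" for j
      proof -
        have "norm ((deriv ^^ j) B z) \<le> fact j * T / R ^ j"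
        proof (rule Cauchy_inequality)
          show "B holomorphic_on ball z R" using hol by (rule holomorphic_on_subset) (use sub ball_subset_cball in blast)
          show "continuous_on (cball z R) B"
            using holomorphic_on_imp_continuous_on[OF hol] sub by (rule continuous_on_subset)
        qed (use R T in auto)
        then have "(1 - norm z) ^ j * norm ((deriv ^^ j) B z) \<le> (1 - norm z) ^ j * (fact j * T / R ^ j)"
          using z by (intro mult_left_mono) auto
        also have "\<dots> = fact j * (2 / r) ^ j * T"
          using z by (simp add: R_def power_mult_distrib power_divide)
        also have "\<dots> \<le> fact N * (2 / r) ^ N * T"
          using r T0 that by (intro mult_right_mono mult_mono power_increasing fact_mono) (auto simp: le_divide_eq)
        finally show ?thesis .
      qed
      have "(\<Sum>j=0..N. (1 - norm z) ^ j * norm ((deriv ^^ j) B z)) \<le> (\<Sum>j=0..N. fact N * (2 / r) ^ N * T)"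
        by (rule sum_mono) (rule le_T, simp)
      then have "exp (- H z) \<le> (\<Sum>j=0..N. fact N * (2 / r) ^ N * T)"
        using lb[OF z] by linarith
      also have "\<dots> = (real N + 1) * (fact N * (2 / r) ^ N * T)" by (simp add: add.commute)
      also have "\<dots> = (real N + 1) * fact N * ((2 / r) ^ N * (2 * r) ^ N) * (exp (5 * S z) * norm (blaschke_prod J a z))"
        unfolding T_def by (simp only: mult.assoc)
      also have "(2 / r) ^ N * (2 * r) ^ N = ((2 / r) * (2 * r)) ^ N" by (simp only: power_mult_distrib)
      also have "(2 / r) * (2 * r) = 4" using r by simp
      also have "(real N + 1) * fact N * 4 ^ N = C" by (simp add: C_def)
      also have "C = exp (ln C)" using C by simp
      finally have "exp (- H z) \<le> exp (ln C) * (exp (5 * S z) * norm (blaschke_prod J a z))" .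
      then have "exp (- H z) \<le> exp (5 * S z + ln C) * norm (blaschke_prod J a z)"
        by (simp only: exp_add mult_ac)
      moreover have "- H z = 5 * S z + ln C + - H1 z" by (simp add: H1_def)
      ultimately have "exp (5 * S z + ln C) * exp (- H1 z) \<le> exp (5 * S z + ln C) * norm (blaschke_prod J a z)"
        by (simp only: exp_add)
      then show ?thesis by (simp only: mult_le_cancel_left_pos exp_gt_zero)
    qed
    then have "exp (- H1 z) * pseudohyp_set z (a ` K) ^ N \<le> norm (blaschke_prod K a z)"
      by (intro deleted_imp_lower_bound[OF K z]) (auto simp: norm_blaschke_del_def M_def J_def)
    then show ?thesis by (simp add: nB[OF z])
  qed
  ultimately show ?thesis by blast
qed

section \<open>Factorization and the equivalence\<close>

text \<open>
  The \<open>N\<close> indices of zeros nearest to \<open>a i\<close> include \<open>i\<close>; link \<open>i\<close> to the others among them. All further zeros have distance at least \<open>exp (- H (a i))\<close>. A greedy colouring gives earlier linked zeros a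
  different colour, so two zeros of equal colour have distance at least \<open>exp (- H)\<close> at the later
  one, and by Harnack's inequality at the earlier one as well. In a colour class, the product over the other
  zeros then consists of at most \<open>N\<close> factors bounded below and a part of the deleted product.
\<close>

lemma deleted_imp_factorization:
  assumes B: "blaschke_with_zeros B K a" and N: "N \<ge> 1" and H: "H \<in> Har_pos"
    and lb: "\<And>z. z \<in> \<D> \<Longrightarrow> exp (- H z) \<le> norm_blaschke_del K a N z"
  shows "\<exists>F :: nat \<Rightarrow> complex \<Rightarrow> complex.
      (\<forall>i<N. nevanlinna_interpolating_blaschke (F i)) \<and> (\<forall>z\<in>\<D>. B z = (\<Prod>i<N. F i z))"
proof -
  note K = blaschke_with_zerosD(1)[OF B]
  have disc: "a k \<in> \<D>" if "k \<in> K" for k using blaschke_seq_disc[OF K that] .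
  define M where "M i = nearest_indices K a N (a i)" for i
  note M = nearest_indices[OF K disc, where N = N, folded M_def]
  have del: "exp (- H (a i)) \<le> norm (blaschke_prod (K - M i) a (a i))" if "i \<in> K" for i
    using lb[OF disc[OF that]] by (simp add: norm_blaschke_del_def M_def)
  have bM: "blaschke_seq (K - M i) a" for i using K by (rule blaschke_seq_subset) auto
  have self: "i \<in> M i" if "i \<in> K" for i
  proof (rule ccontr)
    assume "i \<notin> M i"
    then have "blaschke_prod (K - M i) a (a i) = 0" using that by (intro blaschke_prod_at_zero bM) auto
    then show False using del[OF that] by simp
  qed
  have far: "exp (- H (a i)) \<le> pseudohyp (a i) (a j)" if "i \<in> K" "j \<in> K" "j \<notin> M i" for i j
    using del[OF that(1)] norm_blaschke_prod_le_pseudohyp[OF bM _ disc[OF that(1)], of j] that by force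
  define R where "R i = (if i \<in> K then M i - {i} else {})" for i
  have R: "finite (R i)" "card (R i) < N" for i
  proof -
    show "finite (R i)" using M(2)[of i] by (simp add: R_def)
    show "card (R i) < N"
    proof (cases "i \<in> K")
      case True
      then have "card (M i - {i}) < card (M i)" using M(2) self by (intro card_Diff1_less) auto
      then show ?thesis using M(3)[OF True] True by (simp add: R_def)
    qed (use N in \<open>simp add: R_def\<close>)
  qed
  obtain col :: "nat \<Rightarrow> nat" where col: "\<And>i. col i < N" "\<And>i j. j \<in> R i \<Longrightarrow> j < i \<Longrightarrow> col j \<noteq> col i"
    using greedy_colouring[of R N, OF R] by blast
  define C where "C c = {i \<in> K. col i = c}" for c
  have CK: "C c \<subseteq> K" for c by (auto simp: C_def)
  have bC: "blaschke_seq (C c) a" for c using K CK by (rule blaschke_seq_subset)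
  have earlier: "exp (- H (a i)) \<le> pseudohyp (a i) (a j)" if "i \<in> C c" "j \<in> C c" "j < i" for i j c
  proof (rule far)
    show "j \<notin> M i" using col(2)[of j i] that by (auto simp: R_def C_def)
  qed (use that CK in auto)
  \<comment> \<open>The factor \<open>3\<close> is Harnack's constant for zeros at distance at most \<open>1/2\<close>; as \<open>exp (- 1) \<le> 1/2\<close>, the summand \<open>1\<close> covers the others.\<close>
  define H' where "H' z = 3 * H z + 1" for z
  have H': "H' \<in> Har_pos" unfolding H'_def by (intro Har_pos_add_const Har_pos_cmult H) auto
  have sep: "exp (- H' (a i)) \<le> pseudohyp (a i) (a j)" if ij: "i \<in> C c" "j \<in> C c" "i \<noteq> j" for i j c
  proof -
    have iK: "a i \<in> \<D>" and jK: "a j \<in> \<D>" using ij CK disc by blast+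
    have Hi: "0 < H (a i)" using Har_pos_pos[OF H iK] .
    consider "j < i" | "i < j" "1/2 \<le> pseudohyp (a i) (a j)" | "i < j" "pseudohyp (a i) (a j) \<le> 1/2"
      using ij(3) by linarith
    then show ?thesis
    proof cases
      case 1
      have "exp (- H' (a i)) \<le> exp (- H (a i))" using Hi by (simp add: H'_def)
      then show ?thesis using earlier[OF ij(1,2) 1] by linarith
    next
      case 2
      have "exp (- H' (a i)) \<le> exp (- 1)" using Hi by (simp add: H'_def)
      also have "exp (- 1) \<le> (1/2 :: real)"
        using exp_ge_add_one_self[of "1::real"] by (simp add: exp_minus inverse_eq_divide divide_le_eq)
      finally show ?thesis using 2 by linarith
    next
      case 3
      have "exp (- H' (a i)) \<le> exp (- H (a j))"
        using Har_pos_Harnack[OF H iK jK 3(2)] by (simp add: H'_def)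
      also have "\<dots> \<le> pseudohyp (a i) (a j)"
        using earlier[OF ij(2,1) 3(1)] by (simp add: pseudohyp_commute)
      finally show ?thesis .
    qed
  qed
  have int: "nevanlinna_interpolating (C c) a" for c
  proof (rule nevanlinna_interpolating_if_separated[OF bC])
    show "inj_on a (C c)"
    proof (rule inj_onI, rule ccontr)
      fix i j assume "i \<in> C c" "j \<in> C c" "a i = a j" "i \<noteq> j"
      then show False using sep[of i c j] by simp
    qed
    show "(\<lambda>z. real N * H' z + H z) \<in> Har_pos" using N by (intro Har_pos_add Har_pos_cmult H H') auto
    fix k assume k: "k \<in> C c"
    then have kK: "k \<in> K" using CK by blast
    have ak: "a k \<in> \<D>" using disc[OF kK] .
    define A where "A = (C c \<inter> M k) - {k}"
    have A: "finite A" "card A \<le> N"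
    proof -
      show "finite A" using M(2)[OF kK] by (simp add: A_def)
      have "card A \<le> card (M k)" using M(2)[OF kK] by (intro card_mono) (auto simp: A_def)
      then show "card A \<le> N" using M(3)[OF kK] by simp
    qed
    have H'k: "0 < H' (a k)" using Har_pos_pos[OF H' ak] .
    have "exp (- (real N * H' (a k))) = exp (- H' (a k)) ^ N" by (simp flip: exp_of_nat_mult)
    also have "\<dots> \<le> exp (- H' (a k)) ^ card A" using A H'k by (intro power_decreasing) auto
    also have "\<dots> = (\<Prod>j\<in>A. exp (- H' (a k)))" by simp
    also have "\<dots> \<le> (\<Prod>j\<in>A. pseudohyp (a k) (a j))"
      using sep[OF k] by (intro prod_mono) (auto simp: A_def)
    also have "\<dots> = norm (blaschke_prod A a (a k))" using A by (simp add: norm_blaschke_prod_finite)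
    finally have 1: "exp (- (real N * H' (a k))) \<le> norm (blaschke_prod A a (a k))" .
    have "exp (- H (a k)) \<le> norm (blaschke_prod (K - M k) a (a k))" by (rule del[OF kK])
    also have "\<dots> \<le> norm (blaschke_prod (C c - M k) a (a k))"
      by (rule norm_blaschke_prod_antimono[OF bM _ ak]) (use CK in auto)
    finally have 2: "exp (- H (a k)) \<le> norm (blaschke_prod (C c - M k) a (a k))" .
    have e: "C c - {k} = A \<union> (C c - M k)" using self[OF kK] by (auto simp: A_def)
    have "blaschke_prod (C c - {k}) a (a k) = blaschke_prod A a (a k) * blaschke_prod (C c - M k) a (a k)"
      unfolding e
    proof (rule blaschke_prod_Un[OF _ _ ak])
      show "blaschke_seq (A \<union> (C c - M k)) a" using bC[of c] by (rule blaschke_seq_subset) (auto simp: A_def)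
    qed (auto simp: A_def)
    moreover have "exp (- (real N * H' (a k) + H (a k))) = exp (- (real N * H' (a k))) * exp (- H (a k))"
      by (simp flip: exp_add)
    ultimately show "exp (- (real N * H' (a k) + H (a k))) \<le> norm (blaschke_prod (C c - {k}) a (a k))"
      using 1 2 by (simp add: norm_mult mult_mono)
  qed
  obtain u where u: "norm u = 1" "\<And>z. z \<in> \<D> \<Longrightarrow> B z = u * blaschke_prod K a z"
    using B by (auto simp: blaschke_with_zeros_def)
  \<comment> \<open>The unimodular constant of \<open>B\<close> goes to the first factor; colours may be unused, their factor is constant.\<close>
  define F where "F c z = (if c = 0 then u else 1) * blaschke_prod (C c) a z" for c z
  have "nevanlinna_interpolating_blaschke (F c)" for c
  proof -
    have "blaschke_with_zeros (F c) (C c) a" unfolding blaschke_with_zeros_def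
      using bC u(1) by (intro conjI exI[of _ "if c = 0 then u else 1"]) (auto simp: F_def)
    then show ?thesis using int unfolding nevanlinna_interpolating_blaschke_def by blast
  qed
  moreover have "B z = (\<Prod>c<N. F c z)" if z: "z \<in> \<D>" for z
  proof -
    have UK: "K = (\<Union>c\<in>{..<N}. C c)" using col(1) by (auto simp: C_def)
    have "blaschke_prod K a z = (\<Prod>c<N. blaschke_prod (C c) a z)"
    proof -
      have "disjoint_family_on C {..<N}" by (auto simp: disjoint_family_on_def C_def)
      from blaschke_prod_UN[OF finite_lessThan _ this z] K show ?thesis by (simp only: UK[symmetric])
    qed
    moreover have "(\<Prod>c<N. if c = 0 then u else 1) = u" using N by (subst prod.delta) auto
    ultimately show ?thesis using u(2)[OF z] by (simp add: F_def prod.distrib)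
  qed
  ultimately show ?thesis by blast
qed

text \<open>
  Each factor satisfies the bound with exponent \<open>1\<close> for its own zeros, and these are zeros of \<open>B\<close>, so their
  distance from \<open>z\<close> is at least that of the zero set of \<open>B\<close>.
\<close>

lemma factorization_imp_lower_bound:
  assumes B: "blaschke_with_zeros B K a" and N: "N \<ge> 1"
    and F: "\<And>i. i < N \<Longrightarrow> nevanlinna_interpolating_blaschke (F i)" "\<And>z. z \<in> \<D> \<Longrightarrow> B z = (\<Prod>i<N. F i z)"
  shows "\<exists>H1\<in>Har_pos. \<forall>z\<in>\<D>. exp (- H1 z) * pseudohyp_set z (a ` K) ^ N \<le> norm (B z)"
proof -
  note K = blaschke_with_zerosD(1)[OF B] and nB = blaschke_with_zerosD(3)[OF B]
  have aK: "a ` K \<subseteq> \<D>" using blaschke_seq_disc[OF K] by blast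
  have "\<exists>H\<in>Har_pos. \<forall>z\<in>\<D>. exp (- H z) * pseudohyp_set z (a ` K) \<le> norm (F i z)" if i: "i < N" for i
  proof -
    obtain K' a' where F': "blaschke_with_zeros (F i) K' a'" "nevanlinna_interpolating K' a'"
      using F(1)[OF i] by (auto simp: nevanlinna_interpolating_blaschke_def)
    note K' = blaschke_with_zerosD(1)[OF F'(1)] and nF = blaschke_with_zerosD(3)[OF F'(1)]
    have "a' ` K' \<subseteq> a ` K"
    proof
      fix x assume "x \<in> a' ` K'"
      then obtain k where k: "k \<in> K'" "x = a' k" by auto
      have x: "x \<in> \<D>" using blaschke_seq_disc[OF K' k(1)] k by simp
      have "F i x = 0" using nF[OF x] blaschke_prod_at_zero[OF K' k(1)] k by simp
      then have "B x = 0" using F(2)[OF x] i by (auto simp: prod_zero_iff)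
      then show "x \<in> a ` K" using nB[OF x] blaschke_prod_nonzero[OF K x] by auto
    qed
    then have le: "pseudohyp_set z (a ` K) \<le> pseudohyp_set z (a' ` K')" if "z \<in> \<D>" for z
      using that aK by (intro pseudohyp_set_antimono)
    obtain H0 where H0: "H0 \<in> Har_pos" "\<And>k. k \<in> K' \<Longrightarrow> exp (- H0 (a' k)) \<le> norm (blaschke_prod (K' - {k}) a' (a' k))"
      using separated_if_nevanlinna_interpolating[OF K' F'(2)] by blast
    obtain H where H: "H \<in> Har_pos" "\<And>z. z \<in> \<D> \<Longrightarrow> exp (- H z) * pseudohyp_set z (a' ` K') \<le> norm (blaschke_prod K' a' z)"
      using one_zero_lower_bound[OF K' H0] by blast
    have "exp (- H z) * pseudohyp_set z (a ` K) \<le> norm (F i z)" if z: "z \<in> \<D>" for z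
    proof -
      have "exp (- H z) * pseudohyp_set z (a ` K) \<le> exp (- H z) * pseudohyp_set z (a' ` K')"
        by (intro mult_left_mono le z) auto
      then show ?thesis using H(2)[OF z] nF[OF z] by linarith
    qed
    then show ?thesis using H(1) by blast
  qed
  then obtain H where H: "\<And>i. i < N \<Longrightarrow> H i \<in> Har_pos"
    "\<And>i z. i < N \<Longrightarrow> z \<in> \<D> \<Longrightarrow> exp (- H i z) * pseudohyp_set z (a ` K) \<le> norm (F i z)" by metis
  have "0 \<in> {..<N}" using N by simp
  then have "(\<lambda>z. \<Sum>i<N. H i z) \<in> Har_pos" using H(1) by (intro Har_pos_sum) auto
  moreover have "exp (- (\<Sum>i<N. H i z)) * pseudohyp_set z (a ` K) ^ N \<le> norm (B z)" if z: "z \<in> \<D>" for z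
  proof -
    have "exp (- (\<Sum>i<N. H i z)) * pseudohyp_set z (a ` K) ^ N = (\<Prod>i<N. exp (- H i z) * pseudohyp_set z (a ` K))"
      by (simp add: prod.distrib exp_sum flip: sum_negf)
    also have "\<dots> \<le> (\<Prod>i<N. norm (F i z))" using H(2)[OF _ z] by (intro prod_mono) auto
    also have "\<dots> = norm (B z)" by (simp add: F(2)[OF z] prod_norm)
    finally show ?thesis .
  qed
  ultimately show ?thesis by (intro bexI[of _ "\<lambda>z. \<Sum>i<N. H i z"] ballI)
qed

theorem theoremC:
  fixes B :: "complex \<Rightarrow> complex" and K :: "nat set" and a :: "nat \<Rightarrow> complex" and N :: nat
  assumes "blaschke_with_zeros B K a" and "N \<ge> 1"
  defines "A1 \<equiv> \<exists>F :: nat \<Rightarrow> complex \<Rightarrow> complex.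
      (\<forall>i<N. nevanlinna_interpolating_blaschke (F i)) \<and> (\<forall>z\<in>\<D>. B z = (\<Prod>i<N. F i z))"
    and "A2 \<equiv> \<exists>H1\<in>Har_pos. \<forall>z\<in>\<D>.
      norm (B z) \<ge> exp (- H1 z) * pseudohyp_set z (a ` K) ^ N"
    and "A3 \<equiv> \<exists>H2\<in>Har_pos. \<forall>z\<in>\<D>. norm_blaschke_del K a N z \<ge> exp (- H2 z)"
    and "A4 \<equiv> \<exists>H3\<in>Har_pos. \<forall>z\<in>\<D>.
      (\<Sum>j=0..N. (1 - norm z) ^ j * norm ((deriv ^^ j) B z)) \<ge> exp (- H3 z)"
  shows "(A1 \<longleftrightarrow> A2) \<and> (A2 \<longleftrightarrow> A3) \<and> (A3 \<longleftrightarrow> A4)"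
proof -
  note B = assms(1) and N = assms(2)
  have A1_A2: A2 if A1: A1
  proof -
    obtain F where "\<And>i. i < N \<Longrightarrow> nevanlinna_interpolating_blaschke (F i)"
        "\<And>z. z \<in> \<D> \<Longrightarrow> B z = (\<Prod>i<N. F i z)"
      using A1 unfolding A1_def by blast
    from factorization_imp_lower_bound[OF B N this] show ?thesis unfolding A2_def .
  qed
  have A2_A3: A3 if A2: A2
  proof -
    obtain H1 where H1: "H1 \<in> Har_pos"
        "\<And>z. z \<in> \<D> \<Longrightarrow> exp (- H1 z) * pseudohyp_set z (a ` K) ^ N \<le> norm (B z)"
      using A2 unfolding A2_def by blast
    have "exp (- H1 z) * pseudohyp_set z (a ` K) ^ N \<le> norm (blaschke_prod K a z)" if "z \<in> \<D>" for z
      using H1(2)[OF that] blaschke_with_zerosD(3)[OF B that] by simp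
    from lower_bound_imp_deleted[OF blaschke_with_zerosD(1)[OF B] H1(1) this] show ?thesis
      unfolding A3_def .
  qed
  have A3_A1: A1 and A3_A4: A4 if A3: A3
  proof -
    obtain H2 where H2: "H2 \<in> Har_pos" "\<And>z. z \<in> \<D> \<Longrightarrow> exp (- H2 z) \<le> norm_blaschke_del K a N z"
      using A3 unfolding A3_def by blast
    from deleted_imp_factorization[OF B N H2] show A1 unfolding A1_def .
    from deleted_imp_derivatives[OF B H2] show A4 unfolding A4_def .
  qed
  have A4_A2: A2 if A4: A4
  proof -
    obtain H3 where "H3 \<in> Har_pos"
        "\<And>z. z \<in> \<D> \<Longrightarrow> exp (- H3 z) \<le> (\<Sum>j=0..N. (1 - norm z) ^ j * norm ((deriv ^^ j) B z))"
      using A4 unfolding A4_def by blast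
    from derivatives_imp_lower_bound[OF B N this] show ?thesis unfolding A2_def .
  qed
  show ?thesis using A1_A2 A2_A3 A3_A1 A3_A4 A4_A2 by satx
qed

end
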